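(* Let $X$ and $Y$ be coarse disjoint unions of expander graphs. If the uniform Roe algebras $\mathrm C^*_u(X)$ and $\mathrm C^*_u(Y)$ are isomorphic (as $\mathrm C^*$-algebras), then $X$ and $Y$ are bijectively coarsely equivalent.
   Context: A metric space is uniformly locally finite (u.l.f.) if for each $r>0$ there is a uniform bound on the cardinality of its balls of radius $r$. For a u.l.f. metric space $(X,d_X)$, let $(\delta_x)_{x\in X}$ be the standard orthonormal basis of the complex Hilbert space $\ell_2(X)$. The propagation of $a\in\mathcal B(\ell_2(X))$ is $\mathrm{prop}(a)=\sup\{d_X(x,z)\mid\langle a\delta_x,\delta_z\rangle\ne0\}$. The uniform Roe algebra $\mathrm C^*_u(X)$ is the norm closure of the set of all operators in $\mathcal B(\ell_2(X))$ with finite propagation. Two maps $f,g\colon X\to(Y,d_Y)$ from a set into a metric space are close if $\sup_{x\in X}d_Y(f(x),g(x))<\infty$. A map $f\colon(X,d_X)\to(Y,d_Y)$ between metric spaces is coarse if for all $r>0$ there is $s>0$ such that $d_X(x,z)<r$ implies $d_Y(f(x),f(z))<s$. A coarse map $f\colon X\to Y$ is a coarse equivalence if there is a coarse map $g\colon Y\to X$ such that $g\circ f$ and $f\circ g$ are close to the respective identity maps. $X$ and $Y$ are bijectively coarsely equivalent if there is a bijection $X\to Y$ which is a coarse equivalence. Graphs are simple, unweighted and undirected, and are identified with their vertex sets equipped with the shortest path metric. For a subset $A$ of a graph $X$, $\partial(A)=\{x\in X\setminus A\mid d_X(x,A)\le 1\}$. For $k\in\mathbb N$ and $h>0$, a finite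 graph $X$ is a $(k,h)$-expander graph if each vertex is incident to at most $k$ edges and $|\partial(A)|\ge h\big(1-\frac{|A|}{|X|}\big)|A|$ for all $A\subseteq X$. A sequence $(X_n)_n$ of finite graphs is a sequence of expander graphs if there are $k\in\mathbb N$ and $h>0$ such that each $X_n$ is a $(k,h)$-expander graph, and $|X_n|\to\infty$ as $n\to\infty$. A coarse disjoint union of a sequence $(X_n)_{n\in\mathbb N}$ of finite metric spaces is the disjoint union $\bigsqcup_nX_n$ equipped with any metric $d$ that restricts to the given metric on each $X_n$ and satisfies $d(X_n,X_m)\to\infty$ as $(n,m)\to\infty$ in $\{(n,m)\in\mathbb N^2\mid n\ne m\}$ (i.e., for each $R$, $d(X_n,X_m)>R$ for all but finitely many pairs $n\neq m$). A coarse disjoint union of expander graphs is a coarse disjoint union of a sequence of expander graphs; it is automatically u.l.f. *)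

theory Defs
  imports "HOL-Analysis.Analysis"
begin

section \<open>The Hilbert space of square-summable functions on a set\<close>

text \<open>
  Vectors are functions on the whole type vanishing outside \<open>X\<close>, so that equality of vectors
  is equality of functions.
\<close>

definition ell2 :: "'a set \<Rightarrow> ('a \<Rightarrow> complex) set" where
  "ell2 X = {f. (\<forall>x. x \<notin> X \<longrightarrow> f x = 0) \<and> (\<lambda>x. (cmod (f x))\<^sup>2) summable_on X}"

definition ell2_inner :: "'a set \<Rightarrow> ('a \<Rightarrow> complex) \<Rightarrow> ('a \<Rightarrow> complex) \<Rightarrow> complex" where
  "ell2_inner X f g = (\<Sum>\<^sub>\<infinity>x\<in>X. f x * cnj (g x))"

definition ell2_norm :: "'a set \<Rightarrow> ('a \<Rightarrow> complex) \<Rightarrow> real" where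
  "ell2_norm X f = sqrt (\<Sum>\<^sub>\<infinity>x\<in>X. (cmod (f x))\<^sup>2)"

definition ell2_basis :: "'a \<Rightarrow> 'a \<Rightarrow> complex" where
  "ell2_basis x = (\<lambda>z. if z = x then 1 else 0)"

section \<open>Bounded operators\<close>

text \<open>
  Operators are extensional functions (\<open>undefined\<close> outside \<open>ell2 X\<close>), so that equality of
  operators is equality of functions; composition of operators is \<open>compose (ell2 X)\<close>.
\<close>

definition bounded_ops :: "'a set \<Rightarrow> (('a \<Rightarrow> complex) \<Rightarrow> ('a \<Rightarrow> complex)) set" where
  "bounded_ops X = {a \<in> ell2 X \<rightarrow>\<^sub>E ell2 X.
     (\<forall>f\<in>ell2 X. \<forall>g\<in>ell2 X. a (\<lambda>x. f x + g x) = (\<lambda>x. a f x + a g x)) \<and>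
     (\<forall>c. \<forall>f\<in>ell2 X. a (\<lambda>x. c * f x) = (\<lambda>x. c * a f x)) \<and>
     (\<exists>C. \<forall>f\<in>ell2 X. ell2_norm X (a f) \<le> C * ell2_norm X f)}"

definition op_add ::
  "'a set \<Rightarrow> (('a \<Rightarrow> complex) \<Rightarrow> ('a \<Rightarrow> complex)) \<Rightarrow> (('a \<Rightarrow> complex) \<Rightarrow> ('a \<Rightarrow> complex))
    \<Rightarrow> (('a \<Rightarrow> complex) \<Rightarrow> ('a \<Rightarrow> complex))" where
  "op_add X a b = (\<lambda>f\<in>ell2 X. \<lambda>x. a f x + b f x)"

definition op_scale ::
  "'a set \<Rightarrow> complex \<Rightarrow> (('a \<Rightarrow> complex) \<Rightarrow> ('a \<Rightarrow> complex))
    \<Rightarrow> (('a \<Rightarrow> complex) \<Rightarrow> ('a \<Rightarrow> complex))" where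
  "op_scale X c a = (\<lambda>f\<in>ell2 X. \<lambda>x. c * a f x)"

definition op_adjoint ::
  "'a set \<Rightarrow> (('a \<Rightarrow> complex) \<Rightarrow> ('a \<Rightarrow> complex)) \<Rightarrow> (('a \<Rightarrow> complex) \<Rightarrow> ('a \<Rightarrow> complex))" where
  "op_adjoint X a = (THE b. b \<in> bounded_ops X \<and>
     (\<forall>f\<in>ell2 X. \<forall>g\<in>ell2 X. ell2_inner X (a f) g = ell2_inner X f (b g)))"

definition op_norm :: "'a set \<Rightarrow> (('a \<Rightarrow> complex) \<Rightarrow> ('a \<Rightarrow> complex)) \<Rightarrow> real" where
  "op_norm X a = (SUP f\<in>{f \<in> ell2 X. ell2_norm X f \<le> 1}. ell2_norm X (a f))"

section \<open>Uniform Roe algebras\<close>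

definition propagation ::
  "'a set \<Rightarrow> ('a \<Rightarrow> 'a \<Rightarrow> real) \<Rightarrow> (('a \<Rightarrow> complex) \<Rightarrow> ('a \<Rightarrow> complex)) \<Rightarrow> ennreal" where
  "propagation X d a =
     Sup {ennreal (d x z) | x z. x \<in> X \<and> z \<in> X \<and>
            ell2_inner X (a (ell2_basis x)) (ell2_basis z) \<noteq> 0}"

definition uniform_roe ::
  "'a set \<Rightarrow> ('a \<Rightarrow> 'a \<Rightarrow> real) \<Rightarrow> (('a \<Rightarrow> complex) \<Rightarrow> ('a \<Rightarrow> complex)) set" where
  "uniform_roe X d = {a \<in> bounded_ops X. \<forall>\<epsilon>>0. \<exists>b\<in>bounded_ops X.
     propagation X d b < \<infinity> \<and> op_norm X (op_add X a (op_scale X (-1) b)) < \<epsilon>}"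

text \<open>
  Isomorphism of C*-algebras, for algebras of operators \<open>A\<close> on \<open>ell2 X\<close> and \<open>B\<close> on
  \<open>ell2 Y\<close>. Such a map is automatically isometric, so the norm is not mentioned.
\<close>

definition star_isomorphism ::
  "'a set \<Rightarrow> (('a \<Rightarrow> complex) \<Rightarrow> ('a \<Rightarrow> complex)) set
    \<Rightarrow> 'b set \<Rightarrow> (('b \<Rightarrow> complex) \<Rightarrow> ('b \<Rightarrow> complex)) set
    \<Rightarrow> ((('a \<Rightarrow> complex) \<Rightarrow> ('a \<Rightarrow> complex)) \<Rightarrow> (('b \<Rightarrow> complex) \<Rightarrow> ('b \<Rightarrow> complex)))
    \<Rightarrow> bool" where
  "star_isomorphism X A Y B \<Phi> \<longleftrightarrow>
     bij_betw \<Phi> A B \<and>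
     (\<forall>a\<in>A. \<forall>b\<in>A. \<Phi> (op_add X a b) = op_add Y (\<Phi> a) (\<Phi> b)) \<and>
     (\<forall>c. \<forall>a\<in>A. \<Phi> (op_scale X c a) = op_scale Y c (\<Phi> a)) \<and>
     (\<forall>a\<in>A. \<forall>b\<in>A. \<Phi> (compose (ell2 X) a b) = compose (ell2 Y) (\<Phi> a) (\<Phi> b)) \<and>
     (\<forall>a\<in>A. \<Phi> (op_adjoint X a) = op_adjoint Y (\<Phi> a))"

definition uniform_roe_isomorphic ::
  "'a set \<Rightarrow> ('a \<Rightarrow> 'a \<Rightarrow> real) \<Rightarrow> 'b set \<Rightarrow> ('b \<Rightarrow> 'b \<Rightarrow> real) \<Rightarrow> bool" where
  "uniform_roe_isomorphic X dX Y dY \<longleftrightarrow>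
     (\<exists>\<Phi>. star_isomorphism X (uniform_roe X dX) Y (uniform_roe Y dY) \<Phi>)"

section \<open>Coarse geometry\<close>

definition close_maps :: "'a set \<Rightarrow> ('b \<Rightarrow> 'b \<Rightarrow> real) \<Rightarrow> ('a \<Rightarrow> 'b) \<Rightarrow> ('a \<Rightarrow> 'b) \<Rightarrow> bool" where
  "close_maps X dY f g \<longleftrightarrow> bdd_above ((\<lambda>x. dY (f x) (g x)) ` X)"

definition coarse_map ::
  "'a set \<Rightarrow> ('a \<Rightarrow> 'a \<Rightarrow> real) \<Rightarrow> 'b set \<Rightarrow> ('b \<Rightarrow> 'b \<Rightarrow> real) \<Rightarrow> ('a \<Rightarrow> 'b) \<Rightarrow> bool" where
  "coarse_map X dX Y dY f \<longleftrightarrow> f \<in> X \<rightarrow> Y \<and>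
     (\<forall>r>0. \<exists>s>0. \<forall>x\<in>X. \<forall>z\<in>X. dX x z < r \<longrightarrow> dY (f x) (f z) < s)"

definition coarse_equivalence ::
  "'a set \<Rightarrow> ('a \<Rightarrow> 'a \<Rightarrow> real) \<Rightarrow> 'b set \<Rightarrow> ('b \<Rightarrow> 'b \<Rightarrow> real) \<Rightarrow> ('a \<Rightarrow> 'b) \<Rightarrow> bool" where
  "coarse_equivalence X dX Y dY f \<longleftrightarrow> coarse_map X dX Y dY f \<and>
     (\<exists>g. coarse_map Y dY X dX g \<and>
        close_maps X dX (g \<circ> f) id \<and> close_maps Y dY (f \<circ> g) id)"

definition bijectively_coarsely_equivalent ::
  "'a set \<Rightarrow> ('a \<Rightarrow> 'a \<Rightarrow> real) \<Rightarrow> 'b set \<Rightarrow> ('b \<Rightarrow> 'b \<Rightarrow> real) \<Rightarrow> bool" where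
  "bijectively_coarsely_equivalent X dX Y dY \<longleftrightarrow>
     (\<exists>f. bij_betw f X Y \<and> coarse_equivalence X dX Y dY f)"

section \<open>Expander graphs\<close>

text \<open>
  A graph is a vertex set \<open>V\<close> with a symmetric irreflexive adjacency relation \<open>E\<close> on \<open>V\<close>.
  Walks of length \<open>n\<close> correspond to \<open>E ^^ n\<close>; the path distance is infinite between
  different connected components, and so is the distance to the empty set.
\<close>

definition finite_graph :: "'a set \<Rightarrow> 'a rel \<Rightarrow> bool" where
  "finite_graph V E \<longleftrightarrow> finite V \<and> E \<subseteq> V \<times> V \<and> sym E \<and> irrefl E"

definition graph_dist :: "'a rel \<Rightarrow> 'a \<Rightarrow> 'a \<Rightarrow> ereal" where
  "graph_dist E x y = (INF n\<in>{n. (x, y) \<in> E ^^ n}. ereal (real n))"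

definition graph_boundary :: "'a set \<Rightarrow> 'a rel \<Rightarrow> 'a set \<Rightarrow> 'a set" where
  "graph_boundary V E A = {x \<in> V - A. (INF a\<in>A. graph_dist E x a) \<le> 1}"

definition expander_graph :: "nat \<Rightarrow> real \<Rightarrow> 'a set \<Rightarrow> 'a rel \<Rightarrow> bool" where
  "expander_graph k h V E \<longleftrightarrow> finite_graph V E \<and>
     (\<forall>v\<in>V. card (E `` {v}) \<le> k) \<and>
     (\<forall>A\<subseteq>V. real (card (graph_boundary V E A))
               \<ge> h * (1 - real (card A) / real (card V)) * real (card A))"

definition expander_sequence :: "(nat \<Rightarrow> 'a set) \<Rightarrow> (nat \<Rightarrow> 'a rel) \<Rightarrow> bool" where
  "expander_sequence V E \<longleftrightarrow>
     (\<exists>k h. h > 0 \<and> (\<forall>n. expander_graph k h (V n) (E n))) \<and>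
     filterlim (\<lambda>n. card (V n)) at_top sequentially"

section \<open>Coarse disjoint unions\<close>

text \<open>
  The summands \<open>V n\<close> are realised as disjoint subsets of \<open>X\<close>. Their metrics \<open>\<rho> n\<close> may take
  values in the extended reals to cover graph distances, but as they are restrictions of the
  real-valued \<open>d\<close>, they are finite on \<open>V n\<close> (expander graphs are connected anyway). The
  distance between two sets is infinite if one of them is empty.
\<close>

definition coarse_disjoint_union ::
  "(nat \<Rightarrow> 'a set) \<Rightarrow> (nat \<Rightarrow> 'a \<Rightarrow> 'a \<Rightarrow> ereal) \<Rightarrow> 'a set \<Rightarrow> ('a \<Rightarrow> 'a \<Rightarrow> real) \<Rightarrow> bool" where
  "coarse_disjoint_union V \<rho> X d \<longleftrightarrow>
     (\<forall>n. finite (V n)) \<and> disjoint_family V \<and> X = (\<Union>n. V n) \<and> Metric_space X d \<and>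
     (\<forall>n. \<forall>x\<in>V n. \<forall>y\<in>V n. ereal (d x y) = \<rho> n x y) \<and>
     (\<forall>R::real. finite {(n, m). n \<noteq> m \<and>
        \<not> (INF x\<in>V n. INF y\<in>V m. ereal (d x y)) > ereal R})"

definition coarse_disjoint_union_of_expanders :: "'a set \<Rightarrow> ('a \<Rightarrow> 'a \<Rightarrow> real) \<Rightarrow> bool" where
  "coarse_disjoint_union_of_expanders X d \<longleftrightarrow>
     (\<exists>V E. expander_sequence V E \<and> coarse_disjoint_union V (\<lambda>n. graph_dist (E n)) X d)"

end

(* An isomorphism of uniform Roe algebras is implemented by a unitary U, because it maps the matrix
units to a system of rank one matrix units. A Baire category argument shows that the projections
U 1_A U*, A a subset of X, are quasi-local uniformly in A. Combined with random signs (in place of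
Lyapunov-type convexity results for vector measures with atoms), this yields that every U delta_x
has a coefficient bounded away from 0, at g x say, and that U delta_x is uniformly concentrated
near g x; hence g is a coarse equivalence. Random signs also show that g satisfies Hall's condition
up to a bounded error: there is R such that every finite subset A of X has at most as many points
as the R-neighbourhood of g(A). By Hall's theorem and Schroeder-Bernstein, g is close to a bijection.
All of this takes place in uniformly locally finite spaces; expander graphs enter through their
bounded degree. *)

theory Submission
  imports Defs
begin

section \<open>The Hilbert space of square-summable functions\<close>

text \<open>The obstacle is that an element of the algebra is local only at its own scale: the
  conjugate of each 1_A is close to finite propagation, but the width might grow with A. The sign
  arguments choose A depending on the vector under study, so they need one width for all A. Signs
  are effective because 2 * 1_A - 1 is unitary: it preserves norms over X, while quasi-locality
  keeps its conjugate from moving mass far over Y. If all coefficients of V delta_y were tiny,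
  suitable signs would nearly cancel its image near y; then U 1_A V delta_y would be close to
  delta_y / 2, which unitarity forbids. For Hall's condition the roles are reversed: a vector
  vanishing near g(A) would acquire mass there from suitable signs, which quasi-locality forbids.
  The matrices of U and V are conjugate transposes, so everything applies equally to a map f from Y
  to X; large entries at (x, g x) and (f y, y) together with concentration make f and g inverse to
  each other up to a bounded error.\<close>

lemma ell2_outside: "f \<in> ell2 X \<Longrightarrow> x \<notin> X \<Longrightarrow> f x = 0"
  by (auto simp: ell2_def)

lemma ell2_summable: "f \<in> ell2 X \<Longrightarrow> (\<lambda>x. (cmod (f x))\<^sup>2) summable_on X"
  by (auto simp: ell2_def)

lemma ell2I:
  "(\<And>x. x \<notin> X \<Longrightarrow> f x = 0) \<Longrightarrow> (\<lambda>x. (cmod (f x))\<^sup>2) summable_on X \<Longrightarrow> f \<in> ell2 X"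
  by (auto simp: ell2_def)

lemma ell2_zero [simp]: "(\<lambda>x. 0) \<in> ell2 X"
  by (simp add: ell2_def)

lemma ell2_scale [intro]:
  assumes "f \<in> ell2 X" shows "(\<lambda>x. c * f x) \<in> ell2 X"
  using assms by (auto simp: ell2_def norm_mult power_mult_distrib intro: summable_on_cmult_right)

lemma ell2_add [intro]:
  assumes f: "f \<in> ell2 X" and g: "g \<in> ell2 X" shows "(\<lambda>x. f x + g x) \<in> ell2 X"
proof (rule ell2I)
  have s: "(\<lambda>x. 2 * (cmod (f x))\<^sup>2 + 2 * (cmod (g x))\<^sup>2) summable_on X"
    by (intro summable_on_add summable_on_cmult_right ell2_summable f g)
  show "(\<lambda>x. (cmod (f x + g x))\<^sup>2) summable_on X"
  proof (rule summable_on_comparison_test[OF s])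
    fix x
    have "(cmod (f x + g x))\<^sup>2 \<le> (cmod (f x) + cmod (g x))\<^sup>2"
      by (intro power_mono norm_triangle_ineq) auto
    also have "\<dots> \<le> 2 * (cmod (f x))\<^sup>2 + 2 * (cmod (g x))\<^sup>2"
      using sum_squares_bound[of "cmod (f x)" "cmod (g x)"] by (simp add: power2_sum)
    finally show "(cmod (f x + g x))\<^sup>2 \<le> 2 * (cmod (f x))\<^sup>2 + 2 * (cmod (g x))\<^sup>2" .
  qed auto
qed (use f g in \<open>auto simp: ell2_outside\<close>)

lemma ell2_diff [intro]:
  assumes f: "f \<in> ell2 X" and g: "g \<in> ell2 X" shows "(\<lambda>x. f x - g x) \<in> ell2 X"
  using ell2_add[OF f ell2_scale[OF g, of "-1"]] by simp

lemma ell2_sum [intro]: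
  "(\<And>i. i \<in> I \<Longrightarrow> f i \<in> ell2 X) \<Longrightarrow> (\<lambda>x. \<Sum>i\<in>I. f i x) \<in> ell2 X"
  by (induction I rule: infinite_finite_induct) auto

lemma ell2_finite_support:
  assumes "finite F" "F \<subseteq> X" "\<And>x. x \<notin> F \<Longrightarrow> f x = 0" shows "f \<in> ell2 X"
proof (rule ell2I)
  have "(\<lambda>x. (cmod (f x))\<^sup>2) summable_on F" using assms by simp
  then show "(\<lambda>x. (cmod (f x))\<^sup>2) summable_on X"
    by (rule summable_on_cong_neutral[THEN iffD1, rotated -1]) (use assms in auto)
qed (use assms in auto)

lemma ell2_basis_in [simp, intro]: "x \<in> X \<Longrightarrow> ell2_basis x \<in> ell2 X"
  by (rule ell2_finite_support[of "{x}"]) (auto simp: ell2_basis_def)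

text \<open>Multiplication by the indicator of \<open>A\<close>, written 1_A in the overview. It is
  a total map on functions; restricting it to \<open>ell2 X\<close> is postponed to the point where
  it must be an element of the algebra.\<close>

definition cutoff :: "'a set \<Rightarrow> ('a \<Rightarrow> complex) \<Rightarrow> 'a \<Rightarrow> complex" where
  "cutoff A f = (\<lambda>x. if x \<in> A then f x else 0)"

lemma cutoff_ell2 [intro]: assumes "f \<in> ell2 X" shows "cutoff A f \<in> ell2 X"
proof (rule ell2I)
  show "(\<lambda>x. (cmod (cutoff A f x))\<^sup>2) summable_on X"
    by (rule summable_on_comparison_test[OF ell2_summable[OF assms]]) (auto simp: cutoff_def)
qed (use assms in \<open>auto simp: cutoff_def ell2_outside\<close>)

section \<open>Inner product and norm\<close>

lemma ell2_abs_summable: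
  assumes "f \<in> ell2 X" "g \<in> ell2 X"
  shows "(\<lambda>x. norm (f x * cnj (g x))) summable_on X"
proof (rule abs_summable_product)
  show "(\<lambda>i. norm (f i * f i)) summable_on X" "(\<lambda>i. norm (cnj (g i) * cnj (g i))) summable_on X"
    using ell2_summable[OF assms(1)] ell2_summable[OF assms(2)]
    by (simp_all add: norm_mult power2_eq_square)
qed

lemma ell2_inner_summable:
  assumes "f \<in> ell2 X" "g \<in> ell2 X"
  shows "(\<lambda>x. f x * cnj (g x)) summable_on X"
  using ell2_abs_summable[OF assms] by (rule abs_summable_summable)

lemma ell2_inner_add_left:
  assumes "f \<in> ell2 X" "f' \<in> ell2 X" "g \<in> ell2 X"
  shows "ell2_inner X (\<lambda>x. f x + f' x) g = ell2_inner X f g + ell2_inner X f' g"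
  using assms by (simp add: ell2_inner_def ring_distribs infsum_add ell2_inner_summable)

lemma ell2_inner_scale_left:
  assumes "f \<in> ell2 X" "g \<in> ell2 X"
  shows "ell2_inner X (\<lambda>x. c * f x) g = c * ell2_inner X f g"
  by (simp add: ell2_inner_def mult.assoc infsum_cmult_right')

lemma ell2_inner_cnj: "ell2_inner X g f = cnj (ell2_inner X f g)"
  by (simp add: ell2_inner_def flip: infsum_cnj) (simp add: mult.commute)

lemma ell2_inner_add_right:
  assumes "f \<in> ell2 X" "g \<in> ell2 X" "g' \<in> ell2 X"
  shows "ell2_inner X f (\<lambda>x. g x + g' x) = ell2_inner X f g + ell2_inner X f g'"
  unfolding ell2_inner_cnj[of X f] ell2_inner_add_left[OF assms(2,3,1)] by simp

lemma ell2_inner_scale_right: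
  assumes "f \<in> ell2 X" "g \<in> ell2 X"
  shows "ell2_inner X f (\<lambda>x. c * g x) = cnj c * ell2_inner X f g"
  unfolding ell2_inner_cnj[of X f] ell2_inner_scale_left[OF assms(2,1)] by simp

lemma ell2_inner_diff_left:
  assumes "f \<in> ell2 X" "f' \<in> ell2 X" "g \<in> ell2 X"
  shows "ell2_inner X (\<lambda>x. f x - f' x) g = ell2_inner X f g - ell2_inner X f' g"
  using ell2_inner_add_left[OF assms(1) ell2_scale[OF assms(2), of "-1"] assms(3)]
    ell2_inner_scale_left[OF assms(2,3), of "-1"] by simp

lemma ell2_inner_diff_right:
  assumes "f \<in> ell2 X" "g \<in> ell2 X" "g' \<in> ell2 X"
  shows "ell2_inner X f (\<lambda>x. g x - g' x) = ell2_inner X f g - ell2_inner X f g'"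
  unfolding ell2_inner_cnj[of X f] ell2_inner_diff_left[OF assms(2,3,1)] by simp

lemma ell2_inner_zero_left [simp]: "ell2_inner X (\<lambda>x. 0) g = 0"
  by (simp add: ell2_inner_def)

lemma ell2_inner_sum_left:
  assumes "finite I" "\<And>i. i \<in> I \<Longrightarrow> f i \<in> ell2 X" "g \<in> ell2 X"
  shows "ell2_inner X (\<lambda>x. \<Sum>i\<in>I. f i x) g = (\<Sum>i\<in>I. ell2_inner X (f i) g)"
  using assms(1,2)
  by (induction I) (simp_all add: ell2_inner_add_left ell2_sum assms(3))

lemma ell2_inner_basis_right:
  assumes "x \<in> X" shows "ell2_inner X f (ell2_basis x) = f x"
proof -
  have "ell2_inner X f (ell2_basis x) = (\<Sum>\<^sub>\<infinity>z\<in>{x}. f x)"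
    unfolding ell2_inner_def
    by (rule infsum_cong_neutral) (use assms in \<open>auto simp: ell2_basis_def\<close>)
  then show ?thesis by simp
qed

lemma ell2_inner_basis_left:
  assumes "x \<in> X" shows "ell2_inner X (ell2_basis x) f = cnj (f x)"
  using ell2_inner_cnj[of X "ell2_basis x" f] by (simp add: ell2_inner_basis_right assms)

lemma ell2_norm_sq: "(ell2_norm X f)\<^sup>2 = (\<Sum>\<^sub>\<infinity>x\<in>X. (cmod (f x))\<^sup>2)"
  by (simp add: ell2_norm_def infsum_nonneg)

lemma ell2_norm_nonneg [simp]: "0 \<le> ell2_norm X f"
  by (simp add: ell2_norm_def infsum_nonneg)

lemma ell2_inner_self: "ell2_inner X f f = of_real ((ell2_norm X f)\<^sup>2)"
proof -
  have "ell2_inner X f f = (\<Sum>\<^sub>\<infinity>x\<in>X. of_real ((cmod (f x))\<^sup>2))"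
    unfolding ell2_inner_def by (intro infsum_cong) (simp add: complex_norm_square[symmetric])
  also have "\<dots> = of_real (\<Sum>\<^sub>\<infinity>x\<in>X. (cmod (f x))\<^sup>2)"
  proof (cases "(\<lambda>x. (cmod (f x))\<^sup>2) summable_on X")
    case True then show ?thesis
      by (intro infsumI) (rule has_sum_of_real[OF has_sum_infsum])
  next
    \<comment> \<open>Divergent infinite sums are 0 by convention, so both sides vanish and the
      identity holds for every function.\<close>
    case False
    then have "\<not> (\<lambda>x. complex_of_real ((cmod (f x))\<^sup>2)) summable_on X"
      using summable_on_Re by fastforce
    with False show ?thesis by (simp add: infsum_not_exists del: of_real_power)
  qed
  finally show ?thesis by (simp only: ell2_norm_sq)
qed

lemma ell2_norm_zero [simp]: "ell2_norm X (\<lambda>x. 0) = 0"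
  by (simp add: ell2_norm_def)

lemma ell2_norm_scale: "ell2_norm X (\<lambda>x. c * f x) = cmod c * ell2_norm X f"
  by (simp add: ell2_norm_def norm_mult power_mult_distrib infsum_cmult_right' real_sqrt_mult)

lemma ell2_norm_basis [simp]: "x \<in> X \<Longrightarrow> ell2_norm X (ell2_basis x) = 1"
  using ell2_inner_basis_right[of x X "ell2_basis x"]
  unfolding ell2_inner_self
  by (simp add: ell2_basis_def ell2_norm_def infsum_nonneg flip: of_real_power)

lemma ell2_sum_le_norm_sq:
  assumes "f \<in> ell2 X" "finite F" "F \<subseteq> X"
  shows "(\<Sum>x\<in>F. (cmod (f x))\<^sup>2) \<le> (ell2_norm X f)\<^sup>2"
  unfolding ell2_norm_sq by (rule finite_sum_le_infsum) (use assms ell2_summable in auto)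

lemma ell2_coeff_le_norm:
  assumes "f \<in> ell2 X" shows "cmod (f x) \<le> ell2_norm X f"
proof (cases "x \<in> X")
  case True
  then show ?thesis
    using ell2_sum_le_norm_sq[OF assms, of "{x}"] by (simp add: power2_le_iff_abs_le)
qed (simp add: ell2_outside[OF assms])

lemma ell2_norm_eq_0: "f \<in> ell2 X \<Longrightarrow> ell2_norm X f = 0 \<Longrightarrow> f = (\<lambda>x. 0)"
  by (rule ext) (metis ell2_coeff_le_norm norm_le_zero_iff)

text \<open>Nonnegative sums converge once their finite partial sums are bounded. This is the way
  into \<open>ell2 X\<close> for vectors given only by their coefficients: adjoints, the map built
  from Bessel's inequality, Schur's test.\<close>

lemma ell2_in_if_bounded:
  assumes "\<And>x. x \<notin> X \<Longrightarrow> f x = 0"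
    and "\<And>F. finite F \<Longrightarrow> F \<subseteq> X \<Longrightarrow> (\<Sum>x\<in>F. (cmod (f x))\<^sup>2) \<le> B"
  shows "f \<in> ell2 X" and "(ell2_norm X f)\<^sup>2 \<le> B"
proof -
  have s: "(\<lambda>x. (cmod (f x))\<^sup>2) summable_on X"
    by (rule nonneg_bdd_above_summable_on) (use assms(2) in \<open>auto intro!: bdd_aboveI2\<close>)
  then show "f \<in> ell2 X" using assms(1) by (auto intro: ell2I)
  show "(ell2_norm X f)\<^sup>2 \<le> B"
    unfolding ell2_norm_sq by (rule infsum_le_finite_sums[OF s]) (use assms(2) in auto)
qed

lemma ell2_norm_mono:
  assumes "g \<in> ell2 X" "\<And>x. cmod (f x) \<le> cmod (g x)"
  shows "ell2_norm X f \<le> ell2_norm X g"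
proof -
  have f: "f \<in> ell2 X"
  proof (rule ell2_in_if_bounded(1))
    fix F assume F: "finite F" "F \<subseteq> X"
    have "(\<Sum>x\<in>F. (cmod (f x))\<^sup>2) \<le> (\<Sum>x\<in>F. (cmod (g x))\<^sup>2)"
      by (intro sum_mono power_mono assms) auto
    also have "\<dots> \<le> (ell2_norm X g)\<^sup>2" by (rule ell2_sum_le_norm_sq) (use assms F in auto)
    finally show "(\<Sum>x\<in>F. (cmod (f x))\<^sup>2) \<le> (ell2_norm X g)\<^sup>2" .
  next
    show "f x = 0" if "x \<notin> X" for x
      using assms(2)[of x] ell2_outside[OF assms(1) that] by simp
  qed
  show ?thesis unfolding ell2_norm_def
    by (intro real_sqrt_le_mono infsum_mono power_mono ell2_summable f assms) auto
qed

lemma ell2_norm_cutoff_le: "f \<in> ell2 X \<Longrightarrow> ell2_norm X (cutoff A f) \<le> ell2_norm X f"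
  by (rule ell2_norm_mono) (auto simp: cutoff_def)

lemma ell2_norm_add_sq:
  assumes "f \<in> ell2 X" "g \<in> ell2 X"
  shows "(ell2_norm X (\<lambda>x. f x + g x))\<^sup>2
    = (ell2_norm X f)\<^sup>2 + (ell2_norm X g)\<^sup>2 + 2 * Re (ell2_inner X f g)"
proof -
  have "complex_of_real ((ell2_norm X (\<lambda>x. f x + g x))\<^sup>2)
    = ell2_inner X f f + ell2_inner X g g + (ell2_inner X f g + ell2_inner X g f)"
    unfolding ell2_inner_self[symmetric] using assms
    by (simp add: ell2_inner_add_left ell2_inner_add_right ell2_add)
  also have "ell2_inner X f g + ell2_inner X g f = of_real (2 * Re (ell2_inner X f g))"
    by (simp add: ell2_inner_cnj[of X g f] complex_add_cnj)
  finally show ?thesis unfolding ell2_inner_self of_real_add[symmetric] of_real_eq_iff by simp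
qed

lemma ell2_norm_diff_sq:
  assumes "f \<in> ell2 X" "g \<in> ell2 X"
  shows "(ell2_norm X (\<lambda>x. f x - g x))\<^sup>2
    = (ell2_norm X f)\<^sup>2 + (ell2_norm X g)\<^sup>2 - 2 * Re (ell2_inner X f g)"
  using ell2_norm_add_sq[OF assms(1) ell2_scale[OF assms(2), of "-1"]]
    ell2_inner_scale_right[OF assms, of "-1"] ell2_norm_scale[of X "-1" g] by simp

lemma ell2_cauchy_schwarz:
  assumes f: "f \<in> ell2 X" and g: "g \<in> ell2 X"
  shows "cmod (ell2_inner X f g) \<le> ell2_norm X f * ell2_norm X g"
proof (cases "ell2_norm X g = 0")
  case True
  then have "g = (\<lambda>x. 0)" using g ell2_norm_eq_0 by blast
  then show ?thesis by (simp add: ell2_inner_def)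
next
  case False
  let ?n = "ell2_norm X g" and ?i = "ell2_inner X f g"
  \<comment> \<open>\<open>t * g\<close> is the orthogonal projection of \<open>f\<close> onto the
    line through \<open>g\<close>; that the remainder has nonnegative square norm is the
    inequality.\<close>
  define t where "t = ?i / of_real (?n\<^sup>2)"
  have "0 \<le> (ell2_norm X (\<lambda>x. f x - t * g x))\<^sup>2" by simp
  also have "\<dots> = (ell2_norm X f)\<^sup>2 + (cmod t * ?n)\<^sup>2 - 2 * Re (cnj t * ?i)"
    using f g by (simp add: ell2_norm_diff_sq ell2_scale ell2_norm_scale ell2_inner_scale_right)
  also have "cnj t * ?i = of_real ((cmod ?i)\<^sup>2 / ?n\<^sup>2)"
    by (simp add: t_def complex_norm_square[symmetric] mult.commute)
  also have "(cmod t * ?n)\<^sup>2 = (cmod ?i)\<^sup>2 / ?n\<^sup>2"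
    using False by (simp add: t_def norm_divide power_mult_distrib power_divide power2_eq_square norm_mult)
  finally have "(cmod ?i)\<^sup>2 / ?n\<^sup>2 \<le> (ell2_norm X f)\<^sup>2" by simp
  then have "(cmod ?i)\<^sup>2 \<le> (ell2_norm X f * ?n)\<^sup>2"
    using False by (simp add: field_simps power_mult_distrib)
  then show ?thesis by (rule power2_le_imp_le) simp
qed

lemma ell2_norm_triangle:
  assumes f: "f \<in> ell2 X" and g: "g \<in> ell2 X"
  shows "ell2_norm X (\<lambda>x. f x + g x) \<le> ell2_norm X f + ell2_norm X g"
proof (rule power2_le_imp_le)
  have "Re (ell2_inner X f g) \<le> ell2_norm X f * ell2_norm X g"
    using ell2_cauchy_schwarz[OF assms] complex_Re_le_cmod order_trans by blast
  then show "(ell2_norm X (\<lambda>x. f x + g x))\<^sup>2 \<le> (ell2_norm X f + ell2_norm X g)\<^sup>2"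
    by (simp add: ell2_norm_add_sq[OF assms] power2_sum)
qed simp

lemma ell2_norm_minus_commute: "ell2_norm X (\<lambda>x. f x - g x) = ell2_norm X (\<lambda>x. g x - f x)"
  by (simp add: ell2_norm_def norm_minus_commute)

lemma ell2_finite_approx:
  assumes f: "f \<in> ell2 X" and "\<epsilon> > 0"
  obtains F where "finite F" "F \<subseteq> X" "ell2_norm X (\<lambda>x. f x - cutoff F f x) < \<epsilon>"
proof -
  from infsum_finite_approximation[OF ell2_summable[OF f], of "\<epsilon>\<^sup>2 / 2"] \<open>\<epsilon> > 0\<close>
  obtain F where F: "finite F" "F \<subseteq> X"
    and d: "dist (\<Sum>x\<in>F. (cmod (f x))\<^sup>2) (\<Sum>\<^sub>\<infinity>x\<in>X. (cmod (f x))\<^sup>2) \<le> \<epsilon>\<^sup>2 / 2" by auto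
  have s: "(\<lambda>x. (cmod (cutoff F f x))\<^sup>2) summable_on X"
    using f cutoff_ell2 ell2_summable by blast
  have "(\<Sum>x\<in>F. (cmod (f x))\<^sup>2) = (\<Sum>\<^sub>\<infinity>x\<in>F. (cmod (f x))\<^sup>2)" using F by simp
  also have "\<dots> = (\<Sum>\<^sub>\<infinity>x\<in>X. (cmod (cutoff F f x))\<^sup>2)"
    by (rule infsum_cong_neutral) (use F in \<open>auto simp: cutoff_def\<close>)
  finally have e: "(\<Sum>x\<in>F. (cmod (f x))\<^sup>2) = (\<Sum>\<^sub>\<infinity>x\<in>X. (cmod (cutoff F f x))\<^sup>2)" .
  have "(ell2_norm X (\<lambda>x. f x - cutoff F f x))\<^sup>2
      = (\<Sum>\<^sub>\<infinity>x\<in>X. (cmod (f x))\<^sup>2 + - (cmod (cutoff F f x))\<^sup>2)"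
    unfolding ell2_norm_sq by (intro infsum_cong) (simp add: cutoff_def)
  also have "\<dots> = (\<Sum>\<^sub>\<infinity>x\<in>X. (cmod (f x))\<^sup>2) - (\<Sum>x\<in>F. (cmod (f x))\<^sup>2)"
    unfolding infsum_add[OF ell2_summable[OF f] summable_on_uminus[THEN iffD2, OF s]] infsum_uminus e
    by simp
  also have "\<dots> \<le> \<epsilon>\<^sup>2 / 2" using d unfolding dist_real_def by linarith
  also have "\<dots> < \<epsilon>\<^sup>2" using \<open>\<epsilon> > 0\<close> by simp
  finally have "ell2_norm X (\<lambda>x. f x - cutoff F f x) < \<epsilon>"
    using \<open>\<epsilon> > 0\<close> by (simp add: power2_less_imp_less)
  with F that show ?thesis by blast
qed

lemma cutoff_finite_eq_sum:
  "finite F \<Longrightarrow> cutoff F f = (\<lambda>z. \<Sum>x\<in>F. f x * ell2_basis x z)"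
  by (auto simp: cutoff_def ell2_basis_def if_distrib cong: if_cong)

lemma ell2_norm_cutoff_finite:
  assumes "finite F" "F \<subseteq> X"
  shows "(ell2_norm X (cutoff F f))\<^sup>2 = (\<Sum>x\<in>F. (cmod (f x))\<^sup>2)"
proof -
  have "(ell2_norm X (cutoff F f))\<^sup>2 = (\<Sum>\<^sub>\<infinity>x\<in>F. (cmod (f x))\<^sup>2)"
    unfolding ell2_norm_sq
    by (rule infsum_cong_neutral) (use assms in \<open>auto simp: cutoff_def\<close>)
  then show ?thesis using assms by simp
qed

lemma ell2_parallelogram:
  assumes "f \<in> ell2 X" "g \<in> ell2 X"
  shows "(ell2_norm X (\<lambda>x. f x + g x))\<^sup>2 + (ell2_norm X (\<lambda>x. f x - g x))\<^sup>2
    = 2 * (ell2_norm X f)\<^sup>2 + 2 * (ell2_norm X g)\<^sup>2"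
  by (simp add: ell2_norm_add_sq[OF assms] ell2_norm_diff_sq[OF assms])

text \<open>Averaging over independent signs, the expected value of \<open>\<parallel>\<Sum> \<sigma>\<^sub>i w\<^sub>i\<parallel>\<^sup>2\<close> is
  \<open>\<Sum> \<parallel>w\<^sub>i\<parallel>\<^sup>2\<close>, so some choice of signs stays below and some stays above it (\<open>c = \<plusminus>1\<close>).\<close>

lemma ell2_signs:
  fixes c :: real
  assumes "finite I" "\<forall>i\<in>I. w i \<in> ell2 X"
  shows "\<exists>J\<subseteq>I. c * (ell2_norm X (\<lambda>x. \<Sum>i\<in>I. (if i \<in> J then 1 else -1) * w i x))\<^sup>2
    \<le> c * (\<Sum>i\<in>I. (ell2_norm X (w i))\<^sup>2)"
  using assms
proof (induction I)
  case (insert j I)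
  define S where "S J x = (\<Sum>i\<in>I. (if i \<in> J then 1 else -1) * w i x)" for J x
  define T where "T = (\<Sum>i\<in>I. (ell2_norm X (w i))\<^sup>2)"
  have "\<exists>J\<subseteq>I. c * (ell2_norm X (S J))\<^sup>2 \<le> c * T"
    unfolding S_def T_def by (rule insert.IH) (use insert.prems in simp)
  then obtain J where J: "J \<subseteq> I" and le: "c * (ell2_norm X (S J))\<^sup>2 \<le> c * T"
    by blast
  have s: "S J \<in> ell2 X"
    unfolding S_def using insert.prems by (intro ell2_sum ell2_scale) simp
  have "S (insert j J) x = S J x" for x
    unfolding S_def by (intro sum.cong) (use insert.hyps in auto)
  then have p: "(\<Sum>i\<in>insert j I. (if i \<in> insert j J then 1 else -1) * w i x) = S J x + w j x" for x
    using insert.hyps unfolding S_def by simp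
  have "j \<notin> J" using J insert.hyps by blast
  then have m: "(\<Sum>i\<in>insert j I. (if i \<in> J then 1 else -1) * w i x) = S J x - w j x" for x
    using insert.hyps unfolding S_def by simp
  have e: "(\<Sum>i\<in>insert j I. (ell2_norm X (w i))\<^sup>2) = (ell2_norm X (w j))\<^sup>2 + T"
    using insert.hyps by (simp add: T_def)
  have "c * (ell2_norm X (\<lambda>x. S J x + w j x))\<^sup>2 + c * (ell2_norm X (\<lambda>x. S J x - w j x))\<^sup>2
      = c * (2 * (ell2_norm X (S J))\<^sup>2 + 2 * (ell2_norm X (w j))\<^sup>2)"
    unfolding distrib_left[symmetric, of c] using insert.prems
    by (subst ell2_parallelogram[OF s]) (simp_all add: distrib_left)
  also have "\<dots> \<le> 2 * (c * ((ell2_norm X (w j))\<^sup>2 + T))"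
    using le by (simp add: algebra_simps)
  \<comment> \<open>The two signs of \<open>w j\<close> average to at most the bound, so one of them
    meets it. Carrying the factor \<open>c\<close> along treats upper and lower estimates at
    once.\<close>
  finally consider "c * (ell2_norm X (\<lambda>x. S J x + w j x))\<^sup>2 \<le> c * ((ell2_norm X (w j))\<^sup>2 + T)"
    | "c * (ell2_norm X (\<lambda>x. S J x - w j x))\<^sup>2 \<le> c * ((ell2_norm X (w j))\<^sup>2 + T)" by linarith
  then show ?case
  proof cases
    case 1 then show ?thesis
      using J by (intro exI[of _ "insert j J"]) (simp only: p e, blast)
  next
    case 2 then show ?thesis
      using J by (intro exI[of _ J]) (simp only: m e, blast)
  qed
qed simp

section \<open>Bounded linear maps and the uniform Roe algebra\<close>

text \<open>Covers maps between different spaces and omits the extensionality demanded by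
  \<open>bounded_ops\<close>, so that lambda terms such as composites and differences qualify as
  they stand.\<close>

definition ell2_bounded_linear ::
  "'a set \<Rightarrow> 'b set \<Rightarrow> (('a \<Rightarrow> complex) \<Rightarrow> ('b \<Rightarrow> complex)) \<Rightarrow> bool" where
  "ell2_bounded_linear X Y T \<longleftrightarrow> (\<forall>f\<in>ell2 X. T f \<in> ell2 Y) \<and>
     (\<forall>f\<in>ell2 X. \<forall>g\<in>ell2 X. T (\<lambda>x. f x + g x) = (\<lambda>y. T f y + T g y)) \<and>
     (\<forall>c. \<forall>f\<in>ell2 X. T (\<lambda>x. c * f x) = (\<lambda>y. c * T f y)) \<and>
     (\<exists>C. \<forall>f\<in>ell2 X. ell2_norm Y (T f) \<le> C * ell2_norm X f)"

lemma bounded_ops_iff: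
  "a \<in> bounded_ops X \<longleftrightarrow> ell2_bounded_linear X X a \<and> a \<in> extensional (ell2 X)"
  by (auto simp: bounded_ops_def ell2_bounded_linear_def PiE_def)

lemma bounded_ops_linear: "a \<in> bounded_ops X \<Longrightarrow> ell2_bounded_linear X X a"
  by (simp add: bounded_ops_iff)

lemma restrict_bounded_ops:
  assumes "ell2_bounded_linear X X T" shows "restrict T (ell2 X) \<in> bounded_ops X"
  using assms by (auto simp: bounded_ops_iff ell2_bounded_linear_def ell2_add ell2_scale)

context
  fixes X :: "'a set" and Y :: "'b set" and T
  assumes T: "ell2_bounded_linear X Y T"
begin

lemma ell2_linear_in: "f \<in> ell2 X \<Longrightarrow> T f \<in> ell2 Y"
  using T by (simp add: ell2_bounded_linear_def)

lemma ell2_linear_add: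
  "f \<in> ell2 X \<Longrightarrow> g \<in> ell2 X \<Longrightarrow> T (\<lambda>x. f x + g x) = (\<lambda>y. T f y + T g y)"
  using T by (simp add: ell2_bounded_linear_def)

lemma ell2_linear_scale: "f \<in> ell2 X \<Longrightarrow> T (\<lambda>x. c * f x) = (\<lambda>y. c * T f y)"
  using T by (simp add: ell2_bounded_linear_def)

lemma ell2_linear_zero: "T (\<lambda>x. 0) = (\<lambda>y. 0)"
  using ell2_linear_scale[of "\<lambda>x. 0" 0] by simp

lemma ell2_linear_diff:
  assumes "f \<in> ell2 X" "g \<in> ell2 X" shows "T (\<lambda>x. f x - g x) = (\<lambda>y. T f y - T g y)"
  using ell2_linear_add[OF assms(1) ell2_scale[OF assms(2), of "-1"]]
    ell2_linear_scale[OF assms(2), of "-1"] by simp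

lemma ell2_linear_sum:
  assumes "finite I" "\<And>i. i \<in> I \<Longrightarrow> f i \<in> ell2 X"
  shows "T (\<lambda>x. \<Sum>i\<in>I. c i * f i x) = (\<lambda>y. \<Sum>i\<in>I. c i * T (f i) y)"
  using assms
proof (induction I)
  case (insert j I)
  have "(\<lambda>x. \<Sum>i\<in>I. c i * f i x) \<in> ell2 X"
    by (intro ell2_sum ell2_scale) (use insert.prems in simp)
  with insert show ?case
    by (simp add: ell2_linear_add ell2_linear_scale ell2_scale)
qed (simp add: ell2_linear_zero)

lemma ell2_linear_bound:
  obtains C where "C > 0" "\<And>f. f \<in> ell2 X \<Longrightarrow> ell2_norm Y (T f) \<le> C * ell2_norm X f"
proof -
  obtain C where C: "\<forall>f\<in>ell2 X. ell2_norm Y (T f) \<le> C * ell2_norm X f"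
    using T unfolding ell2_bounded_linear_def by blast
  have "ell2_norm Y (T f) \<le> max C 1 * ell2_norm X f" if "f \<in> ell2 X" for f
    using bspec[OF C that] mult_right_mono[of C "max C 1" "ell2_norm X f"] by simp
  then show ?thesis using that[of "max C 1"] by simp
qed

text \<open>The value of \<open>T f\<close> at \<open>y\<close> is continuous in \<open>f\<close>,
  and every finite truncation of \<open>f\<close> is sent to a vector vanishing at \<open>y\<close>.
  This extends statements about basis vectors, such as a propagation bound, to all of
  \<open>ell2 X\<close>.\<close>

lemma ell2_linear_coeff_vanish:
  assumes f: "f \<in> ell2 X" and z: "\<And>x. x \<in> X \<Longrightarrow> f x \<noteq> 0 \<Longrightarrow> T (ell2_basis x) y = 0"
  shows "T f y = 0"
proof (rule ccontr)
  assume ne: "T f y \<noteq> 0"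
  obtain C where C: "C > 0" "\<And>f. f \<in> ell2 X \<Longrightarrow> ell2_norm Y (T f) \<le> C * ell2_norm X f"
    using ell2_linear_bound by blast
  \<comment> \<open>The truncation error times the bound \<open>C\<close> stays below the modulus of
    the supposedly nonzero coefficient.\<close>
  obtain F where F: "finite F" "F \<subseteq> X" "ell2_norm X (\<lambda>x. f x - cutoff F f x) < cmod (T f y) / C"
    using ell2_finite_approx[OF f, of "cmod (T f y) / C"] ne C by auto
  have in': "(\<lambda>x. f x - cutoff F f x) \<in> ell2 X" using f by blast
  have "T (cutoff F f) y = (\<Sum>x\<in>F. f x * T (ell2_basis x) y)"
    unfolding cutoff_finite_eq_sum[OF F(1)] using F by (subst ell2_linear_sum) auto
  also have "\<dots> = 0" using F z by (intro sum.neutral) (metis mult_eq_0_iff subsetD)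
  finally have "T f y = T (\<lambda>x. f x - cutoff F f x) y"
    using f by (simp add: ell2_linear_diff cutoff_ell2)
  then have "cmod (T f y) \<le> ell2_norm Y (T (\<lambda>x. f x - cutoff F f x))"
    using ell2_coeff_le_norm[OF ell2_linear_in[OF in']] by metis
  also have "\<dots> \<le> C * ell2_norm X (\<lambda>x. f x - cutoff F f x)" using C in' by blast
  also have "\<dots> < cmod (T f y)" using F(3) C by (simp add: field_simps)
  finally show False by simp
qed

end

lemma bounded_ops_in: "a \<in> bounded_ops X \<Longrightarrow> f \<in> ell2 X \<Longrightarrow> a f \<in> ell2 X"
  using ell2_linear_in bounded_ops_linear by metis

lemma ell2_bounded_linearI:
  assumes "\<And>f. f \<in> ell2 X \<Longrightarrow> T f \<in> ell2 Y"
    and "\<And>f g. f \<in> ell2 X \<Longrightarrow> g \<in> ell2 X \<Longrightarrow> T (\<lambda>x. f x + g x) = (\<lambda>y. T f y + T g y)"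
    and "\<And>c f. f \<in> ell2 X \<Longrightarrow> T (\<lambda>x. c * f x) = (\<lambda>y. c * T f y)"
    and "\<And>f. f \<in> ell2 X \<Longrightarrow> ell2_norm Y (T f) \<le> C * ell2_norm X f"
  shows "ell2_bounded_linear X Y T"
  unfolding ell2_bounded_linear_def using assms by blast

lemma ell2_linear_diff_map:
  assumes S: "ell2_bounded_linear X Y S" and T: "ell2_bounded_linear X Y T"
  shows "ell2_bounded_linear X Y (\<lambda>f y. S f y - T f y)"
proof -
  obtain C where C: "\<And>f. f \<in> ell2 X \<Longrightarrow> ell2_norm Y (S f) \<le> C * ell2_norm X f"
    using ell2_linear_bound[OF S] by metis
  obtain D where D: "\<And>f. f \<in> ell2 X \<Longrightarrow> ell2_norm Y (T f) \<le> D * ell2_norm X f"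
    using ell2_linear_bound[OF T] by metis
  show ?thesis
  proof (rule ell2_bounded_linearI)
    fix f assume f: "f \<in> ell2 X"
    have n: "(\<lambda>y. -1 * T f y) \<in> ell2 Y" by (intro ell2_scale ell2_linear_in[OF T] f)
    have "ell2_norm Y (\<lambda>y. S f y + -1 * T f y) \<le> ell2_norm Y (S f) + ell2_norm Y (\<lambda>y. -1 * T f y)"
      by (intro ell2_norm_triangle n ell2_linear_in[OF S] f)
    then show "ell2_norm Y (\<lambda>y. S f y - T f y) \<le> (C + D) * ell2_norm X f"
      using C[OF f] D[OF f] unfolding ell2_norm_scale by (simp add: distrib_right)
  qed (auto simp: ell2_linear_add[OF S] ell2_linear_add[OF T] ell2_linear_scale[OF S]
      ell2_linear_scale[OF T] algebra_simps intro!: ell2_diff ell2_linear_in[OF S]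
      ell2_linear_in[OF T])
qed

lemma ell2_linear_eqI:
  assumes S: "ell2_bounded_linear X Y S" and T: "ell2_bounded_linear X Y T"
    and "\<And>x. x \<in> X \<Longrightarrow> S (ell2_basis x) = T (ell2_basis x)" and f: "f \<in> ell2 X"
  shows "S f = T f"
proof
  fix y
  have "S f y - T f y = 0"
    by (rule ell2_linear_coeff_vanish[OF ell2_linear_diff_map[OF S T] f]) (simp add: assms(3))
  then show "S f y = T f y" by simp
qed

lemma ell2_linear_comp:
  assumes S: "ell2_bounded_linear Y Z S" and T: "ell2_bounded_linear X Y T"
  shows "ell2_bounded_linear X Z (\<lambda>f. S (T f))"
proof -
  obtain C where C: "C > 0" "\<And>f. f \<in> ell2 Y \<Longrightarrow> ell2_norm Z (S f) \<le> C * ell2_norm Y f"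
    using ell2_linear_bound[OF S] by metis
  obtain D where D: "\<And>f. f \<in> ell2 X \<Longrightarrow> ell2_norm Y (T f) \<le> D * ell2_norm X f"
    using ell2_linear_bound[OF T] by metis
  show ?thesis
  proof (rule ell2_bounded_linearI)
    fix f assume f: "f \<in> ell2 X"
    have "ell2_norm Z (S (T f)) \<le> C * ell2_norm Y (T f)" using C ell2_linear_in[OF T f] by blast
    also have "\<dots> \<le> C * (D * ell2_norm X f)" using D[OF f] C(1) by simp
    finally show "ell2_norm Z (S (T f)) \<le> (C * D) * ell2_norm X f" by simp
  qed (auto simp: ell2_linear_add[OF T] ell2_linear_scale[OF T] ell2_linear_in[OF T]
      ell2_linear_add[OF S] ell2_linear_scale[OF S] intro: ell2_linear_in[OF S])
qed

section \<open>Adjoints\<close>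

lemma ell2_eqI_inner:
  assumes "g \<in> ell2 X" "g' \<in> ell2 X" "\<And>f. f \<in> ell2 X \<Longrightarrow> ell2_inner X f g = ell2_inner X f g'"
  shows "g = g'"
proof
  fix x show "g x = g' x"
  proof (cases "x \<in> X")
    case True
    then show ?thesis using assms(3)[of "ell2_basis x"] by (simp add: ell2_inner_basis_left)
  qed (use assms in \<open>simp add: ell2_outside\<close>)
qed

text \<open>The coefficient of \<open>S g\<close> at \<open>x\<close> is forced to be the conjugate
  of the inner product of \<open>T (ell2_basis x)\<close> with \<open>g\<close>, so \<open>S\<close>
  is written down directly. The work lies in its square-summability and in passing from finitely
  supported \<open>f\<close> to all \<open>f\<close>.\<close>

lemma ell2_linear_adjoint:
  assumes T: "ell2_bounded_linear X Y T"
  obtains S where "ell2_bounded_linear Y X S"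
    "\<And>f g. f \<in> ell2 X \<Longrightarrow> g \<in> ell2 Y \<Longrightarrow> ell2_inner Y (T f) g = ell2_inner X f (S g)"
proof -
  obtain C where C: "C > 0" "\<And>f. f \<in> ell2 X \<Longrightarrow> ell2_norm Y (T f) \<le> C * ell2_norm X f"
    using ell2_linear_bound[OF T] by blast
  define S where "S g x = (if x \<in> X then cnj (ell2_inner Y (T (ell2_basis x)) g) else 0)" for g x
  have fin: "ell2_inner Y (T (cutoff F f)) g = ell2_inner X (cutoff F f) (S g)"
    if "finite F" "F \<subseteq> X" "g \<in> ell2 Y" for F f g
  proof -
    have "ell2_inner Y (T (cutoff F f)) g
        = (\<Sum>x\<in>F. ell2_inner Y (\<lambda>y. f x * T (ell2_basis x) y) g)"
      unfolding cutoff_finite_eq_sum[OF that(1)] using that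
      by (subst ell2_linear_sum[OF T])
        (auto intro!: ell2_inner_sum_left ell2_scale ell2_linear_in[OF T])
    also have "\<dots> = (\<Sum>x\<in>F. f x * cnj (S g x))"
      using that by (intro sum.cong)
        (auto simp: S_def ell2_inner_scale_left ell2_linear_in[OF T] subsetD)
    also have "\<dots> = (\<Sum>\<^sub>\<infinity>x\<in>F. f x * cnj (S g x))" using that by simp
    also have "\<dots> = ell2_inner X (cutoff F f) (S g)"
      unfolding ell2_inner_def by (rule infsum_cong_neutral) (use that in \<open>auto simp: cutoff_def\<close>)
    finally show ?thesis .
  qed
  have bd: "(\<Sum>x\<in>F. (cmod (S g x))\<^sup>2) \<le> (C * ell2_norm Y g)\<^sup>2"
    if F: "finite F" "F \<subseteq> X" and g: "g \<in> ell2 Y" for F g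
  proof -
    \<comment> \<open>Testing the finite identity on the truncation of \<open>S g\<close> itself
      bounds the square of its norm by \<open>C\<close> times that norm times the norm of
      \<open>g\<close>; one factor cancels.\<close>
    let ?s = "cutoff F (S g)"
    have s: "?s \<in> ell2 X" by (rule ell2_finite_support[OF F]) (simp add: cutoff_def)
    have "ell2_inner Y (T ?s) g = ell2_inner X ?s (S g)" by (rule fin[OF F g])
    also have "\<dots> = ell2_inner X ?s ?s"
      unfolding ell2_inner_def by (intro infsum_cong) (simp add: cutoff_def)
    finally have "(ell2_norm X ?s)\<^sup>2 = cmod (ell2_inner Y (T ?s) g)"
      by (simp add: ell2_inner_self norm_power)
    also have "\<dots> \<le> ell2_norm Y (T ?s) * ell2_norm Y g"
      by (intro ell2_cauchy_schwarz ell2_linear_in[OF T] s g)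
    also have "\<dots> \<le> (C * ell2_norm X ?s) * ell2_norm Y g"
      by (intro mult_right_mono C s) simp
    finally have "ell2_norm X ?s * ell2_norm X ?s \<le> ell2_norm X ?s * (C * ell2_norm Y g)"
      by (simp add: power2_eq_square mult_ac)
    then have "ell2_norm X ?s \<le> C * ell2_norm Y g"
      using C(1) by (cases "ell2_norm X ?s = 0")
        (simp_all add: mult_le_cancel_left less_le)
    then have "(ell2_norm X ?s)\<^sup>2 \<le> (C * ell2_norm Y g)\<^sup>2" by (intro power_mono) auto
    then show ?thesis by (simp add: ell2_norm_cutoff_finite[OF F])
  qed
  have S: "S g \<in> ell2 X" "ell2_norm X (S g) \<le> C * ell2_norm Y g" if g: "g \<in> ell2 Y" for g
  proof -
    have z: "\<And>x. x \<notin> X \<Longrightarrow> S g x = 0" by (simp add: S_def)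
    show "S g \<in> ell2 X" by (rule ell2_in_if_bounded(1)[OF z bd]) (use g in auto)
    have "(ell2_norm X (S g))\<^sup>2 \<le> (C * ell2_norm Y g)\<^sup>2"
      by (rule ell2_in_if_bounded(2)[OF z bd]) (use g in auto)
    then show "ell2_norm X (S g) \<le> C * ell2_norm Y g"
      by (rule power2_le_imp_le) (use C(1) in simp)
  qed
  have "ell2_bounded_linear Y X S"
  proof (rule ell2_bounded_linearI[OF S(1) _ _ S(2)])
    show "S (\<lambda>x. f x + g x) = (\<lambda>y. S f y + S g y)" if "f \<in> ell2 Y" "g \<in> ell2 Y" for f g
      using that by (auto simp: S_def ell2_inner_add_right ell2_linear_in[OF T])
    show "S (\<lambda>x. c * f x) = (\<lambda>y. c * S f y)" if "f \<in> ell2 Y" for c f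
      using that by (auto simp: S_def ell2_inner_scale_right ell2_linear_in[OF T])
  qed auto
  moreover have "ell2_inner Y (T f) g = ell2_inner X f (S g)" if f: "f \<in> ell2 X" and g: "g \<in> ell2 Y" for f g
  proof -
    have le: "cmod (ell2_inner Y (T f) g - ell2_inner X f (S g)) \<le> \<epsilon>" if "\<epsilon> > 0" for \<epsilon>
    proof -
      \<comment> \<open>Each of the two error terms is at most \<open>C * ell2_norm Y g\<close>
        times the truncation error; the summand 1 keeps the divisor positive.\<close>
      define K where "K = 2 * C * ell2_norm Y g + 1"
      have K: "K > 0" using C(1) by (simp add: K_def add_nonneg_pos)
      obtain F where F: "finite F" "F \<subseteq> X" and l: "ell2_norm X (\<lambda>x. f x - cutoff F f x) < \<epsilon> / K"
        using ell2_finite_approx[OF f, of "\<epsilon> / K"] \<open>\<epsilon> > 0\<close> K by auto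
      let ?r = "\<lambda>x. f x - cutoff F f x"
      have r: "?r \<in> ell2 X" using f by blast
      have e: "ell2_inner Y (T f) g - ell2_inner X f (S g) = ell2_inner Y (T ?r) g - ell2_inner X ?r (S g)"
        using f g fin[OF F g, of f] by (simp add: ell2_linear_diff[OF T] cutoff_ell2 S
            ell2_inner_diff_left ell2_linear_in[OF T])
      have "cmod (ell2_inner Y (T ?r) g) \<le> ell2_norm Y (T ?r) * ell2_norm Y g"
        by (intro ell2_cauchy_schwarz ell2_linear_in[OF T] r g)
      also have "\<dots> \<le> (C * ell2_norm X ?r) * ell2_norm Y g"
        by (intro mult_right_mono C r) simp
      finally have 1: "cmod (ell2_inner Y (T ?r) g) \<le> C * ell2_norm Y g * ell2_norm X ?r"
        by (simp add: mult_ac)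
      have "cmod (ell2_inner X ?r (S g)) \<le> ell2_norm X ?r * ell2_norm X (S g)"
        by (intro ell2_cauchy_schwarz S r g)
      also have "\<dots> \<le> ell2_norm X ?r * (C * ell2_norm Y g)"
        by (intro mult_left_mono S g) simp
      finally have 2: "cmod (ell2_inner X ?r (S g)) \<le> C * ell2_norm Y g * ell2_norm X ?r"
        by (simp add: mult_ac)
      have "K * ell2_norm X ?r = C * ell2_norm Y g * ell2_norm X ?r
          + C * ell2_norm Y g * ell2_norm X ?r + ell2_norm X ?r"
        by (simp add: K_def algebra_simps)
      then have "cmod (ell2_inner Y (T f) g - ell2_inner X f (S g)) \<le> K * ell2_norm X ?r"
        unfolding e using norm_triangle_ineq4[of "ell2_inner Y (T ?r) g" "ell2_inner X ?r (S g)"]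
          1 2 ell2_norm_nonneg[of X ?r] by linarith
      also have "\<dots> \<le> \<epsilon>" using l K by (simp add: field_simps)
      finally show ?thesis .
    qed
    have "cmod (ell2_inner Y (T f) g - ell2_inner X f (S g)) \<le> 0"
      by (rule field_le_epsilon) (use le in simp)
    then show ?thesis by simp
  qed
  ultimately show ?thesis by (rule that)
qed

text \<open>Makes the definite description in \<open>op_adjoint\<close> usable: existence comes from
  the coefficientwise construction, uniqueness from testing against all vectors.\<close>

lemma op_adjoint_inner:
  assumes a: "a \<in> bounded_ops X"
  shows "op_adjoint X a \<in> bounded_ops X"
    and "f \<in> ell2 X \<Longrightarrow> g \<in> ell2 X \<Longrightarrow> ell2_inner X (a f) g = ell2_inner X f (op_adjoint X a g)"
proof -
  let ?P = "\<lambda>b. b \<in> bounded_ops X \<and>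
     (\<forall>f\<in>ell2 X. \<forall>g\<in>ell2 X. ell2_inner X (a f) g = ell2_inner X f (b g))"
  obtain S where S: "ell2_bounded_linear X X S"
    "\<And>f g. f \<in> ell2 X \<Longrightarrow> g \<in> ell2 X \<Longrightarrow> ell2_inner X (a f) g = ell2_inner X f (S g)"
    using ell2_linear_adjoint[OF bounded_ops_linear[OF a]] by blast
  have "?P (restrict S (ell2 X))"
    using S by (simp add: restrict_bounded_ops)
  moreover have "b = b'" if b: "?P b" and b': "?P b'" for b b'
  proof (rule extensionalityI)
    show "b \<in> extensional (ell2 X)" "b' \<in> extensional (ell2 X)"
      using b b' by (auto simp: bounded_ops_iff)
    fix g assume g: "g \<in> ell2 X"
    show "b g = b' g"
    proof (rule ell2_eqI_inner)
      show "b g \<in> ell2 X" "b' g \<in> ell2 X"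
        using bounded_ops_in b b' g by metis+
      show "ell2_inner X f (b g) = ell2_inner X f (b' g)" if "f \<in> ell2 X" for f
        using b b' g that by metis
    qed
  qed
  ultimately have "\<exists>!b. ?P b" by blast
  then have "?P (op_adjoint X a)"
    unfolding op_adjoint_def by (rule theI')
  then show "op_adjoint X a \<in> bounded_ops X"
    and "f \<in> ell2 X \<Longrightarrow> g \<in> ell2 X \<Longrightarrow> ell2_inner X (a f) g = ell2_inner X f (op_adjoint X a g)"
    by blast+
qed

lemma op_adjoint_eqI:
  assumes a: "a \<in> bounded_ops X" and b: "b \<in> bounded_ops X"
    and "\<And>f g. f \<in> ell2 X \<Longrightarrow> g \<in> ell2 X \<Longrightarrow> ell2_inner X (a f) g = ell2_inner X f (b g)"
  shows "op_adjoint X a = b"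
proof (rule extensionalityI)
  show "op_adjoint X a \<in> extensional (ell2 X)" "b \<in> extensional (ell2 X)"
    using op_adjoint_inner(1)[OF a] b by (auto simp: bounded_ops_iff)
  fix g assume g: "g \<in> ell2 X"
  show "op_adjoint X a g = b g"
  proof (rule ell2_eqI_inner)
    show "op_adjoint X a g \<in> ell2 X" "b g \<in> ell2 X"
      using bounded_ops_in op_adjoint_inner(1)[OF a] b g by metis+
    show "ell2_inner X f (op_adjoint X a g) = ell2_inner X f (b g)" if "f \<in> ell2 X" for f
      using op_adjoint_inner(2)[OF a that g] assms(3)[OF that g] by simp
  qed
qed

text \<open>A real bound in place of the supremum in \<open>ennreal\<close>. The coordinate
  \<open>b (ell2_basis x) z\<close> is the inner product that occurs in
  \<open>propagation\<close>.\<close>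

definition propagation_le :: "'a set \<Rightarrow> ('a \<Rightarrow> 'a \<Rightarrow> real) \<Rightarrow> (('a \<Rightarrow> complex) \<Rightarrow> ('a \<Rightarrow> complex)) \<Rightarrow> real \<Rightarrow> bool" where
  "propagation_le X d b t \<longleftrightarrow> (\<forall>x\<in>X. \<forall>z\<in>X. b (ell2_basis x) z \<noteq> 0 \<longrightarrow> d x z \<le> t)"

lemma propagation_finite_iff: "propagation X d b < \<infinity> \<longleftrightarrow> (\<exists>t. propagation_le X d b t)"
proof
  assume fin: "propagation X d b < \<infinity>"
  have "d x z \<le> enn2real (propagation X d b)"
    if "x \<in> X" "z \<in> X" "b (ell2_basis x) z \<noteq> 0" for x z
  proof -
    have "ennreal (d x z) \<le> propagation X d b"
      unfolding propagation_def
    proof (rule Sup_upper, intro CollectI exI conjI)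
      show "ell2_inner X (b (ell2_basis x)) (ell2_basis z) \<noteq> 0"
        using that by (simp add: ell2_inner_basis_right)
    qed (use that in auto)
    also have "\<dots> = ennreal (enn2real (propagation X d b))" using fin by simp
    finally show ?thesis by (simp add: ennreal_le_iff)
  qed
  then show "\<exists>t. propagation_le X d b t" unfolding propagation_le_def by blast
next
  assume "\<exists>t. propagation_le X d b t"
  then obtain t where t: "propagation_le X d b t" ..
  have "propagation X d b \<le> ennreal t"
    unfolding propagation_def
  proof (rule Sup_least, clarify)
    fix x z assume "x \<in> X" "z \<in> X" "ell2_inner X (b (ell2_basis x)) (ell2_basis z) \<noteq> 0"
    then show "ennreal (d x z) \<le> ennreal t"
      using t by (auto simp: propagation_le_def ell2_inner_basis_right intro!: ennreal_leI)
  qed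
  then show "propagation X d b < \<infinity>" using order.strict_trans1 by force
qed

section \<open>Operator norm and approximation by finite propagation\<close>

lemma op_norm_bound:
  assumes a: "ell2_bounded_linear X X a" and f: "f \<in> ell2 X"
  shows "ell2_norm X (a f) \<le> op_norm X a * ell2_norm X f"
proof (cases "ell2_norm X f = 0")
  case True
  then show ?thesis using ell2_norm_eq_0[OF f True] ell2_linear_zero[OF a] by simp
next
  case False
  obtain C where C: "C > 0" "\<And>f. f \<in> ell2 X \<Longrightarrow> ell2_norm X (a f) \<le> C * ell2_norm X f"
    using ell2_linear_bound[OF a] by blast
  let ?c = "of_real (1 / ell2_norm X f) :: complex"
  have g: "(\<lambda>x. ?c * f x) \<in> ell2 X" using f by blast
  have "ell2_norm X (a (\<lambda>x. ?c * f x)) \<le> op_norm X a"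
    unfolding op_norm_def
  proof (rule cSUP_upper)
    show "(\<lambda>x. ?c * f x) \<in> {f \<in> ell2 X. ell2_norm X f \<le> 1}"
      using g False unfolding mem_Collect_eq ell2_norm_scale by (simp add: norm_divide)
    \<comment> \<open>A supremum of reals is an upper bound only if the set is bounded above; the
      boundedness of \<open>a\<close> supplies this.\<close>
    show "bdd_above ((\<lambda>f. ell2_norm X (a f)) ` {f \<in> ell2 X. ell2_norm X f \<le> 1})"
    proof (rule bdd_aboveI2)
      fix f assume "f \<in> {f \<in> ell2 X. ell2_norm X f \<le> 1}"
      then have "ell2_norm X (a f) \<le> C * ell2_norm X f" "C * ell2_norm X f \<le> C * 1"
        using C by (auto intro: mult_left_mono)
      then show "ell2_norm X (a f) \<le> C" by simp
    qed
  qed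
  then show ?thesis
    unfolding ell2_linear_scale[OF a f] ell2_norm_scale
    using False ell2_norm_nonneg[of X f] by (simp add: norm_divide pos_divide_le_eq less_le)
qed

lemma op_norm_le:
  assumes "\<And>f. f \<in> ell2 X \<Longrightarrow> ell2_norm X (a f) \<le> C * ell2_norm X f" "C \<ge> 0"
  shows "op_norm X a \<le> C"
  unfolding op_norm_def
proof (rule cSUP_least)
  have "(\<lambda>x. 0) \<in> {f \<in> ell2 X. ell2_norm X f \<le> 1}" by simp
  then show "{f \<in> ell2 X. ell2_norm X f \<le> 1} \<noteq> {}" by blast
  fix f assume f: "f \<in> {f \<in> ell2 X. ell2_norm X f \<le> 1}"
  then have "ell2_norm X (a f) \<le> C * ell2_norm X f" by (intro assms(1)) simp
  also have "\<dots> \<le> C * 1" using f assms(2) by (intro mult_left_mono) auto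
  finally show "ell2_norm X (a f) \<le> C" by simp
qed

lemma op_diff_apply:
  assumes "b \<in> bounded_ops X" "f \<in> ell2 X"
  shows "op_add X a (op_scale X (-1) b) f = (\<lambda>x. a f x - b f x)"
  using assms by (simp add: op_add_def op_scale_def)

lemma uniform_roe_approx:
  assumes a: "a \<in> uniform_roe X d" and "\<epsilon> > 0"
  obtains b t where "b \<in> bounded_ops X" "propagation_le X d b t"
    "\<And>f. f \<in> ell2 X \<Longrightarrow> ell2_norm X (\<lambda>x. a f x - b f x) \<le> \<epsilon> * ell2_norm X f"
proof -
  obtain b where b: "b \<in> bounded_ops X" "propagation X d b < \<infinity>"
    and lt: "op_norm X (op_add X a (op_scale X (-1) b)) < \<epsilon>"
    using a \<open>\<epsilon> > 0\<close> by (auto simp: uniform_roe_def)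
  have a': "a \<in> bounded_ops X" using a by (simp add: uniform_roe_def)
  let ?D = "op_add X a (op_scale X (-1) b)"
  note lin = ell2_linear_diff_map[OF bounded_ops_linear[OF a'] bounded_ops_linear[OF b(1)]]
  have D: "ell2_bounded_linear X X ?D"
    using bounded_ops_linear[OF restrict_bounded_ops[OF lin]]
    by (simp add: op_add_def op_scale_def restrict_def cong: if_cong)
  have "ell2_norm X (\<lambda>x. a f x - b f x) \<le> \<epsilon> * ell2_norm X f" if f: "f \<in> ell2 X" for f
    using op_norm_bound[OF D f] mult_right_mono[OF less_imp_le[OF lt] ell2_norm_nonneg[of X f]]
    unfolding op_diff_apply[OF b(1) f] by linarith
  with b that show ?thesis unfolding propagation_finite_iff by blast
qed

lemma uniform_roeI:
  assumes a: "a \<in> bounded_ops X"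
    and "\<And>\<epsilon>. \<epsilon> > 0 \<Longrightarrow> \<exists>b\<in>bounded_ops X. \<exists>t. propagation_le X d b t \<and>
      (\<forall>f\<in>ell2 X. ell2_norm X (\<lambda>x. a f x - b f x) \<le> \<epsilon> * ell2_norm X f)"
  shows "a \<in> uniform_roe X d"
  unfolding uniform_roe_def
proof (intro CollectI conjI a allI impI)
  fix \<epsilon> :: real assume "\<epsilon> > 0"
  \<comment> \<open>Halving \<epsilon> leaves room for the strict inequality in the
    definition.\<close>
  with assms(2)[of "\<epsilon> / 2"] obtain b t where b: "b \<in> bounded_ops X" "propagation_le X d b t"
    "\<forall>f\<in>ell2 X. ell2_norm X (\<lambda>x. a f x - b f x) \<le> \<epsilon> / 2 * ell2_norm X f" by auto
  have "op_norm X (op_add X a (op_scale X (-1) b)) \<le> \<epsilon> / 2"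
    by (rule op_norm_le) (use b \<open>\<epsilon> > 0\<close> in \<open>simp_all add: op_diff_apply\<close>)
  with b \<open>\<epsilon> > 0\<close> show "\<exists>b\<in>bounded_ops X. propagation X d b < \<infinity> \<and> op_norm X (op_add X a (op_scale X (- 1) b)) < \<epsilon>"
    by (intro bexI[of _ b] conjI propagation_finite_iff[THEN iffD2] exI[of _ t]) auto
qed

lemma finite_propagation_uniform_roe:
  assumes "b \<in> bounded_ops X" "propagation_le X d b t" shows "b \<in> uniform_roe X d"
  by (rule uniform_roeI[OF assms(1)]) (use assms in \<open>intro bexI[of _ b] exI[of _ t], auto\<close>)

lemma uniform_roe_linear: "a \<in> uniform_roe X d \<Longrightarrow> ell2_bounded_linear X X a"
  by (simp add: uniform_roe_def bounded_ops_linear)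

text \<open>A propagation bound speaks of basis vectors only; by continuity of coefficients
  \<open>b v\<close> vanishes wherever every point of the support of \<open>v\<close> is farther
  than \<open>t\<close>, hence on the support of \<open>w\<close>.\<close>

lemma propagation_separated:
  assumes b: "ell2_bounded_linear X X b" "propagation_le X d b t"
    and v: "v \<in> ell2 X" and w: "w \<in> ell2 X"
    and sep: "\<And>x z. x \<in> X \<Longrightarrow> z \<in> X \<Longrightarrow> v x \<noteq> 0 \<Longrightarrow> w z \<noteq> 0 \<Longrightarrow> t < d x z"
  shows "ell2_inner X (b v) w = 0"
  unfolding ell2_inner_def
proof (rule infsum_0)
  fix z assume z: "z \<in> X"
  show "b v z * cnj (w z) = 0"
  proof (cases "w z = 0")
    case False
    have "b v z = 0"
      by (rule ell2_linear_coeff_vanish[OF b(1) v])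
        (use sep[OF _ z _ False] b(2) z in \<open>force simp: propagation_le_def\<close>)
    then show ?thesis by simp
  qed simp
qed

section \<open>Isomorphisms of uniform Roe algebras are spatial\<close>

definition rank_one :: "'a set \<Rightarrow> ('a \<Rightarrow> complex) \<Rightarrow> ('a \<Rightarrow> complex) \<Rightarrow> ('a \<Rightarrow> complex) \<Rightarrow> ('a \<Rightarrow> complex)" where
  "rank_one X v w = (\<lambda>f\<in>ell2 X. \<lambda>z. ell2_inner X f w * v z)"

lemma rank_one_apply: "f \<in> ell2 X \<Longrightarrow> rank_one X v w f = (\<lambda>z. ell2_inner X f w * v z)"
  by (simp add: rank_one_def)

lemma rank_one_bounded:
  assumes v: "v \<in> ell2 X" and w: "w \<in> ell2 X" shows "rank_one X v w \<in> bounded_ops X"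
  unfolding rank_one_def
proof (rule restrict_bounded_ops, rule ell2_bounded_linearI)
  fix f assume f: "f \<in> ell2 X"
  show "ell2_norm X (\<lambda>z. ell2_inner X f w * v z) \<le> (ell2_norm X w * ell2_norm X v) * ell2_norm X f"
    unfolding ell2_norm_scale
    using mult_right_mono[OF ell2_cauchy_schwarz[OF f w] ell2_norm_nonneg[of X v]]
    by (simp add: mult_ac)
qed (use v w in \<open>auto simp: ell2_inner_add_left ell2_inner_scale_left distrib_right intro!: ell2_scale\<close>)

lemma rank_one_diff_norm:
  assumes f: "f \<in> ell2 X" and v: "v \<in> ell2 X" "v' \<in> ell2 X" and w: "w \<in> ell2 X" "w' \<in> ell2 X"
  shows "ell2_norm X (\<lambda>z. rank_one X v w f z - rank_one X v' w' f z)
    \<le> (ell2_norm X (\<lambda>z. w z - w' z) * ell2_norm X v + ell2_norm X w' * ell2_norm X (\<lambda>z. v z - v' z))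
      * ell2_norm X f"
proof -
  let ?dw = "\<lambda>z. w z - w' z" and ?dv = "\<lambda>z. v z - v' z"
  have dw: "?dw \<in> ell2 X" and dv: "?dv \<in> ell2 X" using v w by blast+
  have eq: "(\<lambda>z. rank_one X v w f z - rank_one X v' w' f z)
      = (\<lambda>z. ell2_inner X f ?dw * v z + ell2_inner X f w' * ?dv z)"
    using f v w by (auto simp: rank_one_apply ell2_inner_diff_right algebra_simps)
  have "ell2_norm X (\<lambda>z. ell2_inner X f ?dw * v z + ell2_inner X f w' * ?dv z)
      \<le> ell2_norm X (\<lambda>z. ell2_inner X f ?dw * v z) + ell2_norm X (\<lambda>z. ell2_inner X f w' * ?dv z)"
    by (intro ell2_norm_triangle ell2_scale v dv)
  also have "\<dots> = cmod (ell2_inner X f ?dw) * ell2_norm X v + cmod (ell2_inner X f w') * ell2_norm X ?dv"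
    by (simp only: ell2_norm_scale)
  also have "\<dots> \<le> (ell2_norm X f * ell2_norm X ?dw) * ell2_norm X v
      + (ell2_norm X f * ell2_norm X w') * ell2_norm X ?dv"
    by (intro add_mono mult_right_mono ell2_cauchy_schwarz f dw w) auto
  finally show ?thesis unfolding eq by (simp add: algebra_simps)
qed

text \<open>Truncating \<open>v\<close> and \<open>w\<close> to finite sets leaves finitely many
  nonzero entries, hence finite propagation. That arbitrary vectors are allowed matters over
  \<open>Y\<close>, where rank one operators are pulled back through the isomorphism.\<close>

lemma rank_one_uniform_roe:
  assumes v: "v \<in> ell2 X" and w: "w \<in> ell2 X" shows "rank_one X v w \<in> uniform_roe X d"
proof (rule uniform_roeI[OF rank_one_bounded[OF v w]])
  fix \<epsilon> :: real assume "\<epsilon> > 0"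
  define K where "K = ell2_norm X v + ell2_norm X w + 1"
  have K: "K > 0" "ell2_norm X v \<le> K" "ell2_norm X w \<le> K"
    by (auto simp: K_def add_nonneg_pos)
  \<comment> \<open>Both error terms in \<open>rank_one_diff_norm\<close> become at most \<eta> * K,
    which is half of \<epsilon>.\<close>
  define \<eta> where "\<eta> = \<epsilon> / (2 * K)"
  have \<eta>: "\<eta> > 0" using \<open>\<epsilon> > 0\<close> K by (simp add: \<eta>_def)
  obtain F where F: "finite F" "F \<subseteq> X" "ell2_norm X (\<lambda>x. v x - cutoff F v x) < \<eta>"
    using ell2_finite_approx[OF v \<eta>] by blast
  obtain G where G: "finite G" "G \<subseteq> X" "ell2_norm X (\<lambda>x. w x - cutoff G w x) < \<eta>"
    using ell2_finite_approx[OF w \<eta>] by blast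
  let ?b = "rank_one X (cutoff F v) (cutoff G w)"
  have cv: "cutoff F v \<in> ell2 X" and cw: "cutoff G w \<in> ell2 X" using v w by blast+
  have fin: "finite (G \<times> F)" using F G by blast
  \<comment> \<open>A crude bound: each distance that occurs is at most the sum of all of them over
    a finite set.\<close>
  have "propagation_le X d ?b (\<Sum>(x, z)\<in>G \<times> F. \<bar>d x z\<bar>)"
    unfolding propagation_le_def
  proof (intro ballI impI)
    fix x z assume xz: "x \<in> X" "z \<in> X" "?b (ell2_basis x) z \<noteq> 0"
    then have "x \<in> G" "z \<in> F"
      by (auto simp: rank_one_apply ell2_inner_basis_left cutoff_def split: if_splits)
    then have "(\<Sum>(x, z)\<in>{(x, z)}. \<bar>d x z\<bar>) \<le> (\<Sum>(x, z)\<in>G \<times> F. \<bar>d x z\<bar>)"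
      using fin by (intro sum_mono2) auto
    then show "d x z \<le> (\<Sum>(x, z)\<in>G \<times> F. \<bar>d x z\<bar>)" by simp
  qed
  moreover have "ell2_norm X (\<lambda>z. rank_one X v w f z - ?b f z) \<le> \<epsilon> * ell2_norm X f"
    if f: "f \<in> ell2 X" for f
  proof -
    have "ell2_norm X (\<lambda>z. w z - cutoff G w z) * ell2_norm X v
        + ell2_norm X (cutoff G w) * ell2_norm X (\<lambda>z. v z - cutoff F v z) \<le> \<eta> * K + K * \<eta>"
      using F G K ell2_norm_cutoff_le[OF w, of G] \<eta> by (intro add_mono mult_mono) auto
    also have "\<dots> = \<epsilon>" using K by (simp add: \<eta>_def field_simps)
    finally have le: "ell2_norm X (\<lambda>z. w z - cutoff G w z) * ell2_norm X v
        + ell2_norm X (cutoff G w) * ell2_norm X (\<lambda>z. v z - cutoff F v z) \<le> \<epsilon>" .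
    show ?thesis
      by (rule order_trans[OF rank_one_diff_norm[OF f v cv w cw] mult_right_mono[OF le]]) simp
  qed
  ultimately show "\<exists>b\<in>bounded_ops X. \<exists>t. propagation_le X d b t \<and>
      (\<forall>f\<in>ell2 X. ell2_norm X (\<lambda>x. rank_one X v w f x - b f x) \<le> \<epsilon> * ell2_norm X f)"
    using rank_one_bounded[OF cv cw] by blast
qed

lemma compose_rank_one:
  assumes "a \<in> bounded_ops X" "v \<in> ell2 X"
  shows "compose (ell2 X) a (rank_one X v w) = rank_one X (a v) w"
  using assms by (auto simp: compose_def rank_one_def restrict_def ell2_linear_scale[OF bounded_ops_linear])

lemma op_scale_rank_one: "op_scale X c (rank_one X v w) = rank_one X (\<lambda>z. c * v z) w"
  by (auto simp: op_scale_def rank_one_def restrict_def mult_ac)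

lemma op_adjoint_rank_one:
  assumes v: "v \<in> ell2 X" and w: "w \<in> ell2 X"
  shows "op_adjoint X (rank_one X v w) = rank_one X w v"
proof (rule op_adjoint_eqI)
  fix f g assume f: "f \<in> ell2 X" and g: "g \<in> ell2 X"
  show "ell2_inner X (rank_one X v w f) g = ell2_inner X f (rank_one X w v g)"
    using f g v w ell2_inner_cnj[of X v g]
    by (simp add: rank_one_apply ell2_inner_scale_left ell2_inner_scale_right)
qed (use v w in \<open>auto intro: rank_one_bounded\<close>)

text \<open>\<open>V\<close> is both inverse and adjoint of the unitary \<open>U\<close>. Of the
  isomorphism only the fact is kept that conjugation carries each algebra into the other, in a form
  symmetric in the two sides, so that every result has a counterpart with \<open>X\<close> and
  \<open>Y\<close> exchanged.\<close>

locale roe_spatial =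
  fixes X :: "'a set" and dX :: "'a \<Rightarrow> 'a \<Rightarrow> real" and Y :: "'b set" and dY :: "'b \<Rightarrow> 'b \<Rightarrow> real"
    and U :: "('a \<Rightarrow> complex) \<Rightarrow> ('b \<Rightarrow> complex)" and V :: "('b \<Rightarrow> complex) \<Rightarrow> ('a \<Rightarrow> complex)"
  assumes U_in: "f \<in> ell2 X \<Longrightarrow> U f \<in> ell2 Y" and V_in: "g \<in> ell2 Y \<Longrightarrow> V g \<in> ell2 X"
    and V_U: "f \<in> ell2 X \<Longrightarrow> V (U f) = f" and U_V: "g \<in> ell2 Y \<Longrightarrow> U (V g) = g"
    and adjoint: "f \<in> ell2 X \<Longrightarrow> g \<in> ell2 Y \<Longrightarrow> ell2_inner Y (U f) g = ell2_inner X f (V g)"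
    and push: "a \<in> uniform_roe X dX \<Longrightarrow> \<exists>b\<in>uniform_roe Y dY. \<forall>f\<in>ell2 X. U (a f) = b (U f)"
    and pull: "b \<in> uniform_roe Y dY \<Longrightarrow> \<exists>a\<in>uniform_roe X dX. \<forall>g\<in>ell2 Y. V (b g) = a (V g)"

lemma (in roe_spatial) inverse: "roe_spatial Y dY X dX V U"
proof
  show "ell2_inner X (V f) g = ell2_inner Y f (U g)" if "f \<in> ell2 Y" "g \<in> ell2 X" for f g
    using adjoint[OF that(2,1)] ell2_inner_cnj[of X "V f" g] ell2_inner_cnj[of Y f "U g"] by simp
qed (rule U_in V_in V_U U_V push pull; assumption)+

text \<open>A unit vector \<open>u0\<close> in the range of the image of the diagonal unit at
  \<open>x0\<close> is carried by the images of the units \<open>e x x0\<close> to vectors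
  \<open>u x\<close>. The matrix relations make these orthonormal. Completeness needs more: it uses
  that \<Phi> is onto an algebra containing all rank one operators of \<open>ell2 Y\<close>.\<close>

lemma star_isomorphism_spatial:
  assumes \<Phi>: "star_isomorphism X (uniform_roe X dX) Y (uniform_roe Y dY) \<Phi>" and x0: "x0 \<in> X"
  shows "\<exists>U V. roe_spatial X dX Y dY U V"
proof -
  let ?A = "uniform_roe X dX" and ?B = "uniform_roe Y dY"
  have bij: "bij_betw \<Phi> ?A ?B"
    and scale: "\<And>c a. a \<in> ?A \<Longrightarrow> \<Phi> (op_scale X c a) = op_scale Y c (\<Phi> a)"
    and comp: "\<And>a b. a \<in> ?A \<Longrightarrow> b \<in> ?A \<Longrightarrow> \<Phi> (compose (ell2 X) a b) = compose (ell2 Y) (\<Phi> a) (\<Phi> b)"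
    and adj: "\<And>a. a \<in> ?A \<Longrightarrow> \<Phi> (op_adjoint X a) = op_adjoint Y (\<Phi> a)"
    using \<Phi> by (auto simp: star_isomorphism_def)
  have A_ops: "a \<in> bounded_ops X" if "a \<in> ?A" for a using that by (simp add: uniform_roe_def)
  have \<Phi>_roe: "\<Phi> a \<in> ?B" if "a \<in> ?A" for a using bij that by (rule bij_betw_apply)
  then have \<Phi>_ops: "\<Phi> a \<in> bounded_ops Y" if "a \<in> ?A" for a using that by (auto simp: uniform_roe_def)
  have surj: "\<exists>a\<in>?A. \<Phi> a = b" if "b \<in> ?B" for b
    using bij that by (metis bij_betw_imp_surj_on imageE)
  have \<Phi>_in: "\<Phi> a g \<in> ell2 Y" if "a \<in> ?A" "g \<in> ell2 Y" for a g
    using \<Phi>_ops[OF that(1)] that(2) by (rule bounded_ops_in)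
  have \<Phi>_scale: "\<Phi> a (\<lambda>y. c * g y) = (\<lambda>y. c * \<Phi> a g y)" if "a \<in> ?A" "g \<in> ell2 Y" for a c g
    using ell2_linear_scale[OF bounded_ops_linear[OF \<Phi>_ops]] that by blast
  define e where "e x x' = rank_one X (ell2_basis x) (ell2_basis x')" for x x'
  have e_in: "e x x' \<in> ?A" if "x \<in> X" "x' \<in> X" for x x'
    unfolding e_def using that by (intro rank_one_uniform_roe) auto
  have e_adj: "\<Phi> (e x' x) = op_adjoint Y (\<Phi> (e x x'))" if "x \<in> X" "x' \<in> X" for x x'
    using adj[OF e_in[OF that]] that by (simp add: e_def op_adjoint_rank_one)
  have inner_e: "ell2_inner Y (\<Phi> (e x x') f) g = ell2_inner Y f (\<Phi> (e x' x) g)"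
    if "x \<in> X" "x' \<in> X" "f \<in> ell2 Y" "g \<in> ell2 Y" for x x' f g
    using op_adjoint_inner(2)[OF \<Phi>_ops[OF e_in[OF that(1,2)]] that(3,4)] e_adj[OF that(1,2)] by simp
  \<comment> \<open>Compressing \<open>a\<close> between two matrix units leaves a single entry of
    \<open>a\<close> times a matrix unit; this identity in the algebra is transported by
    \<Phi>.\<close>
  have sandwich: "\<Phi> (e x1 x) (\<Phi> a (\<Phi> (e x' x2) g)) = (\<lambda>y. a (ell2_basis x') x * \<Phi> (e x1 x2) g y)"
    if "a \<in> ?A" "x \<in> X" "x' \<in> X" "x1 \<in> X" "x2 \<in> X" "g \<in> ell2 Y" for a x x' x1 x2 g
  proof -
    have ax: "a (ell2_basis x') \<in> ell2 X" by (rule bounded_ops_in[OF A_ops]) (use that in auto)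
    have c1: "compose (ell2 X) a (e x' x2) = rank_one X (a (ell2_basis x')) (ell2_basis x2)"
      unfolding e_def using that A_ops by (intro compose_rank_one) auto
    have r: "rank_one X (a (ell2_basis x')) (ell2_basis x2) \<in> ?A"
      using ax that by (intro rank_one_uniform_roe) auto
    have "compose (ell2 X) (e x1 x) (compose (ell2 X) a (e x' x2))
        = rank_one X (e x1 x (a (ell2_basis x'))) (ell2_basis x2)"
      unfolding c1 using ax that by (intro compose_rank_one A_ops e_in) auto
    also have "\<dots> = op_scale X (a (ell2_basis x') x) (e x1 x2)"
      using ax that by (simp add: e_def rank_one_apply ell2_inner_basis_right op_scale_rank_one)
    finally have "\<Phi> (op_scale X (a (ell2_basis x') x) (e x1 x2))
        = compose (ell2 Y) (\<Phi> (e x1 x)) (compose (ell2 Y) (\<Phi> a) (\<Phi> (e x' x2)))"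
      using that r c1 by (metis comp e_in)
    then have "op_scale Y (a (ell2_basis x') x) (\<Phi> (e x1 x2)) g
        = compose (ell2 Y) (\<Phi> (e x1 x)) (compose (ell2 Y) (\<Phi> a) (\<Phi> (e x' x2))) g"
      using that by (simp add: scale e_in)
    then show ?thesis using that by (simp add: op_scale_def compose_def)
  qed
  have matrix: "\<Phi> (e x1 x) (\<Phi> (e x' x2) g) = (\<lambda>y. of_bool (x = x') * \<Phi> (e x1 x2) g y)"
    if "x \<in> X" "x' \<in> X" "x1 \<in> X" "x2 \<in> X" "g \<in> ell2 Y" for x x' x1 x2 g
  proof -
    have "compose (ell2 X) (e x1 x) (e x' x2) = rank_one X (e x1 x (ell2_basis x')) (ell2_basis x2)"
      unfolding e_def[of x' x2] using that by (intro compose_rank_one A_ops e_in) auto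
    also have "\<dots> = op_scale X (of_bool (x = x')) (e x1 x2)"
    proof -
      have "ell2_inner X (ell2_basis x') (ell2_basis x) = of_bool (x = x')"
        using that by (simp add: ell2_inner_basis_right) (simp add: ell2_basis_def)
      then show ?thesis using that by (simp add: e_def rank_one_apply op_scale_rank_one)
    qed
    finally have "\<Phi> (op_scale X (of_bool (x = x')) (e x1 x2)) = compose (ell2 Y) (\<Phi> (e x1 x)) (\<Phi> (e x' x2))"
      using that by (metis comp e_in)
    then have "op_scale Y (of_bool (x = x')) (\<Phi> (e x1 x2)) g = compose (ell2 Y) (\<Phi> (e x1 x)) (\<Phi> (e x' x2)) g"
      using that by (simp add: scale e_in)
    then show ?thesis using that by (simp add: op_scale_def compose_def)
  qed

  let ?p = "\<Phi> (e x0 x0)"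
  have p_in: "?p g \<in> ell2 Y" if "g \<in> ell2 Y" for g using that x0 \<Phi>_in e_in by blast
  have pp: "?p (?p g) = ?p g" if "g \<in> ell2 Y" for g using matrix[OF x0 x0 x0 x0 that] by simp
  have "\<exists>g\<in>ell2 Y. ?p g \<noteq> (\<lambda>y. 0)"
  proof (rule ccontr)
    assume "\<not> ?thesis"
    then have z: "\<And>g. g \<in> ell2 Y \<Longrightarrow> ?p g = (\<lambda>y. 0)" by blast
    \<comment> \<open>0 times the diagonal unit represents the zero operator. If the unit had image
      0, both would have the same image, against injectivity.\<close>
    let ?z = "op_scale X 0 (e x0 x0)"
    have zA: "?z \<in> ?A" unfolding e_def op_scale_rank_one by (rule rank_one_uniform_roe) (use x0 in auto)
    have "\<Phi> ?z = op_scale Y 0 ?p" using scale e_in x0 by blast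
    also have "\<dots> = ?p"
    proof (rule extensionalityI)
      show "op_scale Y 0 ?p \<in> extensional (ell2 Y)" by (simp add: op_scale_def)
      show "?p \<in> extensional (ell2 Y)" using \<Phi>_ops e_in x0 by (simp add: bounded_ops_iff)
    qed (simp add: op_scale_def z)
    finally have "?z = e x0 x0"
      using bij zA e_in x0 by (metis bij_betw_inv_into_left)
    then have "?z (ell2_basis x0) x0 = e x0 x0 (ell2_basis x0) x0" by simp
    moreover have "?z (ell2_basis x0) x0 = 0" using x0 by (simp add: op_scale_def)
    moreover have "e x0 x0 (ell2_basis x0) x0 = 1"
      using x0 by (simp add: e_def rank_one_apply ell2_inner_self) (simp add: ell2_basis_def)
    ultimately show False by simp
  qed
  then obtain h where h: "h \<in> ell2 Y" "?p h = h" and h0: "h \<noteq> (\<lambda>y. 0)"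
    using pp p_in by metis
  define n where "n = ell2_norm Y h"
  have n: "n > 0" using ell2_norm_eq_0[OF h(1)] h0 by (auto simp: n_def less_le)
  \<comment> \<open>Compression by the diagonal unit turns every element into a multiple of that
    unit. For the preimage of \<open>rank_one Y h h\<close> this says that all vectors in the range
    of the projection are multiples of \<open>h\<close>.\<close>
  have p_rank: "\<exists>c. ?p g = (\<lambda>y. c * h y)" if g: "g \<in> ell2 Y" for g
  proof -
    obtain a where a: "a \<in> ?A" "\<Phi> a = rank_one Y h h"
      using surj rank_one_uniform_roe[OF h(1) h(1)] by blast
    let ?c = "a (ell2_basis x0) x0"
    have eq: "(\<lambda>y. ell2_inner Y (?p g) h * h y) = (\<lambda>y. ?c * ?p g y)" if "g \<in> ell2 Y" for g
      using sandwich[OF a(1) x0 x0 x0 x0 that] \<Phi>_scale[OF e_in[OF x0 x0] h(1)] h p_in[OF that]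
      by (simp add: a(2) rank_one_apply)
    obtain y where y: "h y \<noteq> 0" using h0 by auto
    have "?c \<noteq> 0"
      using fun_cong[OF eq[OF h(1)], of y] h y n by (auto simp: ell2_inner_self n_def)
    then have "?p g = (\<lambda>y. ell2_inner Y (?p g) h / ?c * h y)"
      using eq[OF g] by (auto simp: fun_eq_iff field_simps)
    then show ?thesis by blast
  qed
  define u0 where "u0 = (\<lambda>y. of_real (1 / n) * h y)"
  have u0: "u0 \<in> ell2 Y" unfolding u0_def using h(1) by blast
  have pu0: "?p u0 = u0"
    unfolding u0_def \<Phi>_scale[OF e_in[OF x0 x0] h(1)] h(2) by simp
  have "ell2_norm Y u0 = 1" unfolding u0_def ell2_norm_scale n_def[symmetric] using n by (simp add: norm_divide)
  then have u0_inner: "ell2_inner Y u0 u0 = 1" by (simp add: ell2_inner_self)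

  define u where "u x = \<Phi> (e x x0) u0" for x
  have u_in: "u x \<in> ell2 Y" if "x \<in> X" for x unfolding u_def using that x0 \<Phi>_in e_in u0 by blast
  have coeff: "ell2_inner Y (\<Phi> a (u x')) (u x) = a (ell2_basis x') x" if "a \<in> ?A" "x \<in> X" "x' \<in> X" for a x x'
  proof -
    have "ell2_inner Y (\<Phi> a (u x')) (u x) = ell2_inner Y (\<Phi> (e x0 x) (\<Phi> a (\<Phi> (e x' x0) u0))) u0"
      unfolding u_def using that x0 u0 by (subst inner_e) (auto intro!: \<Phi>_in e_in)
    also have "\<dots> = ell2_inner Y (\<lambda>y. a (ell2_basis x') x * ?p u0 y) u0"
      using sandwich[OF that x0 x0 u0] by simp
    also have "\<dots> = a (ell2_basis x') x"
      by (simp add: pu0 ell2_inner_scale_left u0 u0_inner)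
    finally show ?thesis .
  qed
  have ortho: "ell2_inner Y (u x') (u x) = of_bool (x = x')" if "x \<in> X" "x' \<in> X" for x x'
  proof -
    have "ell2_inner Y (u x') (u x) = ell2_inner Y (\<Phi> (e x0 x) (\<Phi> (e x' x0) u0)) u0"
      unfolding u_def using that x0 u0 by (subst inner_e) (auto intro!: \<Phi>_in e_in)
    also have "\<dots> = ell2_inner Y (\<lambda>y. of_bool (x = x') * ?p u0 y) u0"
      using matrix[OF that x0 x0 u0] by simp
    also have "\<dots> = of_bool (x = x')"
      by (simp only: pu0 ell2_inner_scale_left u0 u0_inner mult_1_right)
    finally show ?thesis .
  qed

  \<comment> \<open>\<open>V\<close> comes before \<open>U\<close>: its coefficients are explicit
    and Bessel's inequality bounds it. Taking \<open>U\<close> as its adjoint avoids infinite sums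
    of vectors.\<close>
  define V where "V g x = (if x \<in> X then ell2_inner Y g (u x) else 0)" for g x
  have bessel: "(\<Sum>x\<in>F. (cmod (V g x))\<^sup>2) \<le> (ell2_norm Y g)\<^sup>2"
    if F: "finite F" "F \<subseteq> X" and g: "g \<in> ell2 Y" for F g
  proof -
    let ?s = "\<lambda>y. \<Sum>x\<in>F. V g x * u x y" and ?S = "\<Sum>x\<in>F. (cmod (V g x))\<^sup>2"
    have t: "(\<lambda>y. V g x * u x y) \<in> ell2 Y" if "x \<in> F" for x
      using that F u_in by (intro ell2_scale) blast
    then have s: "?s \<in> ell2 Y" by (intro ell2_sum)
    have inner_s: "ell2_inner Y ?s k = (\<Sum>x\<in>F. V g x * ell2_inner Y (u x) k)" if "k \<in> ell2 Y" for k
      using that F u_in t by (subst ell2_inner_sum_left) (auto simp: ell2_inner_scale_left subsetD)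
    have "ell2_inner Y ?s g = (\<Sum>x\<in>F. V g x * cnj (V g x))"
      unfolding inner_s[OF g] using F
      by (intro sum.cong refl) (auto simp: V_def ell2_inner_cnj[of Y "u _" g])
    also have "\<dots> = of_real ?S" by (simp add: complex_norm_square[symmetric])
    finally have 1: "ell2_inner Y ?s g = of_real ?S" .
    have us: "ell2_inner Y (u x) ?s = cnj (V g x)" if "x \<in> F" for x
    proof -
      have "ell2_inner Y ?s (u x) = (\<Sum>x'\<in>F. V g x' * of_bool (x = x'))"
        using that F by (subst inner_s) (auto intro!: u_in sum.cong simp: ortho subsetD)
      also have "\<dots> = V g x" using that F by simp
      finally show ?thesis using ell2_inner_cnj[of Y "u x" ?s] by simp
    qed
    have "ell2_inner Y ?s ?s = (\<Sum>x\<in>F. V g x * cnj (V g x))"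
      unfolding inner_s[OF s] by (intro sum.cong refl) (simp add: us)
    also have "\<dots> = of_real ?S" by (simp add: complex_norm_square[symmetric])
    finally have 2: "(ell2_norm Y ?s)\<^sup>2 = ?S" by (simp only: ell2_inner_self of_real_eq_iff)
    \<comment> \<open>\<open>?s\<close> is the projection of \<open>g\<close> to the span of
      finitely many \<open>u x\<close>; its square distance to \<open>g\<close> is the defect in
      Bessel's inequality.\<close>
    have "0 \<le> (ell2_norm Y (\<lambda>y. ?s y - g y))\<^sup>2" by simp
    also have "\<dots> = (ell2_norm Y g)\<^sup>2 - ?S"
      unfolding ell2_norm_diff_sq[OF s g] 1 2 by simp
    finally show ?thesis by simp
  qed
  have V_lin: "ell2_bounded_linear Y X V"
  proof (rule ell2_bounded_linearI)
    fix g assume g: "g \<in> ell2 Y"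
    have z: "\<And>x. x \<notin> X \<Longrightarrow> V g x = 0" by (simp add: V_def)
    show "V g \<in> ell2 X" by (rule ell2_in_if_bounded(1)[OF z bessel[OF _ _ g]])
    have "(ell2_norm X (V g))\<^sup>2 \<le> (ell2_norm Y g)\<^sup>2"
      by (rule ell2_in_if_bounded(2)[OF z bessel[OF _ _ g]])
    then have "ell2_norm X (V g) \<le> ell2_norm Y g" by (rule power2_le_imp_le) simp
    then show "ell2_norm X (V g) \<le> 1 * ell2_norm Y g" by simp
  qed (auto simp: V_def ell2_inner_add_left ell2_inner_scale_left u_in)
  note V_in = ell2_linear_in[OF V_lin]
  obtain U where U_lin: "ell2_bounded_linear X Y U"
    and VU_adj: "\<And>g f. g \<in> ell2 Y \<Longrightarrow> f \<in> ell2 X \<Longrightarrow> ell2_inner X (V g) f = ell2_inner Y g (U f)"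
    using ell2_linear_adjoint[OF V_lin] by blast
  note U_in = ell2_linear_in[OF U_lin]
  have U_basis: "U (ell2_basis x) = u x" if x: "x \<in> X" for x
  proof (rule ell2_eqI_inner)
    show "U (ell2_basis x) \<in> ell2 Y" using x by (intro U_in) auto
    show "ell2_inner Y g (U (ell2_basis x)) = ell2_inner Y g (u x)" if "g \<in> ell2 Y" for g
      using VU_adj[OF that, of "ell2_basis x"] x by (simp add: ell2_inner_basis_right V_def)
  qed (use x u_in in blast)
  have V_u: "V (u x) = ell2_basis x" if "x \<in> X" for x
    using that by (auto simp: V_def ell2_basis_def fun_eq_iff ortho)
  have V_U: "V (U f) = f" if "f \<in> ell2 X" for f
  proof (rule ell2_linear_eqI[OF ell2_linear_comp[OF V_lin U_lin] _ _ that])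
    show "ell2_bounded_linear X X (\<lambda>f. f)" by (rule ell2_bounded_linearI[where C = 1]) auto
  qed (simp add: U_basis V_u)
  \<comment> \<open>If \<open>w\<close> is orthogonal to every \<open>u x\<close>, the preimage of
    \<open>rank_one Y w w\<close> has only zero entries, so it is zero and so is its image;
    evaluation at \<open>w\<close> gives \<open>w = 0\<close>.\<close>
  have complete: "w = (\<lambda>y. 0)" if w: "w \<in> ell2 Y" and Vw: "V w = (\<lambda>x. 0)" for w
  proof -
    obtain a where a: "a \<in> ?A" "\<Phi> a = rank_one Y w w"
      using surj rank_one_uniform_roe[OF w w] by blast
    have "a (ell2_basis x') x = 0" if "x' \<in> X" "x \<in> X" for x x'
    proof -
      have "a (ell2_basis x') x = ell2_inner Y (rank_one Y w w (u x')) (u x)"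
        using coeff[OF a(1) that(2,1)] a(2) by simp
      also have "\<dots> = ell2_inner Y (u x') w * V w x"
        using that w by (simp add: rank_one_apply u_in ell2_inner_scale_left V_def)
      finally show ?thesis using Vw by simp
    qed
    then have az: "a (ell2_basis x') x = 0" if "x' \<in> X" for x x'
      using that ell2_outside[OF bounded_ops_in[OF A_ops[OF a(1)]], of "ell2_basis x'" x] by auto
    have z: "a f = (\<lambda>x. 0)" if "f \<in> ell2 X" for f
      using ell2_linear_coeff_vanish[OF bounded_ops_linear[OF A_ops[OF a(1)]] that] az by auto
    have "op_scale X 0 a = a"
    proof (rule extensionalityI)
      show "op_scale X 0 a \<in> extensional (ell2 X)" by (simp add: op_scale_def)
      show "a \<in> extensional (ell2 X)" using A_ops a(1) by (simp add: bounded_ops_iff)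
    qed (simp add: op_scale_def z)
    then have "\<Phi> a = op_scale Y 0 (\<Phi> a)" using scale[OF a(1), of 0] by simp
    then have "rank_one Y w w w = op_scale Y 0 (rank_one Y w w) w" unfolding a(2) by simp
    then have "(\<lambda>y. ell2_inner Y w w * w y) = (\<lambda>y. 0)"
      using w by (simp add: rank_one_apply op_scale_def)
    then show ?thesis
      using ell2_norm_eq_0[OF w] by (auto simp: fun_eq_iff ell2_inner_self)
  qed
  have U_V: "U (V g) = g" if g: "g \<in> ell2 Y" for g
  proof -
    have UVg: "U (V g) \<in> ell2 Y" using g V_in U_in by blast
    have "V (\<lambda>y. U (V g) y - g y) = (\<lambda>x. 0)"
      using ell2_linear_diff[OF V_lin UVg g] V_U[OF V_in[OF g]] by simp
    then have "(\<lambda>y. U (V g) y - g y) = (\<lambda>y. 0)"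
      using complete ell2_diff[OF UVg g] by blast
    then show ?thesis by (simp add: fun_eq_iff)
  qed
  have intertwine: "U (a f) = \<Phi> a (U f)" if a: "a \<in> ?A" and f: "f \<in> ell2 X" for a f
  proof (rule ell2_linear_eqI[OF _ _ _ f])
    show "ell2_bounded_linear X Y (\<lambda>f. U (a f))"
      by (rule ell2_linear_comp[OF U_lin bounded_ops_linear[OF A_ops[OF a]]])
    show "ell2_bounded_linear X Y (\<lambda>f. \<Phi> a (U f))"
      by (rule ell2_linear_comp[OF bounded_ops_linear[OF \<Phi>_ops[OF a]] U_lin])
    fix x' assume x': "x' \<in> X"
    have ax: "a (ell2_basis x') \<in> ell2 X" by (rule bounded_ops_in[OF A_ops[OF a]]) (use x' in simp)
    have \<Phi>u: "\<Phi> a (u x') \<in> ell2 Y" using a x' \<Phi>_in u_in by blast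
    \<comment> \<open>By \<open>coeff\<close>, \<Phi> a has the same matrix with respect to the
      vectors \<open>u x\<close> as \<open>a\<close> has with respect to the standard basis.\<close>
    have "V (\<Phi> a (u x')) = a (ell2_basis x')"
      using coeff[OF a _ x'] ell2_outside[OF ax] by (auto simp: V_def fun_eq_iff)
    then show "U (a (ell2_basis x')) = \<Phi> a (U (ell2_basis x'))"
      using U_V[OF \<Phi>u] U_basis[OF x'] by simp
  qed
  have "roe_spatial X dX Y dY U V"
  proof
    show "\<exists>b\<in>?B. \<forall>f\<in>ell2 X. U (a f) = b (U f)" if "a \<in> ?A" for a
      using intertwine[OF that] \<Phi>_roe[OF that] by blast
    show "\<exists>a\<in>?A. \<forall>g\<in>ell2 Y. V (b g) = a (V g)" if b: "b \<in> ?B" for b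
    proof -
      obtain a where a: "a \<in> ?A" "\<Phi> a = b" using surj b by blast
      have "V (b g) = a (V g)" if g: "g \<in> ell2 Y" for g
        using intertwine[OF a(1) V_in[OF g]] U_V[OF g] a(2)
          V_U[OF bounded_ops_in[OF A_ops[OF a(1)] V_in[OF g]]] by simp
      with a show ?thesis by blast
    qed
    show "ell2_inner Y (U f) g = ell2_inner X f (V g)" if "f \<in> ell2 X" "g \<in> ell2 Y" for f g
      using VU_adj[OF that(2,1)] ell2_inner_cnj[of X f "V g"] ell2_inner_cnj[of Y "U f" g] by simp
  qed (rule U_in V_in V_U U_V; assumption)+
  then show ?thesis by blast
qed

section \<open>Quasi-locality\<close>

text \<open>A Baire category argument in the compact space of subsets of \<open>X\<close>.\<close>

lemma closed_cover_subsets_interior: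
  fixes C :: "nat \<Rightarrow> 'a set set"
  assumes cover: "\<And>A. A \<subseteq> X \<Longrightarrow> \<exists>n. A \<in> C n"
    and closed: "\<And>n A. A \<subseteq> X \<Longrightarrow> A \<notin> C n \<Longrightarrow>
      \<exists>F. finite F \<and> F \<subseteq> X \<and> (\<forall>A'\<subseteq>X. A' \<inter> F = A \<inter> F \<longrightarrow> A' \<notin> C n)"
  shows "\<exists>n F P. finite F \<and> F \<subseteq> X \<and> P \<subseteq> F \<and> (\<forall>A\<subseteq>X. A \<inter> F = P \<longrightarrow> A \<in> C n)"
proof (rule ccontr)
  assume contra: "\<not> ?thesis"
  \<comment> \<open>A pair \<open>(F, P)\<close> stands for the basic open set of all
    \<open>A\<close> with \<open>A \<inter> F = P\<close>. The relation \<open>R n\<close> says that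
    the second open set lies in the first and misses \<open>C n\<close>.\<close>
  define Q where "Q s \<longleftrightarrow> finite (fst s) \<and> fst s \<subseteq> X \<and> snd s \<subseteq> fst s" for s :: "'a set \<times> 'a set"
  define R where "R n s s' \<longleftrightarrow> fst s \<subseteq> fst s' \<and> snd s' \<inter> fst s = snd s \<and>
      (\<forall>A\<subseteq>X. A \<inter> fst s' = snd s' \<longrightarrow> A \<notin> C n)" for n and s s' :: "'a set \<times> 'a set"
  have step: "\<exists>s'. Q s' \<and> R n s s'" if "Q s" for n s
  proof -
    have s: "finite (fst s)" "fst s \<subseteq> X" "snd s \<subseteq> fst s" using that by (auto simp: Q_def)
    with contra obtain A where A: "A \<subseteq> X" "A \<inter> fst s = snd s" "A \<notin> C n" by metis
    obtain F where F: "finite F" "F \<subseteq> X" "\<And>A'. A' \<subseteq> X \<Longrightarrow> A' \<inter> F = A \<inter> F \<Longrightarrow> A' \<notin> C n"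
      using closed[OF A(1,3)] by metis
    let ?F = "fst s \<union> F"
    have "Q (?F, A \<inter> ?F)" using s F by (auto simp: Q_def)
    moreover have "A' \<notin> C n" if "A' \<subseteq> X" "A' \<inter> ?F = A \<inter> ?F" for A'
      by (rule F(3)) (use that in auto)
    then have "R n s (?F, A \<inter> ?F)" using A by (auto simp: R_def)
    ultimately show ?thesis by blast
  qed
  have "\<exists>f. \<forall>n. Q (f n) \<and> R n (f n) (f (Suc n))"
    by (rule dependent_nat_choice) (use step in \<open>auto intro: exI[of _ "({}, {})"] simp: Q_def\<close>)
  then obtain f where f: "\<And>n. Q (f n)" "\<And>n. R n (f n) (f (Suc n))" by blast
  have mono: "fst (f n) \<subseteq> fst (f m) \<and> snd (f m) \<inter> fst (f n) = snd (f n)" if "n \<le> m" for n m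
    using that
  proof (induction m rule: dec_induct)
    case base then show ?case using f(1)[of n] by (auto simp: Q_def)
  next
    case (step m) then show ?case using f(2)[of m] unfolding R_def by blast
  qed
  \<comment> \<open>The union of the prescribed finite parts is a common point of all the nested
    open sets, so it lies in no \<open>C n\<close>.\<close>
  define A where "A = (\<Union>n. snd (f n))"
  have sub: "snd (f m) \<subseteq> fst (f m)" "fst (f m) \<subseteq> X" for m using f(1)[of m] by (auto simp: Q_def)
  have "A \<subseteq> X" using sub by (fastforce simp: A_def)
  moreover have "A \<inter> fst (f n) = snd (f n)" for n
  proof -
    have "snd (f m) \<inter> fst (f n) \<subseteq> snd (f n)" for m
      using mono[of n m] mono[of m n] sub by (cases "n \<le> m") auto
    then show ?thesis using sub[of n] unfolding A_def by blast
  qed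
  ultimately have "A \<notin> C n" for n using f(2)[of n] by (auto simp: R_def)
  then show False using cover[OF \<open>A \<subseteq> X\<close>] by blast
qed

section \<open>Unitaries between uniformly locally finite spaces\<close>

definition uniformly_locally_finite :: "'a set \<Rightarrow> ('a \<Rightarrow> 'a \<Rightarrow> real) \<Rightarrow> bool" where
  "uniformly_locally_finite X d \<longleftrightarrow>
     (\<forall>r. \<exists>N::nat. \<forall>x\<in>X. finite {z \<in> X. d x z \<le> r} \<and> card {z \<in> X. d x z \<le> r} \<le> N)"

locale ulf_spatial = roe_spatial X dX Y dY U V + X: Metric_space X dX + Y: Metric_space Y dY
  for X :: "'a set" and dX and Y :: "'b set" and dY U V +
  assumes ulf_X: "uniformly_locally_finite X dX" and ulf_Y: "uniformly_locally_finite Y dY"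

lemma (in ulf_spatial) inverse_ulf: "ulf_spatial Y dY X dX V U"
  by (intro ulf_spatial.intro ulf_spatial_axioms.intro inverse ulf_X ulf_Y
      X.Metric_space_axioms Y.Metric_space_axioms)

context roe_spatial
begin

lemma inner_U: "f \<in> ell2 X \<Longrightarrow> g \<in> ell2 X \<Longrightarrow> ell2_inner Y (U f) (U g) = ell2_inner X f g"
  by (simp add: adjoint U_in V_U)

lemma norm_U: "f \<in> ell2 X \<Longrightarrow> ell2_norm Y (U f) = ell2_norm X f"
  using inner_U[of f f] unfolding ell2_inner_self of_real_eq_iff by simp

lemma norm_V: "g \<in> ell2 Y \<Longrightarrow> ell2_norm X (V g) = ell2_norm Y g"
  using norm_U[OF V_in] by (simp add: U_V)

text \<open>Linearity follows from the adjoint relation, by testing both sides against all vectors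
  of \<open>ell2 Y\<close>; the norm bound is isometry.\<close>

lemma U_bounded_linear: "ell2_bounded_linear X Y U"
proof (rule ell2_bounded_linearI)
  show "U (\<lambda>x. f x + g x) = (\<lambda>y. U f y + U g y)" if "f \<in> ell2 X" "g \<in> ell2 X" for f g
    by (rule ell2_eqI_inner[of _ Y])
      (use that in \<open>auto simp: ell2_inner_cnj[of Y _ "U _"] adjoint ell2_inner_add_left
        ell2_inner_add_right U_in V_in ell2_add ell2_inner_cnj[of Y _ "\<lambda>y. U _ y + U _ y"]
        intro!: U_in\<close>)
  show "U (\<lambda>x. c * f x) = (\<lambda>y. c * U f y)" if "f \<in> ell2 X" for c f
    by (rule ell2_eqI_inner[of _ Y])
      (use that in \<open>auto simp: ell2_inner_cnj[of Y _ "U _"] adjoint ell2_inner_scale_left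
        ell2_inner_scale_right U_in V_in ell2_scale intro!: U_in\<close>)
  show "ell2_norm Y (U f) \<le> 1 * ell2_norm X f" if "f \<in> ell2 X" for f
    using that by (simp add: norm_U)
qed (rule U_in)

text \<open>The matrices of \<open>U\<close> and \<open>V\<close> are conjugate transposes, so a
  large entry of one is a large entry of the other.\<close>

lemma U_coeff:
  assumes "x \<in> X" "y \<in> Y" shows "U (ell2_basis x) y = cnj (V (ell2_basis y) x)"
  using assms adjoint[of "ell2_basis x" "ell2_basis y"]
  by (simp add: ell2_inner_basis_left ell2_inner_basis_right)

end

context ulf_spatial
begin

text \<open>Each \<open>A\<close> has its own distance. The set \<open>C n\<close> of all
  \<open>A\<close> for which distance \<open>n\<close> suffices is closed: truncating
  \<open>V v\<close> makes the inner product depend, up to a small error, only on a finite part of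
  \<open>A\<close>. Baire category yields one \<open>n\<close> for all \<open>A\<close> that agree
  with \<open>P\<close> on some finite \<open>F\<close>; what a general set has inside
  \<open>F\<close> is one of finitely many subsets.\<close>

lemma quasi_local_inner:
  assumes "\<epsilon> > 0"
  shows "\<exists>s\<ge>0. \<forall>A\<subseteq>X. \<forall>v\<in>ell2 Y. \<forall>w\<in>ell2 Y.
    (\<forall>y\<in>Y. \<forall>z\<in>Y. v y \<noteq> 0 \<longrightarrow> w z \<noteq> 0 \<longrightarrow> s < dY y z) \<longrightarrow>
    cmod (ell2_inner X (cutoff A (V v)) (V w)) \<le> \<epsilon> * (ell2_norm Y v * ell2_norm Y w)"
proof -
  define sep where "sep s v w \<longleftrightarrow> (\<forall>y\<in>Y. \<forall>z\<in>Y. v y \<noteq> 0 \<longrightarrow> w z \<noteq> 0 \<longrightarrow> s < dY y z)"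
    for s :: real and v w :: "'b \<Rightarrow> complex"
  define q where "q A v w = ell2_inner X (cutoff A (V v)) (V w)" for A v w
  \<comment> \<open>A third of \<epsilon>, because a general set is going to be combined from three
    controlled ones.\<close>
  define C where "C n = {A. \<forall>v\<in>ell2 Y. \<forall>w\<in>ell2 Y. sep (real n) v w \<longrightarrow>
      cmod (q A v w) \<le> \<epsilon> / 3 * (ell2_norm Y v * ell2_norm Y w)}" for n :: nat
  have C_mono: "C n \<subseteq> C m" if "n \<le> m" for n m
  proof -
    have "sep (real n) v w" if "sep (real m) v w" for v w
      using that \<open>n \<le> m\<close> unfolding sep_def by (meson le_less_trans of_nat_mono)
    then show ?thesis unfolding C_def by blast
  qed
  have cover: "\<exists>n. A \<in> C n" if A: "A \<subseteq> X" for A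
  proof -
    have bl: "ell2_bounded_linear X X (cutoff A)"
      by (rule ell2_bounded_linearI[where C = 1])
        (auto simp: ell2_norm_cutoff_le, auto simp: cutoff_def fun_eq_iff)
    have "propagation_le X dX (restrict (cutoff A) (ell2 X)) 0"
      unfolding propagation_le_def
    proof (intro ballI impI)
      fix x z assume xz: "x \<in> X" "z \<in> X" "restrict (cutoff A) (ell2 X) (ell2_basis x) z \<noteq> 0"
      then have "cutoff A (ell2_basis x) z \<noteq> 0" by simp
      then have "z = x" by (auto simp: cutoff_def ell2_basis_def split: if_splits)
      then show "dX x z \<le> 0" using xz by simp
    qed
    then have "restrict (cutoff A) (ell2 X) \<in> uniform_roe X dX"
      by (rule finite_propagation_uniform_roe[OF restrict_bounded_ops[OF bl]])
    from push[OF this] obtain b where b: "b \<in> uniform_roe Y dY"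
      and Ub: "\<And>f. f \<in> ell2 X \<Longrightarrow> U (cutoff A f) = b (U f)" by auto
    have "\<epsilon> / 3 > 0" using assms by simp
    from uniform_roe_approx[OF b this] obtain b' t where b': "b' \<in> bounded_ops Y"
        "propagation_le Y dY b' t"
      and le: "\<And>f. f \<in> ell2 Y \<Longrightarrow> ell2_norm Y (\<lambda>x. b f x - b' f x) \<le> \<epsilon> / 3 * ell2_norm Y f"
      by blast
    obtain n :: nat where n: "t \<le> real n" using real_arch_simple by blast
    have "cmod (q A v w) \<le> \<epsilon> / 3 * (ell2_norm Y v * ell2_norm Y w)"
      if v: "v \<in> ell2 Y" and w: "w \<in> ell2 Y" and sep: "sep (real n) v w" for v w
    proof -
      have bv: "b v \<in> ell2 Y" by (rule ell2_linear_in[OF uniform_roe_linear[OF b] v])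
      have b'v: "b' v \<in> ell2 Y" by (rule bounded_ops_in[OF b'(1) v])
      have "q A v w = ell2_inner Y (b v) w"
        unfolding q_def using adjoint[of "cutoff A (V v)" w] Ub[OF V_in[OF v]] v w
        by (simp add: V_in cutoff_ell2 U_V)
      also have "\<dots> = ell2_inner Y (\<lambda>y. b v y - b' v y) w + ell2_inner Y (b' v) w"
        by (simp add: ell2_inner_diff_left bv b'v w)
      also have "ell2_inner Y (b' v) w = 0"
        by (rule propagation_separated[OF bounded_ops_linear[OF b'(1)] b'(2) v w])
          (use sep n in \<open>force simp: sep_def\<close>)
      finally have "cmod (q A v w) = cmod (ell2_inner Y (\<lambda>y. b v y - b' v y) w)" by simp
      also have "\<dots> \<le> ell2_norm Y (\<lambda>y. b v y - b' v y) * ell2_norm Y w"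
        by (intro ell2_cauchy_schwarz ell2_diff bv b'v w)
      also have "\<dots> \<le> (\<epsilon> / 3 * ell2_norm Y v) * ell2_norm Y w"
        by (intro mult_right_mono le v) simp
      finally show ?thesis by (simp add: mult.assoc)
    qed
    then show ?thesis unfolding C_def by blast
  qed
  have closed: "\<exists>F. finite F \<and> F \<subseteq> X \<and> (\<forall>A'\<subseteq>X. A' \<inter> F = A \<inter> F \<longrightarrow> A' \<notin> C n)"
    if A: "A \<subseteq> X" "A \<notin> C n" for A n
  proof -
    obtain v w where v: "v \<in> ell2 Y" and w: "w \<in> ell2 Y" and sep: "sep (real n) v w"
      and lt: "\<epsilon> / 3 * (ell2_norm Y v * ell2_norm Y w) < cmod (q A v w)"
      using A unfolding C_def by force
    \<comment> \<open>The margin by which \<open>A\<close> fails, scaled so that \<eta> times the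
      norm of \<open>w\<close> stays below it; the added 1 avoids division by zero.\<close>
    define \<eta> where "\<eta> = (cmod (q A v w) - \<epsilon> / 3 * (ell2_norm Y v * ell2_norm Y w)) / (ell2_norm Y w + 1)"
    have w1: "ell2_norm Y w + 1 > 0" by (simp add: add_nonneg_pos)
    have \<eta>: "\<eta> > 0" using lt w1 by (simp add: \<eta>_def)
    obtain F where F: "finite F" "F \<subseteq> X" "ell2_norm X (\<lambda>x. V v x - cutoff F (V v) x) < \<eta>"
      using ell2_finite_approx[OF V_in[OF v] \<eta>] by blast
    have "A' \<notin> C n" if A': "A' \<subseteq> X" "A' \<inter> F = A \<inter> F" for A'
    proof -
      let ?D = "\<lambda>x. cutoff A (V v) x - cutoff A' (V v) x"
      have c: "cutoff A (V v) \<in> ell2 X" "cutoff A' (V v) \<in> ell2 X" using V_in[OF v] by blast+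
      have "ell2_norm X ?D \<le> ell2_norm X (\<lambda>x. V v x - cutoff F (V v) x)"
      proof (rule ell2_norm_mono)
        show "(\<lambda>x. V v x - cutoff F (V v) x) \<in> ell2 X" using V_in[OF v] by blast
        show "cmod (?D x) \<le> cmod (V v x - cutoff F (V v) x)" for x
          using A'(2) by (auto simp: cutoff_def)
      qed
      then have D: "ell2_norm X ?D \<le> \<eta>" using F by linarith
      have "q A v w - q A' v w = ell2_inner X ?D (V w)"
        unfolding q_def by (simp add: ell2_inner_diff_left c V_in[OF w])
      then have "cmod (q A v w - q A' v w) \<le> ell2_norm X ?D * ell2_norm X (V w)"
        using ell2_cauchy_schwarz[OF ell2_diff[OF c] V_in[OF w]] by simp
      also have "\<dots> \<le> \<eta> * ell2_norm Y w"
        unfolding norm_V[OF w] by (intro mult_right_mono D) simp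
      also have "\<dots> < \<eta> * (ell2_norm Y w + 1)" using \<eta> by simp
      also have "\<dots> = cmod (q A v w) - \<epsilon> / 3 * (ell2_norm Y v * ell2_norm Y w)"
        using w1 by (simp add: \<eta>_def)
      finally have "\<epsilon> / 3 * (ell2_norm Y v * ell2_norm Y w) < cmod (q A' v w)"
        using norm_triangle_ineq2[of "q A v w" "q A' v w"] by linarith
      then show ?thesis unfolding C_def using v w sep by force
    qed
    with F show ?thesis by blast
  qed
  obtain n F P where F: "finite F" "F \<subseteq> X" "P \<subseteq> F"
    and C: "\<And>A. A \<subseteq> X \<Longrightarrow> A \<inter> F = P \<Longrightarrow> A \<in> C n"
    using closed_cover_subsets_interior[of X C, OF cover closed] by blast
  obtain m where m: "\<And>B. B \<subseteq> X \<Longrightarrow> B \<in> C (m B)" using cover by metis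
  \<comment> \<open>\<open>n\<close> serves the sets agreeing with \<open>P\<close> on
    \<open>F\<close>, and \<open>m B\<close> serves the subset \<open>B\<close> of \<open>F\<close>;
    these are finitely many numbers.\<close>
  define k where "k = Max (insert n (m ` Pow F))"
  have fin: "finite (insert n (m ` Pow F))" using F by simp
  have kn: "n \<le> k" unfolding k_def by (rule Max_ge[OF fin]) simp
  have km: "m B \<le> k" if "B \<subseteq> F" for B unfolding k_def by (rule Max_ge[OF fin]) (use that in simp)
  have "cmod (q M v w) \<le> \<epsilon> * (ell2_norm Y v * ell2_norm Y w)"
    if M: "M \<subseteq> X" and v: "v \<in> ell2 Y" and w: "w \<in> ell2 Y" and sep: "sep (real k) v w" for M v w
  proof -
    let ?B = "\<epsilon> / 3 * (ell2_norm Y v * ell2_norm Y w)"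
    have bound: "cmod (q A v w) \<le> ?B" if "A \<in> C l" "l \<le> k" for A l
      using C_mono[OF that(2)] that(1) v w sep unfolding C_def by blast
    have 1: "cmod (q (M \<inter> F) v w) \<le> ?B" by (rule bound[OF m km]) (use M in auto)
    have 2: "cmod (q ((M - F) \<union> P) v w) \<le> ?B" by (rule bound[OF C kn]) (use F M in auto)
    have 3: "cmod (q P v w) \<le> ?B" by (rule bound[OF C kn]) (use F in auto)
    have c: "cutoff A (V v) \<in> ell2 X" for A using V_in[OF v] by blast
    \<comment> \<open>The second and third sets agree with \<open>P\<close> on \<open>F\<close>, and
      the first is a subset of \<open>F\<close>. Subtracting the part on \<open>P\<close> corrects
      what the second set contributes inside \<open>F\<close>.\<close>
    have "cutoff M (V v) = (\<lambda>x. cutoff (M \<inter> F) (V v) x + (cutoff ((M - F) \<union> P) (V v) x - cutoff P (V v) x))"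
      using F by (auto simp: cutoff_def fun_eq_iff)
    then have "q M v w = q (M \<inter> F) v w + (q ((M - F) \<union> P) v w - q P v w)"
      unfolding q_def by (simp add: ell2_inner_add_left ell2_inner_diff_left c V_in[OF w] ell2_diff)
    also have "cmod \<dots> \<le> ?B + (?B + ?B)"
      by (intro norm_triangle_le add_mono 1 order_trans[OF norm_triangle_ineq4] 2 3)
    finally show ?thesis by simp
  qed
  then show ?thesis unfolding q_def sep_def by (intro exI[of _ "real k"]) auto
qed

text \<open>Duality: the estimate for inner products is tested on the truncation to \<open>S\<close>
  itself, and one factor of its norm cancels.\<close>

lemma quasi_local:
  assumes "\<epsilon> > 0"
  shows "\<exists>s\<ge>0. \<forall>A\<subseteq>X. \<forall>v\<in>ell2 Y. \<forall>S. (\<forall>y\<in>Y. \<forall>z\<in>S. v y \<noteq> 0 \<longrightarrow> s < dY y z) \<longrightarrow>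
    ell2_norm Y (cutoff S (U (cutoff A (V v)))) \<le> \<epsilon> * ell2_norm Y v"
proof -
  from quasi_local_inner[OF assms] obtain s where s: "s \<ge> 0" and
    ql: "\<forall>A\<subseteq>X. \<forall>v\<in>ell2 Y. \<forall>w\<in>ell2 Y.
      (\<forall>y\<in>Y. \<forall>z\<in>Y. v y \<noteq> 0 \<longrightarrow> w z \<noteq> 0 \<longrightarrow> s < dY y z) \<longrightarrow>
      cmod (ell2_inner X (cutoff A (V v)) (V w)) \<le> \<epsilon> * (ell2_norm Y v * ell2_norm Y w)"
    by (elim exE conjE)
  have "ell2_norm Y (cutoff S (U (cutoff A (V v)))) \<le> \<epsilon> * ell2_norm Y v"
    if A: "A \<subseteq> X" and v: "v \<in> ell2 Y"
      and S: "\<forall>y\<in>Y. \<forall>z\<in>S. v y \<noteq> 0 \<longrightarrow> s < dY y z" for A v S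
  proof -
    let ?g = "U (cutoff A (V v))"
    let ?w = "cutoff S ?g"
    have g: "?g \<in> ell2 Y" by (intro U_in cutoff_ell2 V_in v)
    then have w: "?w \<in> ell2 Y" by blast
    have "of_real ((ell2_norm Y ?w)\<^sup>2) = ell2_inner Y ?g ?w"
      unfolding ell2_inner_self[symmetric] ell2_inner_def
      by (intro infsum_cong) (simp add: cutoff_def)
    also have "\<dots> = ell2_inner X (cutoff A (V v)) (V ?w)"
      by (intro adjoint cutoff_ell2 V_in v w)
    finally have "ell2_inner X (cutoff A (V v)) (V ?w) = of_real ((ell2_norm Y ?w)\<^sup>2)" by simp
    moreover have "\<forall>y\<in>Y. \<forall>z\<in>Y. v y \<noteq> 0 \<longrightarrow> ?w z \<noteq> 0 \<longrightarrow> s < dY y z"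
      using S by (auto simp: cutoff_def split: if_splits)
    ultimately have "(ell2_norm Y ?w)\<^sup>2 \<le> \<epsilon> * (ell2_norm Y v * ell2_norm Y ?w)"
      using bspec[OF bspec[OF ql[THEN spec, THEN mp, OF A] v] w] by (simp only: norm_of_real abs_power2 simp_thms)
    then have "ell2_norm Y ?w * ell2_norm Y ?w \<le> (\<epsilon> * ell2_norm Y v) * ell2_norm Y ?w"
      by (simp add: power2_eq_square mult.assoc)
    then show ?thesis
      using assms mult_right_le_imp_le[of "ell2_norm Y ?w" "ell2_norm Y ?w" "\<epsilon> * ell2_norm Y v"]
        ell2_norm_nonneg[of Y ?w] ell2_norm_nonneg[of Y v]
      by (cases "ell2_norm Y ?w = 0") (auto simp: less_le)
  qed
  with s show ?thesis by (intro exI[of _ s] conjI allI ballI impI)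
qed

end

section \<open>Locating the image of the standard basis\<close>

context ulf_spatial
begin

text \<open>Suppose all coefficients of \<open>f = V (ell2_basis y)\<close> are at most \<delta>. On
  a ball around \<open>y\<close> the vectors \<open>f x * U (ell2_basis x)\<close> then have small
  total square norm, so some signs make their sum small there, and U 1_J f is close to half of the
  basis vector at \<open>y\<close>. Off the ball, quasi-locality makes U 1_J f small. Pulled back by
  the isometry, 1_J f is within 1/4 of f / 2, although the difference has norm exactly 1/2.\<close>

lemma ex_large_coefficient:
  "\<exists>\<delta>>0. \<forall>y\<in>Y. \<exists>x\<in>X. \<delta> \<le> cmod (V (ell2_basis y) x)"
proof -
  from quasi_local[of "1/8"] obtain s where s: "s \<ge> 0" and
    ql: "\<forall>A\<subseteq>X. \<forall>v\<in>ell2 Y. \<forall>S. (\<forall>y\<in>Y. \<forall>z\<in>S. v y \<noteq> 0 \<longrightarrow> s < dY y z) \<longrightarrow>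
      ell2_norm Y (cutoff S (U (cutoff A (V v)))) \<le> 1/8 * ell2_norm Y v" by auto
  obtain N :: nat where N: "\<And>y. y \<in> Y \<Longrightarrow> finite {z \<in> Y. dY y z \<le> s} \<and> card {z \<in> Y. dY y z \<le> s} \<le> N"
    using ulf_Y unfolding uniformly_locally_finite_def by metis
  \<comment> \<open>Makes the square of \<delta> times the number of points in the ball at most
    1/64; \<open>N + 1\<close> excludes division by zero.\<close>
  define \<delta> where "\<delta> = 1 / (8 * sqrt (real N + 1))"
  have "\<delta> > 0" by (simp add: \<delta>_def add_nonneg_pos)
  have \<delta>2: "\<delta>\<^sup>2 * real N \<le> (1/8)\<^sup>2"
    by (simp add: \<delta>_def power_divide power_mult_distrib field_simps)
  have "\<exists>x\<in>X. \<delta> \<le> cmod (V (ell2_basis y) x)" if y: "y \<in> Y" for y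
  proof (rule ccontr)
    assume "\<not> ?thesis"
    then have small: "\<And>x. x \<in> X \<Longrightarrow> cmod (V (ell2_basis y) x) \<le> \<delta>" by force
    define f where "f = V (ell2_basis y)"
    have f: "f \<in> ell2 X" unfolding f_def using y by (intro V_in) auto
    have Uf: "U f = ell2_basis y" unfolding f_def using y by (intro U_V) auto
    obtain F where F: "finite F" "F \<subseteq> X" "ell2_norm X (\<lambda>x. f x - cutoff F f x) < 1/8"
      using ell2_finite_approx[OF f, of "1/8"] by auto
    define B where "B = {z \<in> Y. dY y z \<le> s}"
    have B: "finite B" "card B \<le> N" "B \<subseteq> Y" using N[OF y] by (auto simp: B_def)
    define w where "w x = cutoff B (\<lambda>z. f x * U (ell2_basis x) z)" for x
    have w_in: "\<forall>x\<in>F. w x \<in> ell2 Y"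
      unfolding w_def using F by (intro ballI cutoff_ell2 ell2_scale U_in) auto
    from ell2_signs[OF F(1) w_in, of 1] obtain J where J: "J \<subseteq> F" and
      le: "(ell2_norm Y (\<lambda>z. \<Sum>x\<in>F. (if x \<in> J then 1 else -1) * w x z))\<^sup>2 \<le> (\<Sum>x\<in>F. (ell2_norm Y (w x))\<^sup>2)"
      by auto
    define W where "W = (\<lambda>z. \<Sum>x\<in>F. (if x \<in> J then 1 else -1) * w x z)"
    have W_in: "W \<in> ell2 Y" unfolding W_def using w_in by (intro ell2_sum ell2_scale) auto
    \<comment> \<open>Only the at most \<open>N\<close> rows with index in \<open>B\<close> count.
      Each row of the unitary has square norm at most 1 over \<open>F\<close>, and the factors
      \<open>f x\<close> contribute at most \<delta>.\<close>
    have "(\<Sum>x\<in>F. (ell2_norm Y (w x))\<^sup>2) = (\<Sum>x\<in>F. \<Sum>z\<in>B. (cmod (f x))\<^sup>2 * (cmod (V (ell2_basis z) x))\<^sup>2)"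
      unfolding w_def ell2_norm_cutoff_finite[OF B(1,3)] using F B
      by (intro sum.cong refl) (auto simp: U_coeff norm_mult power_mult_distrib subsetD)
    also have "\<dots> \<le> (\<Sum>x\<in>F. \<Sum>z\<in>B. \<delta>\<^sup>2 * (cmod (V (ell2_basis z) x))\<^sup>2)"
      using F small by (intro sum_mono mult_right_mono power_mono) (auto simp: f_def subsetD)
    also have "\<dots> = \<delta>\<^sup>2 * (\<Sum>z\<in>B. \<Sum>x\<in>F. (cmod (V (ell2_basis z) x))\<^sup>2)"
      by (subst sum.swap) (simp add: sum_distrib_left)
    also have "\<dots> \<le> \<delta>\<^sup>2 * (\<Sum>z\<in>B. 1)"
    proof (intro mult_left_mono sum_mono)
      fix z assume "z \<in> B"
      then have z: "ell2_basis z \<in> ell2 Y" "z \<in> Y" using B by auto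
      show "(\<Sum>x\<in>F. (cmod (V (ell2_basis z) x))\<^sup>2) \<le> 1"
        using ell2_sum_le_norm_sq[OF V_in[OF z(1)] F(1,2)] norm_V[OF z(1)] z(2) by simp
    qed simp
    also have "\<dots> \<le> \<delta>\<^sup>2 * real N" using B by (intro mult_left_mono) auto
    finally have "(ell2_norm Y W)\<^sup>2 \<le> (1/8)\<^sup>2" using le \<delta>2 unfolding W_def by linarith
    then have W: "ell2_norm Y W \<le> 1/8" by (rule power2_le_imp_le) simp
    define g where "g = U (cutoff J f)"
    have cJ: "cutoff J f \<in> ell2 X" and cF: "cutoff F f \<in> ell2 X" using f by blast+
    have g: "g \<in> ell2 Y" unfolding g_def by (rule U_in[OF cJ])
    have W_eq: "W = cutoff B (\<lambda>z. 2 * g z - U (cutoff F f) z)"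
    proof -
      have "(\<lambda>z. 2 * g z - U (cutoff F f) z) = U (\<lambda>x. 2 * cutoff J f x - cutoff F f x)"
        unfolding g_def using cJ cF
        by (simp add: ell2_linear_diff[OF U_bounded_linear] ell2_linear_scale[OF U_bounded_linear] ell2_scale)
      also have "(\<lambda>x. 2 * cutoff J f x - cutoff F f x)
          = (\<lambda>z. \<Sum>x\<in>F. ((if x \<in> J then 1 else -1) * f x) * ell2_basis x z)"
        using J by (subst cutoff_finite_eq_sum[OF F(1), of "\<lambda>x. (if x \<in> J then 1 else -1) * f x", symmetric])
          (auto simp: cutoff_def fun_eq_iff)
      also have "U \<dots> = (\<lambda>z. \<Sum>x\<in>F. ((if x \<in> J then 1 else -1) * f x) * U (ell2_basis x) z)"
        using F by (subst ell2_linear_sum[OF U_bounded_linear]) auto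
      finally have eq: "(\<lambda>z. 2 * g z - U (cutoff F f) z)
          = (\<lambda>z. \<Sum>x\<in>F. ((if x \<in> J then 1 else -1) * f x) * U (ell2_basis x) z)" .
      show ?thesis unfolding eq by (auto simp: W_def w_def cutoff_def mult.assoc)
    qed
    define h where "h = (\<lambda>z. U (cutoff F f) z - ell2_basis y z)"
    have h_in: "h \<in> ell2 Y" unfolding h_def using y by (intro ell2_diff U_in cF) auto
    have "h = U (\<lambda>x. cutoff F f x - f x)"
      unfolding h_def using cF f by (simp add: ell2_linear_diff[OF U_bounded_linear] Uf)
    then have h: "ell2_norm Y h \<le> 1/8"
      using F(3) norm_U[OF ell2_diff[OF cF f]] by (simp add: ell2_norm_minus_commute[of X "cutoff F f"])
    have far: "ell2_norm Y (cutoff (Y - B) g) \<le> 1/8"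
    proof -
      have yb: "ell2_basis y \<in> ell2 Y" using y by simp
      have "\<forall>y'\<in>Y. \<forall>z\<in>Y - B. ell2_basis y y' \<noteq> 0 \<longrightarrow> s < dY y' z"
        by (auto simp: B_def ell2_basis_def split: if_splits)
      moreover have "J \<subseteq> X" using J F by blast
      ultimately have "ell2_norm Y (cutoff (Y - B) (U (cutoff J (V (ell2_basis y))))) \<le> 1/8 * ell2_norm Y (ell2_basis y)"
        using ql yb by blast
      then show ?thesis using y by (simp add: g_def f_def)
    qed
    have yB: "y \<in> B" using y s by (simp add: B_def)
    \<comment> \<open>On \<open>B\<close>, half of \<open>W\<close> compares \<open>g\<close> with
      half of the image of the truncated \<open>f\<close>, and \<open>h\<close> is the error of that
      image against the basis vector at \<open>y\<close>. The three terms have norms at most 1/8,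
      1/16 and 1/16.\<close>
    have decomp: "(\<lambda>z. g z - 1/2 * ell2_basis y z)
        = (\<lambda>z. cutoff (Y - B) g z + (1/2 * W z + 1/2 * cutoff B h z))"
    proof
      fix z
      show "g z - 1/2 * ell2_basis y z = cutoff (Y - B) g z + (1/2 * W z + 1/2 * cutoff B h z)"
        unfolding W_eq h_def using yB B(3) ell2_outside[OF g, of z]
        by (auto simp: cutoff_def ell2_basis_def field_simps)
    qed
    have "ell2_norm Y (\<lambda>z. g z - 1/2 * ell2_basis y z)
        \<le> ell2_norm Y (cutoff (Y - B) g) + ell2_norm Y (\<lambda>z. 1/2 * W z + 1/2 * cutoff B h z)"
      unfolding decomp by (intro ell2_norm_triangle ell2_add ell2_scale cutoff_ell2 g W_in h_in)
    also have "ell2_norm Y (\<lambda>z. 1/2 * W z + 1/2 * cutoff B h z)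
        \<le> ell2_norm Y (\<lambda>z. 1/2 * W z) + ell2_norm Y (\<lambda>z. 1/2 * cutoff B h z)"
      by (intro ell2_norm_triangle ell2_scale cutoff_ell2 W_in h_in)
    also have "\<dots> = 1/2 * ell2_norm Y W + 1/2 * ell2_norm Y (cutoff B h)"
      unfolding ell2_norm_scale by simp
    finally have quarter: "ell2_norm Y (\<lambda>z. g z - 1/2 * ell2_basis y z) \<le> 1/4"
      using far W h ell2_norm_cutoff_le[OF h_in, of B] by linarith
    have "ell2_norm Y (\<lambda>z. g z - 1/2 * ell2_basis y z) = ell2_norm Y (U (\<lambda>x. cutoff J f x - 1/2 * f x))"
      unfolding g_def Uf[symmetric] ell2_linear_diff[OF U_bounded_linear cJ ell2_scale[OF f]]
        ell2_linear_scale[OF U_bounded_linear f] ..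
    also have "\<dots> = ell2_norm X (\<lambda>x. cutoff J f x - 1/2 * f x)"
      by (intro norm_U ell2_diff ell2_scale cJ f)
    also have "\<dots> = ell2_norm X (\<lambda>x. 1/2 * f x)"
    proof -
      \<comment> \<open>The two vectors differ only by a sign in each coordinate: plus on
        \<open>J\<close>, minus elsewhere.\<close>
      have "cmod (cutoff J f x - 1/2 * f x) = cmod (1/2 * f x)" for x
        by (simp add: cutoff_def norm_minus_commute)
      then show ?thesis unfolding ell2_norm_def by (simp only:)
    qed
    also have "\<dots> = 1/2 * ell2_norm Y (ell2_basis y)"
      unfolding ell2_norm_scale using norm_U[OF f] Uf by simp
    finally show False using quarter y by simp
  qed
  with \<open>\<delta> > 0\<close> show ?thesis by blast
qed

text \<open>For the singleton of \<open>x\<close> and the basis vector at \<open>g x\<close>, the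
  vector in \<open>quasi_local\<close> is \<open>U (ell2_basis x)\<close> times a coefficient of
  modulus at least \<delta>. Quasi-locality at level \<epsilon> * \<delta> can be divided by
  it.\<close>

lemma concentration:
  assumes "\<delta> > 0" and g: "\<And>x. x \<in> X \<Longrightarrow> g x \<in> Y" "\<And>x. x \<in> X \<Longrightarrow> \<delta> \<le> cmod (V (ell2_basis (g x)) x)"
    and "\<epsilon> > 0"
  shows "\<exists>s\<ge>0. \<forall>x\<in>X. ell2_norm Y (cutoff {z \<in> Y. s < dY (g x) z} (U (ell2_basis x))) \<le> \<epsilon>"
proof -
  have pos: "\<epsilon> * \<delta> > 0" using assms by simp
  from quasi_local[OF pos] obtain s where s: "s \<ge> 0" and
    ql: "\<forall>A\<subseteq>X. \<forall>v\<in>ell2 Y. \<forall>S. (\<forall>y\<in>Y. \<forall>z\<in>S. v y \<noteq> 0 \<longrightarrow> s < dY y z) \<longrightarrow>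
      ell2_norm Y (cutoff S (U (cutoff A (V v)))) \<le> (\<epsilon> * \<delta>) * ell2_norm Y v" by auto
  have "ell2_norm Y (cutoff {z \<in> Y. s < dY (g x) z} (U (ell2_basis x))) \<le> \<epsilon>" if x: "x \<in> X" for x
  proof -
    let ?S = "{z \<in> Y. s < dY (g x) z}" and ?c = "V (ell2_basis (g x)) x"
    have "cutoff {x} (V (ell2_basis (g x))) = (\<lambda>z. ?c * ell2_basis x z)"
      by (auto simp: cutoff_def ell2_basis_def)
    then have "U (cutoff {x} (V (ell2_basis (g x)))) = (\<lambda>z. ?c * U (ell2_basis x) z)"
      using x by (simp add: ell2_linear_scale[OF U_bounded_linear])
    then have eq: "cutoff ?S (U (cutoff {x} (V (ell2_basis (g x))))) = (\<lambda>z. ?c * cutoff ?S (U (ell2_basis x)) z)"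
      by (auto simp: cutoff_def)
    have "\<forall>y\<in>Y. \<forall>z\<in>?S. ell2_basis (g x) y \<noteq> 0 \<longrightarrow> s < dY y z"
      by (auto simp: ell2_basis_def split: if_splits)
    moreover have "{x} \<subseteq> X" "ell2_basis (g x) \<in> ell2 Y" using x g by auto
    ultimately have "ell2_norm Y (cutoff ?S (U (cutoff {x} (V (ell2_basis (g x)))))) \<le> (\<epsilon> * \<delta>) * ell2_norm Y (ell2_basis (g x))"
      using ql by blast
    then have "cmod ?c * ell2_norm Y (cutoff ?S (U (ell2_basis x))) \<le> \<epsilon> * \<delta>"
      unfolding eq ell2_norm_scale using g x by simp
    then have "\<delta> * ell2_norm Y (cutoff ?S (U (ell2_basis x))) \<le> \<delta> * \<epsilon>"
      using mult_right_mono[OF g(2)[OF x] ell2_norm_nonneg[of Y "cutoff ?S (U (ell2_basis x))"]]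
      by (simp add: mult.commute)
    then show ?thesis using \<open>\<delta> > 0\<close> by simp
  qed
  with s show ?thesis by blast
qed

text \<open>Schur's test: the 0-1 matrix marking the pairs at distance at most \<open>r\<close> has
  at most \<open>N\<close> ones in each row and, by symmetry of the metric, in each column. A single
  operator thus records all such pairs, which makes the distance found for its image
  uniform.\<close>

lemma schur_bounded:
  shows "ell2_bounded_linear X X (\<lambda>f x. if x \<in> X then \<Sum>z\<in>{z \<in> X. dX x z \<le> r}. f z else 0)"
proof -
  obtain N :: nat where N: "\<And>x. x \<in> X \<Longrightarrow> finite {z \<in> X. dX x z \<le> r} \<and> card {z \<in> X. dX x z \<le> r} \<le> N"
    using ulf_X unfolding uniformly_locally_finite_def by metis
  define B where "B x = {z \<in> X. dX x z \<le> r}" for x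
  have B: "finite (B x)" "card (B x) \<le> N" "B x \<subseteq> X" if "x \<in> X" for x
    using N[OF that] by (auto simp: B_def)
  define T where "T f x = (if x \<in> X then \<Sum>z\<in>B x. f z else 0)" for f :: "'a \<Rightarrow> complex" and x
  have bd: "(\<Sum>x\<in>F. (cmod (T f x))\<^sup>2) \<le> (real N * ell2_norm X f)\<^sup>2"
    if F: "finite F" "F \<subseteq> X" and f: "f \<in> ell2 X" for F f
  proof -
    define G where "G = (\<Union>x\<in>F. B x)"
    have G: "finite G" "G \<subseteq> X" using F B unfolding G_def by blast+
    have "(cmod (T f x))\<^sup>2 \<le> real N * (\<Sum>z\<in>G. of_bool (z \<in> B x) * (cmod (f z))\<^sup>2)" if "x \<in> F" for x
    proof -
      have x: "x \<in> X" using that F by blast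
      have "(cmod (T f x))\<^sup>2 \<le> (\<Sum>z\<in>B x. cmod (f z))\<^sup>2"
        using x by (intro power_mono) (auto simp: T_def norm_sum)
      also have "\<dots> \<le> real (card (B x)) * (\<Sum>z\<in>B x. (cmod (f z))\<^sup>2)"
        using Cauchy_Schwarz_ineq_sum[of "\<lambda>_. 1" "\<lambda>z. cmod (f z)" "B x"] by simp
      also have "\<dots> \<le> real N * (\<Sum>z\<in>B x. (cmod (f z))\<^sup>2)"
        using B[OF x] by (intro mult_right_mono sum_nonneg) auto
      also have "(\<Sum>z\<in>B x. (cmod (f z))\<^sup>2) = (\<Sum>z\<in>G. of_bool (z \<in> B x) * (cmod (f z))\<^sup>2)"
        using G that by (intro sum.mono_neutral_cong_left) (auto simp: G_def)
      finally show ?thesis .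
    qed
    then have "(\<Sum>x\<in>F. (cmod (T f x))\<^sup>2)
        \<le> (\<Sum>x\<in>F. real N * (\<Sum>z\<in>G. of_bool (z \<in> B x) * (cmod (f z))\<^sup>2))"
      by (rule sum_mono)
    also have "\<dots> = real N * (\<Sum>z\<in>G. (\<Sum>x\<in>F. of_bool (z \<in> B x)) * (cmod (f z))\<^sup>2)"
      by (subst sum_distrib_left[symmetric], subst sum.swap) (simp add: sum_distrib_right)
    also have "\<dots> \<le> real N * (\<Sum>z\<in>G. real N * (cmod (f z))\<^sup>2)"
    proof (intro mult_left_mono sum_mono mult_right_mono)
      fix z assume "z \<in> G"
      then have z: "z \<in> X" using G by blast
      have "(\<Sum>x\<in>F. of_bool (z \<in> B x)) = real (card (F \<inter> {x. z \<in> B x}))"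
        using F by (simp add: of_bool_def sum.If_cases)
      also have "card (F \<inter> {x. z \<in> B x}) \<le> card (B z)"
        by (rule card_mono[OF B(1)[OF z]]) (use F z in \<open>auto simp: B_def X.commute\<close>)
      finally show "(\<Sum>x\<in>F. of_bool (z \<in> B x)) \<le> real N" using B(2)[OF z] by simp
    qed auto
    also have "\<dots> = (real N)\<^sup>2 * (\<Sum>z\<in>G. (cmod (f z))\<^sup>2)"
      by (simp add: sum_distrib_left power2_eq_square mult_ac)
    also have "\<dots> \<le> (real N)\<^sup>2 * (ell2_norm X f)\<^sup>2"
      by (intro mult_left_mono ell2_sum_le_norm_sq f G) simp
    finally show ?thesis by (simp add: power_mult_distrib)
  qed
  have "ell2_bounded_linear X X T"
  proof (rule ell2_bounded_linearI)
    fix f assume f: "f \<in> ell2 X"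
    have z: "\<And>x. x \<notin> X \<Longrightarrow> T f x = 0" by (simp add: T_def)
    show "T f \<in> ell2 X" by (rule ell2_in_if_bounded(1)[OF z bd[OF _ _ f]])
    have "(ell2_norm X (T f))\<^sup>2 \<le> (real N * ell2_norm X f)\<^sup>2"
      by (rule ell2_in_if_bounded(2)[OF z bd[OF _ _ f]])
    then show "ell2_norm X (T f) \<le> real N * ell2_norm X f" by (rule power2_le_imp_le) simp
  qed (auto simp: T_def sum.distrib sum_distrib_left)
  then show ?thesis unfolding T_def B_def .
qed

text \<open>The operator with entry 1 at every pair at distance at most \<open>r\<close> is
  conjugated and approximated within 1/4 by an operator of propagation \<open>t\<close>. If
  \<open>g x\<close> and \<open>g x'\<close> were more than \<open>2 * s + t\<close> apart, this
  could not link the parts of \<open>U (ell2_basis x)\<close> and \<open>U (ell2_basis x')\<close>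
  within \<open>s\<close> of them. Approximation error and tails give at most 1/4 + 1/8 + 1/8, less
  than the entry 1.\<close>

lemma coarse_bound:
  assumes "\<delta> > 0" and g: "\<And>x. x \<in> X \<Longrightarrow> g x \<in> Y" "\<And>x. x \<in> X \<Longrightarrow> \<delta> \<le> cmod (V (ell2_basis (g x)) x)"
  shows "\<exists>s. \<forall>x\<in>X. \<forall>x'\<in>X. dX x x' \<le> r \<longrightarrow> dY (g x) (g x') \<le> s"
proof -
  define T where "T f x = (if x \<in> X then \<Sum>z\<in>{z \<in> X. dX x z \<le> r}. f z else 0)" for f :: "'a \<Rightarrow> complex" and x
  have T: "ell2_bounded_linear X X T" using schur_bounded[of r] unfolding T_def .
  have T_basis: "T (ell2_basis x') x = of_bool (dX x x' \<le> r)" if "x \<in> X" "x' \<in> X" for x x'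
  proof -
    have "finite {z \<in> X. dX x z \<le> r}" using ulf_X that unfolding uniformly_locally_finite_def by blast
    then show ?thesis using that by (auto simp: T_def ell2_basis_def)
  qed
  have "propagation_le X dX (restrict T (ell2 X)) r"
    unfolding propagation_le_def
  proof (intro ballI impI)
    fix x z assume xz: "x \<in> X" "z \<in> X" "restrict T (ell2 X) (ell2_basis x) z \<noteq> 0"
    then have "dX z x \<le> r" using T_basis[OF xz(2,1)] by (cases "dX z x \<le> r") auto
    then show "dX x z \<le> r" by (simp add: X.commute)
  qed
  then have "restrict T (ell2 X) \<in> uniform_roe X dX"
    by (rule finite_propagation_uniform_roe[OF restrict_bounded_ops[OF T]])
  from push[OF this] obtain b where b: "b \<in> uniform_roe Y dY"
    and Ub: "\<And>f. f \<in> ell2 X \<Longrightarrow> U (T f) = b (U f)" by auto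
  obtain b' t where b': "b' \<in> bounded_ops Y" "propagation_le Y dY b' t"
    and le: "\<And>f. f \<in> ell2 Y \<Longrightarrow> ell2_norm Y (\<lambda>x. b f x - b' f x) \<le> 1/4 * ell2_norm Y f"
    using uniform_roe_approx[OF b, of "1/4"] by (metis zero_less_divide_1_iff zero_less_numeral)
  note b'_lin = bounded_ops_linear[OF b'(1)]
  obtain C where C: "C > 0" "\<And>f. f \<in> ell2 Y \<Longrightarrow> ell2_norm Y (b' f) \<le> C * ell2_norm Y f"
    using ell2_linear_bound[OF b'_lin] by metis
  \<comment> \<open>Tails of norm at most \<eta> meet the approximant with its bound
    \<open>C\<close>, so each of the two tail terms costs at most 1/8.\<close>
  define \<eta> where "\<eta> = 1 / (8 * C)"
  have \<eta>: "\<eta> > 0" "C * \<eta> = 1/8" using C(1) by (auto simp: \<eta>_def)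
  obtain s where s: "s \<ge> 0" and
    conc: "\<forall>x\<in>X. ell2_norm Y (cutoff {z \<in> Y. s < dY (g x) z} (U (ell2_basis x))) \<le> \<eta>"
    using concentration[OF \<open>\<delta> > 0\<close> g \<eta>(1)] by blast
  have "dY (g x) (g x') \<le> 2 * s + t" if x: "x \<in> X" and x': "x' \<in> X" and r: "dX x x' \<le> r" for x x'
  proof (rule ccontr)
    assume far: "\<not> ?thesis"
    define u where "u x = U (ell2_basis x)" for x
    define p where "p x = cutoff {z \<in> Y. dY (g x) z \<le> s} (u x)" for x
    define q where "q x = cutoff {z \<in> Y. s < dY (g x) z} (u x)" for x
    have u: "u x \<in> ell2 Y" "ell2_norm Y (u x) = 1" if "x \<in> X" for x
      using that by (auto simp: u_def norm_U intro: U_in)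
    have pq: "p x \<in> ell2 Y" "q x \<in> ell2 Y" "ell2_norm Y (p x) \<le> 1" "ell2_norm Y (q x) \<le> \<eta>" if "x \<in> X" for x
      using that u[OF that] conc ell2_norm_cutoff_le[OF u(1)[OF that], of "{z \<in> Y. dY (g x) z \<le> s}"]
      by (auto simp: p_def q_def u_def)
    have split: "u x = (\<lambda>z. p x z + q x z)" if "x \<in> X" for x
      using ell2_outside[OF u(1)[OF that]] by (auto simp: p_def q_def cutoff_def fun_eq_iff)
    have bu: "b (u x') \<in> ell2 Y" by (rule ell2_linear_in[OF uniform_roe_linear[OF b] u(1)[OF x']])
    have b'in: "b' f \<in> ell2 Y" if "f \<in> ell2 Y" for f by (rule bounded_ops_in[OF b'(1) that])
    have "ell2_inner Y (b (u x')) (u x) = ell2_inner X (T (ell2_basis x')) (ell2_basis x)"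
      unfolding u_def using x x' by (simp add: Ub[symmetric] inner_U ell2_linear_in[OF T])
    also have "\<dots> = 1" using x x' r by (simp add: ell2_inner_basis_right T_basis)
    finally have one: "ell2_inner Y (b (u x')) (u x) = 1" .
    have "ell2_inner Y (b (u x')) (u x)
        = ell2_inner Y (\<lambda>z. b (u x') z - b' (u x') z) (u x) + ell2_inner Y (b' (u x')) (u x)"
      using bu b'in u x x' by (simp add: ell2_inner_diff_left)
    also have "ell2_inner Y (b' (u x')) (u x)
        = ell2_inner Y (b' (p x')) (p x) + ell2_inner Y (b' (p x')) (q x) + ell2_inner Y (b' (q x')) (u x)"
    proof -
      have "b' (u x') = (\<lambda>z. b' (p x') z + b' (q x') z)"
        unfolding split[OF x'] by (rule ell2_linear_add[OF b'_lin pq(1,2)[OF x']])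
      then have "ell2_inner Y (b' (u x')) (u x) = ell2_inner Y (b' (p x')) (u x) + ell2_inner Y (b' (q x')) (u x)"
        by (simp add: ell2_inner_add_left b'in pq x' u x)
      also have "ell2_inner Y (b' (p x')) (u x) = ell2_inner Y (b' (p x')) (p x) + ell2_inner Y (b' (p x')) (q x)"
        unfolding split[OF x] by (rule ell2_inner_add_right) (use b'in pq x x' in auto)
      finally show ?thesis .
    qed
    also have "ell2_inner Y (b' (p x')) (p x) = 0"
    proof (rule propagation_separated[OF b'_lin b'(2)])
      fix y z assume "y \<in> Y" "z \<in> Y" "p x' y \<noteq> 0" "p x z \<noteq> 0"
      then have yz: "y \<in> Y" "z \<in> Y" "dY (g x') y \<le> s" "dY (g x) z \<le> s"
        by (auto simp: p_def cutoff_def split: if_splits)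
      have "dY (g x) (g x') \<le> dY (g x) z + (dY z y + dY y (g x'))"
        using Y.triangle[of "g x" z "g x'"] Y.triangle[of z y "g x'"] yz g x x' by fastforce
      then show "t < dY y z" using far yz Y.commute[of y z] Y.commute[of y "g x'"] by linarith
    qed (use pq x x' in auto)
    finally have "1 = cmod (ell2_inner Y (\<lambda>z. b (u x') z - b' (u x') z) (u x)
        + (ell2_inner Y (b' (p x')) (q x) + ell2_inner Y (b' (q x')) (u x)))" using one by simp
    also have "\<dots> \<le> 1/4 + (1/8 + 1/8)"
    proof (intro norm_triangle_le add_mono)
      have "cmod (ell2_inner Y (\<lambda>z. b (u x') z - b' (u x') z) (u x))
          \<le> ell2_norm Y (\<lambda>z. b (u x') z - b' (u x') z) * ell2_norm Y (u x)"
        by (intro ell2_cauchy_schwarz ell2_diff bu b'in u x x')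
      then show "cmod (ell2_inner Y (\<lambda>z. b (u x') z - b' (u x') z) (u x)) \<le> 1/4"
        using le[OF u(1)[OF x']] u(2)[OF x] u(2)[OF x'] by simp
      have "cmod (ell2_inner Y (b' (p x')) (q x)) \<le> ell2_norm Y (b' (p x')) * ell2_norm Y (q x)"
        by (intro ell2_cauchy_schwarz b'in pq x x')
      also have "\<dots> \<le> (C * 1) * \<eta>"
        using C pq[OF x] pq[OF x'] order_trans[OF C(2)[OF pq(1)[OF x']] mult_left_mono[OF pq(3)[OF x']]]
        by (intro mult_mono) auto
      finally show "cmod (ell2_inner Y (b' (p x')) (q x)) \<le> 1/8" using \<eta> by simp
      have "cmod (ell2_inner Y (b' (q x')) (u x)) \<le> ell2_norm Y (b' (q x')) * ell2_norm Y (u x)"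
        by (intro ell2_cauchy_schwarz b'in pq u x x')
      also have "\<dots> \<le> C * \<eta>"
        using C u(2)[OF x] order_trans[OF C(2)[OF pq(2)[OF x']] mult_left_mono[OF pq(4)[OF x']]] by simp
      finally show "cmod (ell2_inner Y (b' (q x')) (u x)) \<le> 1/8" using \<eta> by simp
    qed
    finally show False by simp
  qed
  then show ?thesis by blast
qed

end

section \<open>Matching\<close>

text \<open>Gaussian elimination, one equation at a time: an equation without nonzero coefficients
  is dropped, any other is removed together with one unknown.\<close>

lemma homogeneous_system_nontrivial_solution:
  fixes M :: "'a \<Rightarrow> 'b \<Rightarrow> 'c::field"
  assumes "finite S" "finite A" "card S < card A"
  shows "\<exists>c. (\<exists>x\<in>A. c x \<noteq> 0) \<and> (\<forall>y\<in>S. (\<Sum>x\<in>A. c x * M x y) = 0)"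
  using assms
proof (induction S arbitrary: A M rule: finite_induct)
  case empty
  then have "A \<noteq> {}" by auto
  then show ?case by (intro exI[of _ "\<lambda>_. 1"]) auto
next
  case (insert y S)
  show ?case
  proof (cases "\<forall>x\<in>A. M x y = 0")
    case True
    have "card S < card A" using insert.prems insert.hyps by simp
    then have "\<exists>c. (\<exists>x\<in>A. c x \<noteq> 0) \<and> (\<forall>y\<in>S. (\<Sum>x\<in>A. c x * M x y) = 0)"
      by (rule insert.IH[OF insert.prems(1)])
    then obtain c where
      "\<exists>x\<in>A. c x \<noteq> 0" "\<forall>y\<in>S. (\<Sum>x\<in>A. c x * M x y) = 0" by blast
    with True show ?thesis by (intro exI[of _ c]) auto
  next
    case False
    then obtain p where p: "p \<in> A" "M p y \<noteq> 0" by blast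
    let ?A = "A - {p}"
    have fin: "finite ?A" and card: "card S < card ?A" using insert.prems insert.hyps p by auto
    define M' where "M' x z = M x z - M x y / M p y * M p z" for x z
    have "\<exists>c. (\<exists>x\<in>?A. c x \<noteq> 0) \<and> (\<forall>z\<in>S. (\<Sum>x\<in>?A. c x * M' x z) = 0)"
      by (rule insert.IH[OF fin card])
    then obtain c where c: "\<exists>x\<in>?A. c x \<noteq> 0" "\<forall>z\<in>S. (\<Sum>x\<in>?A. c x * M' x z) = 0" by blast
    \<comment> \<open>The value at the pivot is forced by the equation \<open>y\<close>.
      Substituting it turns the system for \<open>M\<close> into the one for \<open>M'\<close>, in
      which the equation \<open>y\<close> has only zero coefficients.\<close>
    define c' where "c' = c(p := - (\<Sum>x\<in>?A. c x * M x y) / M p y)"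
    have sum: "(\<Sum>x\<in>A. c' x * M x z) = (\<Sum>x\<in>?A. c x * M' x z)" for z
    proof -
      have "(\<Sum>x\<in>A. c' x * M x z) = c' p * M p z + (\<Sum>x\<in>?A. c' x * M x z)"
        using insert.prems p by (simp add: sum.remove)
      also have "(\<Sum>x\<in>?A. c' x * M x z) = (\<Sum>x\<in>?A. c x * M x z)"
        by (intro sum.cong) (auto simp: c'_def)
      also have "c' p * M p z = - (\<Sum>x\<in>?A. c x * (M x y / M p y * M p z))"
        by (simp add: c'_def sum_distrib_right sum_divide_distrib mult.assoc flip: sum_negf)
      finally show ?thesis by (simp add: M'_def right_diff_distrib sum_subtractf)
    qed
    have "(\<Sum>x\<in>A. c' x * M x z) = 0" if "z \<in> insert y S" for z
    proof (cases "z = y")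
      case True
      then show ?thesis unfolding sum using p by (simp add: M'_def)
    qed (use that c(2) sum in auto)
    moreover have "\<exists>x\<in>A. c' x \<noteq> 0" using c(1) by (auto simp: c'_def)
    ultimately show ?thesis by blast
  qed
qed

text \<open>A linear combination of the vectors \<open>U \<delta>\<^sub>x\<close>, \<open>x \<in> A\<close>, cannot vanish on a large neighbourhood of
  \<open>g ` A\<close>: by quasi-locality, changing the signs of the coefficients creates little mass near
  \<open>g ` A\<close>, but for random signs nearly all of the mass is there. Hence restriction to the
  neighbourhood is injective on the span, which has dimension \<open>card A\<close>.\<close>

lemma (in ulf_spatial) hall_condition:
  assumes "\<delta> > 0" and g: "\<And>x. x \<in> X \<Longrightarrow> g x \<in> Y" "\<And>x. x \<in> X \<Longrightarrow> \<delta> \<le> cmod (V (ell2_basis (g x)) x)"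
  shows "\<exists>R. \<forall>A. finite A \<longrightarrow> A \<subseteq> X \<longrightarrow> card A \<le> card (\<Union>x\<in>A. {z \<in> Y. dY (g x) z \<le> R})"
proof -
  from quasi_local[of "1/4"] obtain s1 where s1: "s1 \<ge> 0" and
    ql: "\<forall>A\<subseteq>X. \<forall>v\<in>ell2 Y. \<forall>S. (\<forall>y\<in>Y. \<forall>z\<in>S. v y \<noteq> 0 \<longrightarrow> s1 < dY y z) \<longrightarrow>
      ell2_norm Y (cutoff S (U (cutoff A (V v)))) \<le> 1/4 * ell2_norm Y v" by auto
  obtain s2 where s2: "s2 \<ge> 0" and
    conc: "\<forall>x\<in>X. ell2_norm Y (cutoff {z \<in> Y. s2 < dY (g x) z} (U (ell2_basis x))) \<le> 1/4"
    using concentration[OF \<open>\<delta> > 0\<close> g, of "1/4"] by auto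
  have "card A \<le> card (\<Union>x\<in>A. {z \<in> Y. dY (g x) z \<le> s1 + s2})" if A: "finite A" "A \<subseteq> X" for A
  proof (rule ccontr)
    \<comment> \<open>Two radii: each \<open>u x\<close> has most of its mass in \<open>Q\<close>,
      while \<open>v\<close> will vanish on the larger \<open>S\<close>, which keeps the support of
      \<open>v\<close> more than \<open>s1\<close> away from \<open>Q\<close>.\<close>
    define S where "S = (\<Union>x\<in>A. {z \<in> Y. dY (g x) z \<le> s1 + s2})"
    define Q where "Q = (\<Union>x\<in>A. {z \<in> Y. dY (g x) z \<le> s2})"
    have S: "finite S"
      unfolding S_def using A g ulf_Y unfolding uniformly_locally_finite_def by blast
    define u where "u x = U (ell2_basis x)" for x
    have u: "u x \<in> ell2 Y" "ell2_norm Y (u x) = 1" if "x \<in> A" for x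
      using that A by (auto simp: u_def norm_U intro!: U_in)
    assume "\<not> ?thesis"
    then have "card S < card A" by (simp add: S_def)
    from homogeneous_system_nontrivial_solution[OF S A(1) this, of u] obtain c where
      c: "\<exists>x\<in>A. c x \<noteq> 0" and van: "\<And>y. y \<in> S \<Longrightarrow> (\<Sum>x\<in>A. c x * u x y) = 0" by blast
    define k where "k = cutoff A c"
    have k: "k \<in> ell2 X" unfolding k_def
      by (rule ell2_finite_support[OF A]) (auto simp: cutoff_def)
    have Uk: "U (cutoff A c') = (\<lambda>y. \<Sum>x\<in>A. c' x * u x y)" for c'
      unfolding cutoff_finite_eq_sum[OF A(1)] u_def
      using A by (subst ell2_linear_sum[OF U_bounded_linear]) auto
    define v where "v = U k"
    have v: "v \<in> ell2 Y" unfolding v_def by (rule U_in[OF k])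
    have Vv: "V v = k" unfolding v_def by (rule V_U[OF k])
    have v_sum: "v = (\<lambda>y. \<Sum>x\<in>A. c x * u x y)" unfolding v_def k_def by (rule Uk)
    have norm_v: "(ell2_norm Y v)\<^sup>2 = (\<Sum>x\<in>A. (cmod (c x))\<^sup>2)"
      unfolding v_def norm_U[OF k] unfolding k_def by (rule ell2_norm_cutoff_finite[OF A])
    also have "\<dots> > 0" using c A by (auto intro!: sum_pos2 simp: zero_less_power2)
    finally have v_pos: "(ell2_norm Y v)\<^sup>2 > 0" .
    define w where "w x = cutoff Q (\<lambda>y. c x * u x y)" for x
    have w_in: "\<forall>x\<in>A. w x \<in> ell2 Y" unfolding w_def using u by blast
    from ell2_signs[OF A(1) w_in, of "-1"] obtain J where J: "J \<subseteq> A" and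
      ge: "(\<Sum>x\<in>A. (ell2_norm Y (w x))\<^sup>2) \<le> (ell2_norm Y (\<lambda>y. \<Sum>x\<in>A. (if x \<in> J then 1 else -1) * w x y))\<^sup>2"
      by auto
    \<comment> \<open>The tail outside \<open>Q\<close> has norm at most 1/4, which leaves 1 - 1/16
      of the square norm of the unit vector \<open>u x\<close>.\<close>
    have near: "15/16 * (cmod (c x))\<^sup>2 \<le> (ell2_norm Y (w x))\<^sup>2" if x: "x \<in> A" for x
    proof -
      have cq: "cutoff Q (u x) \<in> ell2 Y" "cutoff (-Q) (u x) \<in> ell2 Y" using u[OF x] by blast+
      have "ell2_inner Y (cutoff Q (u x)) (cutoff (-Q) (u x)) = 0"
        unfolding ell2_inner_def by (rule infsum_0) (simp add: cutoff_def)
      then have "(ell2_norm Y (\<lambda>y. cutoff Q (u x) y + cutoff (-Q) (u x) y))\<^sup>2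
          = (ell2_norm Y (cutoff Q (u x)))\<^sup>2 + (ell2_norm Y (cutoff (-Q) (u x)))\<^sup>2"
        by (simp add: ell2_norm_add_sq[OF cq])
      moreover have "(\<lambda>y. cutoff Q (u x) y + cutoff (-Q) (u x) y) = u x" by (auto simp: cutoff_def)
      ultimately have pyth: "(ell2_norm Y (cutoff Q (u x)))\<^sup>2 = 1 - (ell2_norm Y (cutoff (-Q) (u x)))\<^sup>2"
        using u(2)[OF x] by simp
      have "ell2_norm Y (cutoff (-Q) (u x)) \<le> ell2_norm Y (cutoff {z \<in> Y. s2 < dY (g x) z} (u x))"
      proof (rule ell2_norm_mono)
        show "cutoff {z \<in> Y. s2 < dY (g x) z} (u x) \<in> ell2 Y" using u[OF x] by blast
        show "cmod (cutoff (-Q) (u x) y) \<le> cmod (cutoff {z \<in> Y. s2 < dY (g x) z} (u x) y)" for y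
          using x ell2_outside[OF u(1)[OF x], of y] by (force simp: cutoff_def Q_def)
      qed
      also have "\<dots> \<le> 1/4" unfolding u_def using conc x A by blast
      finally have "(ell2_norm Y (cutoff (-Q) (u x)))\<^sup>2 \<le> (1/4)\<^sup>2" by (intro power_mono) auto
      then have ge: "15/16 \<le> (ell2_norm Y (cutoff Q (u x)))\<^sup>2" using pyth by (simp add: power2_eq_square)
      have "w x = (\<lambda>y. c x * cutoff Q (u x) y)" by (auto simp: w_def cutoff_def)
      then have "(ell2_norm Y (w x))\<^sup>2 = (cmod (c x))\<^sup>2 * (ell2_norm Y (cutoff Q (u x)))\<^sup>2"
        by (simp add: ell2_norm_scale power_mult_distrib)
      then show ?thesis using mult_left_mono[OF ge, of "(cmod (c x))\<^sup>2"] by (simp add: mult_ac)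
    qed
    have "15/16 * (ell2_norm Y v)\<^sup>2 \<le> (\<Sum>x\<in>A. (ell2_norm Y (w x))\<^sup>2)"
      unfolding norm_v sum_distrib_left by (intro sum_mono near)
    also note ge
    \<comment> \<open>The signs are 2 * 1_J - 1, and the term -1 contributes minus \<open>v\<close>,
      which vanishes on \<open>Q\<close> because \<open>Q\<close> lies in \<open>S\<close>.\<close>
    also have "(\<lambda>y. \<Sum>x\<in>A. (if x \<in> J then 1 else -1) * w x y) = (\<lambda>y. 2 * cutoff Q (U (cutoff J (V v))) y)"
    proof
      fix y
      have "cutoff J (V v) = cutoff A (\<lambda>x. of_bool (x \<in> J) * c x)"
        using J unfolding Vv by (auto simp: k_def cutoff_def)
      then have UJ: "U (cutoff J (V v)) y = (\<Sum>x\<in>A. of_bool (x \<in> J) * c x * u x y)"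
        by (simp add: Uk)
      show "(\<Sum>x\<in>A. (if x \<in> J then 1 else -1) * w x y) = 2 * cutoff Q (U (cutoff J (V v))) y"
      proof (cases "y \<in> Q")
        case True
        then have "y \<in> S" using s1 by (force simp: Q_def S_def)
        have "(\<Sum>x\<in>A. (if x \<in> J then 1 else -1) * w x y)
            = (\<Sum>x\<in>A. 2 * (of_bool (x \<in> J) * c x * u x y) - c x * u x y)"
          using True by (intro sum.cong) (auto simp: w_def cutoff_def)
        also have "\<dots> = 2 * (\<Sum>x\<in>A. of_bool (x \<in> J) * c x * u x y) - (\<Sum>x\<in>A. c x * u x y)"
          by (simp only: sum_subtractf sum_distrib_left)
        also have "\<dots> = 2 * U (cutoff J (V v)) y" unfolding UJ van[OF \<open>y \<in> S\<close>] by simp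
        finally show ?thesis using True by (simp add: cutoff_def[of Q])
      qed (simp add: w_def cutoff_def)
    qed
    also have "(ell2_norm Y (\<lambda>y. 2 * cutoff Q (U (cutoff J (V v))) y))\<^sup>2 \<le> (1/2 * ell2_norm Y v)\<^sup>2"
    proof (rule power_mono)
      have "\<forall>y\<in>Y. \<forall>z\<in>Q. v y \<noteq> 0 \<longrightarrow> s1 < dY y z"
      proof (intro ballI impI)
        fix y z assume y: "y \<in> Y" "v y \<noteq> 0" and "z \<in> Q"
        then obtain x where x: "x \<in> A" "z \<in> Y" "dY (g x) z \<le> s2" by (auto simp: Q_def)
        have "y \<notin> S" using van y(2) by (auto simp: v_sum)
        then have "s1 + s2 < dY (g x) y" using x y by (auto simp: S_def)
        moreover have "dY (g x) y \<le> dY (g x) z + dY z y"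
          using x A g y by (intro Y.triangle) auto
        ultimately show "s1 < dY y z" using x Y.commute[of y z] by linarith
      qed
      moreover have "J \<subseteq> X" using J A by blast
      ultimately have "ell2_norm Y (cutoff Q (U (cutoff J (V v)))) \<le> 1/4 * ell2_norm Y v"
        using ql v by blast
      then show "ell2_norm Y (\<lambda>y. 2 * cutoff Q (U (cutoff J (V v))) y) \<le> 1/2 * ell2_norm Y v"
        unfolding ell2_norm_scale by simp
    qed simp
    \<comment> \<open>15/16 of the square norm of \<open>v\<close> would be at most 1/4 of
      it.\<close>
    finally show False using v_pos by (simp add: power_mult_distrib power_divide)
  qed
  then show ?thesis by blast
qed

text \<open>Hall's theorem for infinitely many finite sets, by Rado's argument: shrink the sets to a
  minimal family satisfying Hall's condition; its members are singletons.\<close>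

definition hall :: "'a set \<Rightarrow> ('a \<Rightarrow> 'b set) \<Rightarrow> bool" where
  "hall X T \<longleftrightarrow> (\<forall>A. finite A \<longrightarrow> A \<subseteq> X \<longrightarrow> card A \<le> card (\<Union>x\<in>A. T x))"

text \<open>Submodularity of cardinality. If both removals fail, sets \<open>A1\<close> and
  \<open>A2\<close> avoiding \<open>x\<close> witness it. Since \<open>y1\<close> and
  \<open>y2\<close> differ, the union of their reduced neighbourhoods contains all of
  \<open>T x\<close>. Hall's inequalities for the union of \<open>A1\<close> and \<open>A2\<close>
  with \<open>x\<close> added and for their intersection then exceed the two counts by one, the
  point \<open>x\<close>.\<close>

lemma hall_remove_point:
  assumes hall: "hall X T" and fin: "\<And>x. x \<in> X \<Longrightarrow> finite (T x)" and x: "x \<in> X"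
    and y: "y1 \<in> T x" "y2 \<in> T x" "y1 \<noteq> y2"
  shows "hall X (T(x := T x - {y1})) \<or> hall X (T(x := T x - {y2}))"
proof (rule ccontr)
  assume neg: "\<not> ?thesis"
  \<comment> \<open>A violating set contains \<open>x\<close>, since nothing else has changed;
    taking \<open>x\<close> out lowers its size by one and turns < into \<le>.\<close>
  have ex: "\<exists>A. finite A \<and> A \<subseteq> X - {x} \<and> card ((\<Union>a\<in>A. T a) \<union> (T x - {y})) \<le> card A"
    if neg: "\<not> hall X (T(x := T x - {y}))" for y
  proof -
    obtain B where B: "finite B" "B \<subseteq> X" "card (\<Union>a\<in>B. (T(x := T x - {y})) a) < card B"
      using neg unfolding hall_def by force
    have "x \<in> B"
    proof (rule ccontr)
      assume "x \<notin> B"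
      then have "(\<Union>a\<in>B. (T(x := T x - {y})) a) = (\<Union>a\<in>B. T a)" by (intro SUP_cong) auto
      then show False using hall B unfolding hall_def by force
    qed
    then have "(\<Union>a\<in>B. (T(x := T x - {y})) a) = (\<Union>a\<in>B - {x}. T a) \<union> (T x - {y})" by auto
    then show ?thesis using B \<open>x \<in> B\<close> by (intro exI[of _ "B - {x}"]) auto
  qed
  obtain A1 where A1: "finite A1" "A1 \<subseteq> X - {x}" "card ((\<Union>a\<in>A1. T a) \<union> (T x - {y1})) \<le> card A1"
    using ex neg by blast
  obtain A2 where A2: "finite A2" "A2 \<subseteq> X - {x}" "card ((\<Union>a\<in>A2. T a) \<union> (T x - {y2})) \<le> card A2"
    using ex neg by blast
  let ?P = "(\<Union>a\<in>A1. T a) \<union> (T x - {y1})" and ?Q = "(\<Union>a\<in>A2. T a) \<union> (T x - {y2})"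
  have fP: "finite ?P" and fQ: "finite ?Q" using A1 A2 fin x by blast+
  have "card (insert x (A1 \<union> A2)) \<le> card (\<Union>a\<in>insert x (A1 \<union> A2). T a)"
    by (rule hall[unfolded hall_def, rule_format]) (use A1 A2 x in auto)
  also have "(\<Union>a\<in>insert x (A1 \<union> A2). T a) = ?P \<union> ?Q" using y by auto
  finally have u: "card (A1 \<union> A2) + 1 \<le> card (?P \<union> ?Q)"
    using A1 A2 by (subst (asm) card_insert_disjoint) auto
  have "card (A1 \<inter> A2) \<le> card (\<Union>a\<in>A1 \<inter> A2. T a)"
    by (rule hall[unfolded hall_def, rule_format]) (use A1 A2 in auto)
  also have "\<dots> \<le> card (?P \<inter> ?Q)" using fP by (intro card_mono) auto
  finally have "card (A1 \<inter> A2) \<le> card (?P \<inter> ?Q)" .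
  with u A1(3) A2(3) card_Un_Int[OF A1(1) A2(1)] card_Un_Int[OF fP fQ] show False by linarith
qed

text \<open>For finite \<open>A\<close>, a member of the chain whose sets over \<open>A\<close> have
  least total size is contained in all other members over \<open>A\<close>. It agrees there with the
  intersection and passes on its Hall inequality.\<close>

lemma hall_chain_intersection:
  assumes C: "C \<noteq> {}" "\<And>T. T \<in> C \<Longrightarrow> hall X T"
    and chain: "\<And>T T'. T \<in> C \<Longrightarrow> T' \<in> C \<Longrightarrow> (\<forall>x. T x \<subseteq> T' x) \<or> (\<forall>x. T' x \<subseteq> T x)"
    and fin: "\<And>T x. T \<in> C \<Longrightarrow> x \<in> X \<Longrightarrow> finite (T x)"
  shows "hall X (\<lambda>x. \<Inter>T\<in>C. T x)"
  unfolding hall_def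
proof (intro allI impI)
  fix A assume A: "finite A" "A \<subseteq> X"
  define m where "m T = (\<Sum>a\<in>A. card (T a))" for T :: "'a \<Rightarrow> 'b set"
  obtain T0 where T0: "T0 \<in> C" using C by blast
  obtain T where T: "T \<in> C" "\<And>T'. T' \<in> C \<Longrightarrow> m T \<le> m T'"
    using ex_has_least_nat[of "\<lambda>T. T \<in> C" T0 m] T0 by blast
  have "T a \<subseteq> T' a" if T': "T' \<in> C" and a: "a \<in> A" for T' a
  proof (rule ccontr)
    assume n: "\<not> T a \<subseteq> T' a"
    then have sub: "\<And>x. T' x \<subseteq> T x" using chain[OF T(1) T'] by blast
    then have "T' a \<subset> T a" using n by blast
    then have "card (T' a) < card (T a)" using fin[OF T(1)] a A by (intro psubset_card_mono) auto
    moreover have "card (T' b) \<le> card (T b)" if "b \<in> A" for b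
      using sub fin[OF T(1)] that A by (intro card_mono) auto
    ultimately have "m T' < m T" unfolding m_def using A a by (intro sum_strict_mono_ex1) auto
    then show False using T(2)[OF T'] by simp
  qed
  then have "(\<Union>a\<in>A. \<Inter>T\<in>C. T a) = (\<Union>a\<in>A. T a)" using T(1) by blast
  then show "card A \<le> card (\<Union>a\<in>A. \<Inter>T\<in>C. T a)" using C(2)[OF T(1)] A by (simp add: hall_def)
qed

lemma hall_infinite:
  assumes hall: "hall X S" and fin: "\<And>x. x \<in> X \<Longrightarrow> finite (S x)"
  shows "\<exists>f. inj_on f X \<and> (\<forall>x\<in>X. f x \<in> S x)"
proof -
  define \<F> where "\<F> = {T. hall X T \<and> (\<forall>x. T x \<subseteq> S x)}"
  \<comment> \<open>Zorn's lemma is applied to increasing chains of sets, so a family is encoded by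
    the complement of its graph, which grows as the family shrinks.\<close>
  define graph where "graph T = {(x, y). y \<notin> T x}" for T :: "'a \<Rightarrow> 'b set"
  have le: "graph T \<subseteq> graph T' \<longleftrightarrow> (\<forall>x. T' x \<subseteq> T x)" for T T' unfolding graph_def by blast
  have "\<exists>M\<in>graph ` \<F>. \<forall>N\<in>graph ` \<F>. M \<subseteq> N \<longrightarrow> N = M"
  proof (rule subset_Zorn)
    fix K assume "subset.chain (graph ` \<F>) K"
    then have K: "K \<subseteq> graph ` \<F>" and ch: "\<And>M N. M \<in> K \<Longrightarrow> N \<in> K \<Longrightarrow> M \<subseteq> N \<or> N \<subseteq> M"
      by (auto simp: subset_chain_def)
    show "\<exists>U\<in>graph ` \<F>. \<forall>M\<in>K. M \<subseteq> U"
    proof (cases "K = {}")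
      case True
      then show ?thesis using hall by (auto simp: \<F>_def)
    next
      case False
      define C where "C = {T \<in> \<F>. graph T \<in> K}"
      have "C \<noteq> {}" using False K by (auto simp: C_def)
      moreover have "(\<forall>x. T x \<subseteq> T' x) \<or> (\<forall>x. T' x \<subseteq> T x)" if "T \<in> C" "T' \<in> C" for T T'
        using ch[of "graph T" "graph T'"] that unfolding le C_def by blast
      moreover have "finite (T x)" if "T \<in> C" "x \<in> X" for T x
        using that fin finite_subset unfolding C_def \<F>_def by blast
      ultimately have "hall X (\<lambda>x. \<Inter>T\<in>C. T x)"
        by (intro hall_chain_intersection) (auto simp: C_def \<F>_def)
      moreover obtain T0 where "T0 \<in> C" using \<open>C \<noteq> {}\<close> by blast
      then have "(\<Inter>T\<in>C. T x) \<subseteq> S x" for x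
        by (intro INF_lower2[of T0]) (auto simp: C_def \<F>_def)
      ultimately have "(\<lambda>x. \<Inter>T\<in>C. T x) \<in> \<F>" by (simp add: \<F>_def)
      moreover have "M \<subseteq> graph (\<lambda>x. \<Inter>T\<in>C. T x)" if M: "M \<in> K" for M
      proof -
        obtain T where T: "T \<in> \<F>" "M = graph T" using M K by blast
        then have "T \<in> C" using M by (simp add: C_def)
        then show ?thesis unfolding T(2) le by blast
      qed
      ultimately show ?thesis by blast
    qed
  qed
  then obtain T where T: "T \<in> \<F>" and max: "\<forall>N\<in>graph ` \<F>. graph T \<subseteq> N \<longrightarrow> N = graph T"
    by (elim bexE imageE) simp
  have min: "graph T' = graph T" if "T' \<in> \<F>" "\<forall>x. T' x \<subseteq> T x" for T'
    using bspec[OF max imageI[OF that(1)]] that(2) unfolding le by (rule mp)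
  have hT: "hall X T" and sub: "\<And>x. T x \<subseteq> S x" using T by (auto simp: \<F>_def)
  have finT: "finite (T x)" if "x \<in> X" for x using fin[OF that] sub finite_subset by blast
  have single: "y1 = y2" if x: "x \<in> X" and y: "y1 \<in> T x" "y2 \<in> T x" for x y1 y2
  proof (rule ccontr)
    assume "y1 \<noteq> y2"
    from hall_remove_point[OF hT finT x y this] y
    obtain y where y: "y \<in> T x" and "hall X (T(x := T x - {y}))" by metis
    then have "T(x := T x - {y}) \<in> \<F>" using sub by (auto simp: \<F>_def)
    then have "graph (T(x := T x - {y})) = graph T" by (rule min) auto
    then have "(x, y) \<in> graph (T(x := T x - {y})) \<longleftrightarrow> (x, y) \<in> graph T" by simp
    then show False using y by (simp add: graph_def)
  qed
  have "T x \<noteq> {}" if "x \<in> X" for x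
  proof
    assume "T x = {}"
    then show False using hT[unfolded hall_def, rule_format, of "{x}"] that by simp
  qed
  then have "\<forall>x\<in>X. \<exists>y. y \<in> T x" by blast
  then obtain f where f: "\<And>x. x \<in> X \<Longrightarrow> f x \<in> T x" by metis
  have "inj_on f X"
  proof (rule inj_onI, rule ccontr)
    fix a b assume ab: "a \<in> X" "b \<in> X" "f a = f b" "a \<noteq> b"
    have "T a = {f a}" "T b = {f b}" using single f ab(1,2) by fast+
    then show False using hT[unfolded hall_def, rule_format, of "{a, b}"] ab by simp
  qed
  then show ?thesis using f sub by blast
qed

text \<open>Unlike the library version, this one records that the bijection is made of pieces of \<open>i\<close> and
  of the inverse of \<open>j\<close>.\<close>

lemma Schroeder_Bernstein_pieces:
  assumes i: "inj_on i X" "i ` X \<subseteq> Y" and j: "inj_on j Y" "j ` Y \<subseteq> X"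
  shows "\<exists>h. bij_betw h X Y \<and> (\<forall>x\<in>X. h x = i x \<or> j (h x) = x)"
proof -
  \<comment> \<open>The least fixed point consists of the points whose backward orbit under
    \<open>j\<close> and \<open>i\<close> stops in \<open>X\<close> outside the range of
    \<open>j\<close>. There \<open>i\<close> is used; every other point is the value of
    \<open>j\<close> at a point outside the image of \<open>Z\<close>.\<close>
  define Z where "Z = lfp (\<lambda>Z. X - j ` (Y - i ` Z))"
  have Z: "Z = X - j ` (Y - i ` Z)"
    unfolding Z_def by (rule lfp_unfold) (blast intro: monoI)
  have ZX: "Z \<subseteq> X" and iZ: "i ` Z \<subseteq> Y" using Z i(2) by blast+
  have compl: "j ` (Y - i ` Z) = X - Z" using Z j(2) by blast
  have b1: "bij_betw i Z (i ` Z)"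
    using i(1) ZX by (intro inj_on_imp_bij_betw) (rule inj_on_subset)
  have "bij_betw j (Y - i ` Z) (X - Z)"
    using j(1) compl by (auto simp: bij_betw_def intro: inj_on_subset)
  then have b2: "bij_betw (the_inv_into (Y - i ` Z) j) (X - Z) (Y - i ` Z)"
    by (rule bij_betw_the_inv_into)
  define h where "h x = (if x \<in> Z then i x else the_inv_into (Y - i ` Z) j x)" for x
  have "bij_betw h Z (i ` Z)" using b1 by (subst bij_betw_cong[of Z h i]) (auto simp: h_def)
  moreover have "bij_betw h (X - Z) (Y - i ` Z)"
    using b2 by (subst bij_betw_cong[of "X - Z" h "the_inv_into (Y - i ` Z) j"]) (auto simp: h_def)
  ultimately have "bij_betw h (Z \<union> (X - Z)) (i ` Z \<union> (Y - i ` Z))"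
    by (rule bij_betw_combine) blast
  moreover have "Z \<union> (X - Z) = X" "i ` Z \<union> (Y - i ` Z) = Y" using ZX iZ by blast+
  moreover have "h x = i x \<or> j (h x) = x" if "x \<in> X" for x
  proof (cases "x \<in> Z")
    case False
    then have "x \<in> j ` (Y - i ` Z)" using compl that by blast
    moreover have "inj_on j (Y - i ` Z)" using j(1) by (rule inj_on_subset) blast
    ultimately show ?thesis using False by (simp add: h_def f_the_inv_into_f)
  qed (simp add: h_def)
  ultimately show ?thesis by (intro exI[of _ h]) simp
qed

section \<open>The bijective coarse equivalence\<close>

context ulf_spatial
begin

text \<open>The entry of \<open>U (ell2_basis (f y))\<close> at \<open>y\<close> has modulus at
  least \<delta>, but beyond distance \<open>s\<close> from \<open>g (f y)\<close> this vector has
  norm at most \<delta> / 2.\<close>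

lemma composition_close:
  assumes "\<delta> > 0" and g: "\<And>x. x \<in> X \<Longrightarrow> g x \<in> Y" "\<And>x. x \<in> X \<Longrightarrow> \<delta> \<le> cmod (V (ell2_basis (g x)) x)"
    and f: "\<And>y. y \<in> Y \<Longrightarrow> f y \<in> X" "\<And>y. y \<in> Y \<Longrightarrow> \<delta> \<le> cmod (U (ell2_basis (f y)) y)"
  shows "\<exists>s. \<forall>y\<in>Y. dY (g (f y)) y \<le> s"
proof -
  have "\<delta> / 2 > 0" using assms by simp
  from concentration[OF \<open>\<delta> > 0\<close> g this] obtain s where
    s: "\<forall>x\<in>X. ell2_norm Y (cutoff {z \<in> Y. s < dY (g x) z} (U (ell2_basis x))) \<le> \<delta> / 2" by blast
  have "dY (g (f y)) y \<le> s" if y: "y \<in> Y" for y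
  proof (rule ccontr)
    assume "\<not> ?thesis"
    then have e: "cutoff {z \<in> Y. s < dY (g (f y)) z} (U (ell2_basis (f y))) y = U (ell2_basis (f y)) y"
      using y by (simp add: cutoff_def)
    have "cutoff {z \<in> Y. s < dY (g (f y)) z} (U (ell2_basis (f y))) \<in> ell2 Y"
      using f(1)[OF y] by (intro cutoff_ell2 U_in) simp
    from ell2_coeff_le_norm[OF this, of y] s f[OF y] have "\<delta> \<le> \<delta> / 2"
      unfolding e by force
    then show False using \<open>\<delta> > 0\<close> by simp
  qed
  then show ?thesis by blast
qed

lemma injection_near:
  assumes "\<delta> > 0" and g: "\<And>x. x \<in> X \<Longrightarrow> g x \<in> Y" "\<And>x. x \<in> X \<Longrightarrow> \<delta> \<le> cmod (V (ell2_basis (g x)) x)"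
  shows "\<exists>i R. inj_on i X \<and> i ` X \<subseteq> Y \<and> (\<forall>x\<in>X. dY (g x) (i x) \<le> R)"
proof -
  obtain R where "hall X (\<lambda>x. {z \<in> Y. dY (g x) z \<le> R})"
    using hall_condition[OF assms] unfolding hall_def by blast
  moreover have "finite {z \<in> Y. dY (g x) z \<le> R}" if "x \<in> X" for x
    using ulf_Y g(1)[OF that] unfolding uniformly_locally_finite_def by blast
  ultimately obtain i where "inj_on i X" "\<forall>x\<in>X. i x \<in> {z \<in> Y. dY (g x) z \<le> R}"
    using hall_infinite by blast
  then show ?thesis by blast
qed

text \<open>The bijection pieced together from injections near \<open>g\<close> and near
  \<open>f\<close> stays near \<open>g\<close> on both pieces, so it inherits coarseness from
  \<open>g\<close>, and \<open>f\<close> serves as its coarse inverse.\<close>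

lemma bijective_coarse_equivalence: "bijectively_coarsely_equivalent X dX Y dY"
proof -
  interpret inv: ulf_spatial Y dY X dX V U by (rule inverse_ulf)
  obtain \<delta>1 f where \<delta>1: "\<delta>1 > 0" and f1: "\<And>y. y \<in> Y \<Longrightarrow> f y \<in> X \<and> \<delta>1 \<le> cmod (V (ell2_basis y) (f y))"
    using ex_large_coefficient by metis
  obtain \<delta>2 g where \<delta>2: "\<delta>2 > 0" and g1: "\<And>x. x \<in> X \<Longrightarrow> g x \<in> Y \<and> \<delta>2 \<le> cmod (U (ell2_basis x) (g x))"
    using inv.ex_large_coefficient by metis
  define \<delta> where "\<delta> = min \<delta>1 \<delta>2"
  have \<delta>: "\<delta> > 0" using \<delta>1 \<delta>2 by (simp add: \<delta>_def)
  have fX: "f y \<in> X" and f: "\<delta> \<le> cmod (U (ell2_basis (f y)) y)" if "y \<in> Y" for y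
    using f1[OF that] that by (auto simp: U_coeff \<delta>_def)
  have gY: "g x \<in> Y" and g: "\<delta> \<le> cmod (V (ell2_basis (g x)) x)" if "x \<in> X" for x
    using g1[OF that] that by (auto simp: inv.U_coeff \<delta>_def)
  obtain cg where cg: "\<And>r x x'. x \<in> X \<Longrightarrow> x' \<in> X \<Longrightarrow> dX x x' \<le> r \<Longrightarrow> dY (g x) (g x') \<le> cg r"
    using coarse_bound[OF \<delta> gY g] by metis
  obtain cf where cf: "\<And>r y y'. y \<in> Y \<Longrightarrow> y' \<in> Y \<Longrightarrow> dY y y' \<le> r \<Longrightarrow> dX (f y) (f y') \<le> cf r"
    using inv.coarse_bound[OF \<delta> fX f] by metis
  obtain s where s: "\<And>y. y \<in> Y \<Longrightarrow> dY (g (f y)) y \<le> s"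
    using composition_close[OF \<delta> gY g fX f] by metis
  obtain s' where s': "\<And>x. x \<in> X \<Longrightarrow> dX (f (g x)) x \<le> s'"
    using inv.composition_close[OF \<delta> fX f gY g] by metis
  obtain i R where i: "inj_on i X" "i ` X \<subseteq> Y" "\<And>x. x \<in> X \<Longrightarrow> dY (g x) (i x) \<le> R"
    using injection_near[OF \<delta> gY g] by metis
  obtain j R' where j: "inj_on j Y" "j ` Y \<subseteq> X" "\<And>y. y \<in> Y \<Longrightarrow> dX (f y) (j y) \<le> R'"
    using inv.injection_near[OF \<delta> fX f] by metis
  obtain h where h: "bij_betw h X Y" and pieces: "\<And>x. x \<in> X \<Longrightarrow> h x = i x \<or> j (h x) = x"
    using Schroeder_Bernstein_pieces[OF i(1,2) j(1,2)] by metis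
  have hY: "h x \<in> Y" if "x \<in> X" for x using h that by (rule bij_betw_apply)
  \<comment> \<open>On the piece from \<open>i\<close> the distance to \<open>g x\<close> is at most
    \<open>R\<close>. On the other, \<open>x\<close> is within \<open>R'\<close> of
    \<open>f (h x)\<close>; applying \<open>g\<close> costs \<open>cg R'\<close>, and passing from
    \<open>g (f (h x))\<close> to \<open>h x\<close> costs \<open>s\<close>.\<close>
  define K where "K = max R (cg R' + s)"
  have near: "dY (g x) (h x) \<le> K" if x: "x \<in> X" for x
    using pieces[OF x]
  proof
    assume "h x = i x" then show ?thesis using i(3)[OF x] by (simp add: K_def)
  next
    assume jx: "j (h x) = x"
    have "dX x (f (h x)) \<le> R'" using j(3)[OF hY[OF x]] jx X.commute[of x] by simp
    then have "dY (g x) (g (f (h x))) \<le> cg R'" by (intro cg x fX hY)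
    moreover have "dY (g x) (h x) \<le> dY (g x) (g (f (h x))) + dY (g (f (h x))) (h x)"
      by (intro Y.triangle gY fX hY x)
    ultimately show ?thesis using s[OF hY[OF x]] by (simp add: K_def)
  qed
  have coarse_h: "coarse_map X dX Y dY h"
    unfolding coarse_map_def
  proof (intro conjI allI impI)
    show "h \<in> X \<rightarrow> Y" using hY by blast
    fix r :: real
    show "\<exists>s>0. \<forall>x\<in>X. \<forall>z\<in>X. dX x z < r \<longrightarrow> dY (h x) (h z) < s"
    proof (intro exI[of _ "\<bar>2 * K + cg r\<bar> + 1"] conjI ballI impI)
      fix x z assume xz: "x \<in> X" "z \<in> X" "dX x z < r"
      have "dY (g x) (g z) \<le> cg r" using xz by (intro cg) auto
      moreover have "dY (h x) (h z) \<le> dY (h x) (g x) + dY (g x) (h z)"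
        "dY (g x) (h z) \<le> dY (g x) (g z) + dY (g z) (h z)"
        using xz by (intro Y.triangle hY gY; simp)+
      ultimately show "dY (h x) (h z) < \<bar>2 * K + cg r\<bar> + 1"
        using near[OF xz(1)] near[OF xz(2)] Y.commute[of "h x" "g x"] by linarith
    qed simp
  qed
  have coarse_f: "coarse_map Y dY X dX f"
    unfolding coarse_map_def
  proof (intro conjI allI impI)
    show "f \<in> Y \<rightarrow> X" using fX by blast
    fix r :: real
    show "\<exists>s>0. \<forall>x\<in>Y. \<forall>z\<in>Y. dY x z < r \<longrightarrow> dX (f x) (f z) < s"
    proof (intro exI[of _ "\<bar>cf r\<bar> + 1"] conjI ballI impI)
      fix x z assume "x \<in> Y" "z \<in> Y" "dY x z < r"
      then have "dX (f x) (f z) \<le> cf r" by (intro cf) auto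
      then show "dX (f x) (f z) < \<bar>cf r\<bar> + 1" by linarith
    qed simp
  qed
  have "close_maps X dX (f \<circ> h) id"
    unfolding close_maps_def
  proof (rule bdd_aboveI2)
    fix x assume x: "x \<in> X"
    have "dX (f (h x)) (f (g x)) \<le> cf K"
      using near[OF x] by (intro cf hY gY x) (simp add: Y.commute)
    moreover have "dX (f (h x)) x \<le> dX (f (h x)) (f (g x)) + dX (f (g x)) x"
      by (intro X.triangle fX hY gY x)
    ultimately show "dX ((f \<circ> h) x) (id x) \<le> cf K + s'" using s'[OF x] by simp
  qed
  moreover have "close_maps Y dY (h \<circ> f) id"
    unfolding close_maps_def
  proof (rule bdd_aboveI2)
    fix y assume y: "y \<in> Y"
    have "dY (h (f y)) y \<le> dY (h (f y)) (g (f y)) + dY (g (f y)) y"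
      by (intro Y.triangle fX hY gY y)
    then show "dY ((h \<circ> f) y) (id y) \<le> K + s"
      using near[OF fX[OF y]] s[OF y] Y.commute[of "h (f y)"] by simp
  qed
  ultimately have "coarse_equivalence X dX Y dY h"
    unfolding coarse_equivalence_def using coarse_h coarse_f by blast
  with h show ?thesis unfolding bijectively_coarsely_equivalent_def by blast
qed

end

section \<open>Coarse disjoint unions of expander graphs\<close>

text \<open>A walk has at most \<open>k\<close> continuations at each step. Balls in a graph of
  bounded degree are covered by the endpoints of short walks.\<close>

lemma card_relpow_image_le:
  fixes E :: "'a rel"
  assumes "\<And>u. finite (E `` {u}) \<and> card (E `` {u}) \<le> k"
  shows "finite ((E ^^ n) `` {v}) \<and> card ((E ^^ n) `` {v}) \<le> k ^ n"
proof (induction n)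
  case (Suc n)
  let ?S = "(E ^^ n) `` {v}"
  have eq: "(E ^^ Suc n) `` {v} = (\<Union>u\<in>?S. E `` {u})" by auto
  have "card (\<Union>u\<in>?S. E `` {u}) \<le> (\<Sum>u\<in>?S. card (E `` {u}))"
    by (rule card_UN_le) (use Suc in simp)
  also have "\<dots> \<le> card ?S * k" using sum_bounded_above[of ?S "\<lambda>u. card (E `` {u})" k] assms by simp
  also have "\<dots> \<le> k ^ n * k" using Suc by simp
  finally show ?case using Suc assms unfolding eq by (simp add: mult.commute)
qed simp

text \<open>Within its own summand a ball consists of endpoints of short walks, which the degree
  bound counts. Its remaining points lie in a finite set \<open>Z\<close> independent of the centre,
  because only finitely many pairs of summands come within \<open>r\<close>. Nonemptiness supplies
  the base point for constructing \<open>U\<close>.\<close>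

lemma coarse_disjoint_union_of_expanders_ulf:
  assumes "coarse_disjoint_union_of_expanders X d"
  shows "uniformly_locally_finite X d" "Metric_space X d" "X \<noteq> {}"
proof -
  obtain V E where exp: "expander_sequence V E"
    and cdu: "coarse_disjoint_union V (\<lambda>n. graph_dist (E n)) X d"
    using assms unfolding coarse_disjoint_union_of_expanders_def by blast
  obtain k h where kh: "\<And>n. expander_graph k h (V n) (E n)"
    using exp unfolding expander_sequence_def by blast
  have lim: "filterlim (\<lambda>n. card (V n)) at_top sequentially"
    using exp unfolding expander_sequence_def by blast
  have finV: "\<And>n. finite (V n)" and X: "X = (\<Union>n. V n)"
    and dist: "\<And>n x y. x \<in> V n \<Longrightarrow> y \<in> V n \<Longrightarrow> ereal (d x y) = graph_dist (E n) x y"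
    and sep: "\<And>R. finite {(n, m). n \<noteq> m \<and> \<not> (INF x\<in>V n. INF y\<in>V m. ereal (d x y)) > ereal R}"
    using cdu unfolding coarse_disjoint_union_def by blast+
  show "Metric_space X d" using cdu unfolding coarse_disjoint_union_def by blast
  have "\<forall>\<^sub>F n in sequentially. 1 \<le> card (V n)" using lim by (simp add: filterlim_at_top)
  then obtain n where "1 \<le> card (V n)" by (auto simp: eventually_sequentially)
  then have "V n \<noteq> {}" by auto
  then show "X \<noteq> {}" using X by blast
  have deg: "finite (E n `` {u}) \<and> card (E n `` {u}) \<le> k" for n u
  proof -
    have E: "E n \<subseteq> V n \<times> V n" and le: "\<forall>v\<in>V n. card (E n `` {v}) \<le> k"
      using kh[of n] unfolding expander_graph_def finite_graph_def by blast+
    have "finite (E n `` {u})" by (rule finite_subset[OF _ finV[of n]]) (use E in blast)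
    moreover have "E n `` {u} = {}" if "u \<notin> V n" using E that by blast
    then have "card (E n `` {u}) \<le> k" using le by (cases "u \<in> V n") simp_all
    ultimately show ?thesis ..
  qed
  show "uniformly_locally_finite X d"
    unfolding uniformly_locally_finite_def
  proof
    fix r :: real
    define P where "P = {(n, m). n \<noteq> m \<and> \<not> (INF x\<in>V n. INF y\<in>V m. ereal (d x y)) > ereal r}"
    define Z where "Z = (\<Union>(n, m)\<in>P. V m)"
    have Z: "finite Z" unfolding Z_def using sep[of r] finV by (auto simp: P_def)
    \<comment> \<open>A distance at most \<open>r\<close> is below \<open>r + 1\<close>, so some
      actual walk has length below \<open>r + 1\<close>; the extra 1 pays for the strict inequality
      that the infimum requires.\<close>
    define m where "m = nat \<lceil>r + 1\<rceil>"
    define W where "W n x = (\<Union>l\<le>m. (E n ^^ l) `` {x})" for n x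
    have W: "finite (W n x) \<and> card (W n x) \<le> (\<Sum>l\<le>m. k ^ l)" for n x
    proof -
      note rel = card_relpow_image_le[of "E n" k, OF deg]
      have "card (W n x) \<le> (\<Sum>l\<le>m. card ((E n ^^ l) `` {x}))"
        unfolding W_def by (rule card_UN_le) simp
      also have "\<dots> \<le> (\<Sum>l\<le>m. k ^ l)" by (intro sum_mono) (use rel in blast)
      finally show ?thesis using rel unfolding W_def by blast
    qed
    have ball: "{z \<in> X. d x z \<le> r} \<subseteq> W n x \<union> Z" if x: "x \<in> V n" for x n
    proof
      fix z assume z: "z \<in> {z \<in> X. d x z \<le> r}"
      then obtain n' where n': "z \<in> V n'" using X by blast
      show "z \<in> W n x \<union> Z"
      proof (cases "n' = n")
        case True
        have "graph_dist (E n) x z < ereal (r + 1)"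
          using dist[OF x, of z] n' True z by (simp flip: dist[OF x])
        then obtain l where l: "(x, z) \<in> E n ^^ l" "real l < r + 1"
          unfolding graph_dist_def INF_less_iff by auto
        then have "l \<le> m" unfolding m_def by linarith
        then show ?thesis using l unfolding W_def by blast
      next
        case False
        have "(INF x\<in>V n. INF y\<in>V n'. ereal (d x y)) \<le> ereal (d x z)"
          by (rule INF_lower2[OF x INF_lower[OF n']])
        also have "\<dots> \<le> ereal r" using z by simp
        finally have "(n, n') \<in> P" using False by (simp add: P_def not_less)
        then show ?thesis using n' unfolding Z_def by blast
      qed
    qed
    show "\<exists>N. \<forall>x\<in>X. finite {z \<in> X. d x z \<le> r} \<and> card {z \<in> X. d x z \<le> r} \<le> N"
    proof (intro exI[of _ "(\<Sum>l\<le>m. k ^ l) + card Z"] ballI)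
      fix x assume "x \<in> X"
      then obtain n where x: "x \<in> V n" using X by blast
      have fin: "finite (W n x \<union> Z)" using W Z by blast
      have "card {z \<in> X. d x z \<le> r} \<le> card (W n x \<union> Z)" by (rule card_mono[OF fin ball[OF x]])
      also have "\<dots> \<le> card (W n x) + card Z" by (rule card_Un_le)
      also have "\<dots> \<le> (\<Sum>l\<le>m. k ^ l) + card Z" using W[of n x] by simp
      finally show "finite {z \<in> X. d x z \<le> r} \<and> card {z \<in> X. d x z \<le> r} \<le> (\<Sum>l\<le>m. k ^ l) + card Z"
        using finite_subset[OF ball[OF x] fin] by blast
    qed
  qed
qed

theorem theorem1p4:
  fixes X :: "'a set" and dX :: "'a \<Rightarrow> 'a \<Rightarrow> real"
    and Y :: "'b set" and dY :: "'b \<Rightarrow> 'b \<Rightarrow> real"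
  assumes "coarse_disjoint_union_of_expanders X dX"
    and "coarse_disjoint_union_of_expanders Y dY"
    and "uniform_roe_isomorphic X dX Y dY"
  shows "bijectively_coarsely_equivalent X dX Y dY"
proof -
  note X = coarse_disjoint_union_of_expanders_ulf[OF assms(1)]
  note Y = coarse_disjoint_union_of_expanders_ulf[OF assms(2)]
  obtain \<Phi> where \<Phi>: "star_isomorphism X (uniform_roe X dX) Y (uniform_roe Y dY) \<Phi>"
    using assms(3) unfolding uniform_roe_isomorphic_def by blast
  obtain x0 where "x0 \<in> X" using X(3) by blast
  from star_isomorphism_spatial[OF \<Phi> this] obtain U V where "roe_spatial X dX Y dY U V" by blast
  then have "ulf_spatial X dX Y dY U V"
    by (intro ulf_spatial.intro ulf_spatial_axioms.intro X(1,2) Y(1,2))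
  then show ?thesis by (rule ulf_spatial.bijective_coarse_equivalence)
qed

end
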